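(* Let $(\mathfrak g_1,\mathfrak g_2)$ be a matched pair of Lie algebras and let $V$ be a left module over the double crossed sum Lie algebra $\mathfrak g_1\bowtie\mathfrak g_2$ such that the $\mathfrak g_2$-action is locally finite. Then, as a $\mathfrak g_1$-module by restriction and an $R(\mathfrak g_2)$-comodule by the coaction $v\mapsto v_{\langle0\rangle}\otimes v_{\langle1\rangle}\in V\otimes R(\mathfrak g_2)$ determined by $u'\cdot v=v_{\langle1\rangle}(u')v_{\langle0\rangle}$ for all $u'\in U(\mathfrak g_2)$, $V$ is an induced $(\mathfrak g_1,R(\mathfrak g_2))$-module. Conversely, every induced $(\mathfrak g_1,R(\mathfrak g_2))$-module arises in this way.
   Context: Everything is over $\mathbb C$; Lie algebras are finite dimensional; Sweedler notation is used. **Matched pair of Lie algebras.** $(\mathfrak g_1,\mathfrak g_2)$ with linear maps $\mathfrak g_2\otimes\mathfrak g_1\to\mathfrak g_1$, $\xi\otimes X\mapsto\xi\triangleright X$, and $\mathfrak g_2\otimes\mathfrak g_1\to\mathfrak g_2$, $\xi\otimes X\mapsto\xi\triangleleft X$, such that for all $X,Y\in\mathfrak g_1$, $\zeta,\xi\in\mathfrak g_2$: $[\zeta,\xi]\triangleright X=\zeta\triangleright(\xi\triangleright X)-\xi\triangleright(\zeta\triangleright X)$; $\zeta\triangleleft[X,Y]=(\zeta\triangleleft X)\triangleleft Y-(\zeta\triangleleft Y)\triangleleft X$; $\zeta\triangleright[X,Y]=[\zeta\triangleright X,Y]+[X,\zeta\triangleright Y]+(\zeta\triangleleft X)\triangleright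 Y-(\zeta\triangleleft Y)\triangleright X$; $[\zeta,\xi]\triangleleft X=[\zeta\triangleleft X,\xi]+[\zeta,\xi\triangleleft X]+\zeta\triangleleft(\xi\triangleright X)-\xi\triangleleft(\zeta\triangleright X)$. The double crossed sum $\mathfrak g_1\bowtie\mathfrak g_2$ is $\mathfrak g_1\oplus\mathfrak g_2$ with the Lie bracket for which $\mathfrak g_1,\mathfrak g_2$ are subalgebras and $[\xi,X]=\xi\triangleright X+\xi\triangleleft X$. **Mutual actions of enveloping algebras.** Using $U(\mathfrak g_1)\otimes U(\mathfrak g_2)\cong U(\mathfrak g_1\bowtie\mathfrak g_2)$ (multiplication), for $u'\in U(\mathfrak g_2)$, $u\in U(\mathfrak g_1)$ write $u'u=\sum_ip_iq_i$, $p_i\in U(\mathfrak g_1)$, $q_i\in U(\mathfrak g_2)$; then $u'\triangleright u:=\sum_ip_i\varepsilon(q_i)$ and $u'\triangleleft u:=\sum_i\varepsilon(p_i)q_i$. **$R(\mathfrak g_2)$.** The commutative Hopf algebra of those $f\in\mathrm{Hom}(U(\mathfrak g_2),\mathbb C)$ for which there is a two-sided ideal $I\subseteq\ker f$ with $\dim(\ker f/I)<\infty$; $(fg)(u)=f(u_{(1)})g(u_{(2)})$, $f_{(1)}(u^1)f_{(2)}(u^2)=f(u^1u^2)$, $\varepsilon(f)=f(1)$, $S(f)(u)=f(S(u))$. The Lie algebra $\mathfrak g_1$ acts on it by $(X\triangleright f)(u')=f(u'\triangleleft X)$, and it coacts on $\mathfrak g_1$ by $X\mapsto X_{\langle0\rangle}\otimes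 X_{\langle1\rangle}\in\mathfrak g_1\otimes R(\mathfrak g_2)$ determined by $u'\triangleright X=X_{\langle1\rangle}(u')X_{\langle0\rangle}$ for $u'\in U(\mathfrak g_2)$. **Induced modules.** An induced $(\mathfrak g_1,R(\mathfrak g_2))$-module is a left $\mathfrak g_1$-module $V$ with a right $R(\mathfrak g_2)$-coaction $\nabla_V(v)=v_{\langle0\rangle}\otimes v_{\langle1\rangle}$ such that $\nabla_V(X\cdot v)=X_{\langle0\rangle}\cdot v_{\langle0\rangle}\otimes X_{\langle1\rangle}v_{\langle1\rangle}+v_{\langle0\rangle}\otimes X\triangleright v_{\langle1\rangle}$ for all $X\in\mathfrak g_1$, $v\in V$. *)

theory Defs
  imports
    Complex_Main
    "HOL-Library.Poly_Mapping"
    "HOL-Library.Function_Algebras"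
    "HOL-Library.Product_Plus"
    "HOL-Algebra.QuotRing"
begin

section \<open>Lie algebras and modules\<close>

text \<open>
  Lie algebras and their modules live on whole types of class \<^class>\<open>ab_group_add\<close>; the scalar
  multiplication and the bracket are data, because the bracket of a double crossed sum depends on
  the matched pair.
\<close>

record 'a lie =
  lscale :: "complex \<Rightarrow> 'a \<Rightarrow> 'a"
  lbracket :: "'a \<Rightarrow> 'a \<Rightarrow> 'a"

definition bilinear_map ::
  "(complex \<Rightarrow> 'a \<Rightarrow> 'a) \<Rightarrow> (complex \<Rightarrow> 'b \<Rightarrow> 'b) \<Rightarrow> (complex \<Rightarrow> 'c \<Rightarrow> 'c)
    \<Rightarrow> ('a::ab_group_add \<Rightarrow> 'b::ab_group_add \<Rightarrow> 'c::ab_group_add) \<Rightarrow> bool" where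
  "bilinear_map sa sb sc f \<longleftrightarrow>
     (\<forall>y. Vector_Spaces.linear sa sc (\<lambda>x. f x y)) \<and> (\<forall>x. Vector_Spaces.linear sb sc (f x))"

definition lie_algebra :: "'a::ab_group_add lie \<Rightarrow> bool" where
  "lie_algebra L \<longleftrightarrow>
     bilinear_map (lscale L) (lscale L) (lscale L) (lbracket L) \<and>
     (\<forall>x. lbracket L x x = 0) \<and>
     (\<forall>x y z. lbracket L x (lbracket L y z) + lbracket L y (lbracket L z x)
              + lbracket L z (lbracket L x y) = 0)"

definition finite_dim_lie_algebra :: "'a::ab_group_add lie \<Rightarrow> bool" where
  "finite_dim_lie_algebra L \<longleftrightarrow>
     lie_algebra L \<and> (\<exists>B. finite B \<and> module.span (lscale L) B = UNIV)"

definition lie_module ::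
  "'a::ab_group_add lie \<Rightarrow> (complex \<Rightarrow> 'v \<Rightarrow> 'v) \<Rightarrow> ('a \<Rightarrow> 'v::ab_group_add \<Rightarrow> 'v) \<Rightarrow> bool" where
  "lie_module L s act \<longleftrightarrow>
     bilinear_map (lscale L) s s act \<and>
     (\<forall>x y v. act (lbracket L x y) v = act x (act y v) - act y (act x v))"

definition locally_finite ::
  "(complex \<Rightarrow> 'v \<Rightarrow> 'v) \<Rightarrow> ('a \<Rightarrow> 'v::ab_group_add \<Rightarrow> 'v) \<Rightarrow> bool" where
  "locally_finite s act \<longleftrightarrow>
     (\<forall>v. \<exists>W. module.subspace s W \<and> (\<forall>x. \<forall>w\<in>W. act x w \<in> W) \<and> v \<in> W \<and>
              (\<exists>B. finite B \<and> W = module.span s B))"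


section \<open>Matched pairs and the double crossed sum\<close>

text \<open>\<open>la M \<xi> X\<close> is \<open>\<xi> \<triangleright> X\<close> and \<open>ra M \<xi> X\<close> is \<open>\<xi> \<triangleleft> X\<close>, for \<open>\<xi>\<close> in the second and
  \<open>X\<close> in the first Lie algebra.\<close>

record ('a, 'b) lie_pair =
  g1 :: "'a lie"
  g2 :: "'b lie"
  la :: "'b \<Rightarrow> 'a \<Rightarrow> 'a"
  ra :: "'b \<Rightarrow> 'a \<Rightarrow> 'b"

definition matched_pair :: "('a::ab_group_add, 'b::ab_group_add) lie_pair \<Rightarrow> bool" where
  "matched_pair M \<longleftrightarrow>
     finite_dim_lie_algebra (g1 M) \<and> finite_dim_lie_algebra (g2 M) \<and>
     bilinear_map (lscale (g2 M)) (lscale (g1 M)) (lscale (g1 M)) (la M) \<and>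
     bilinear_map (lscale (g2 M)) (lscale (g1 M)) (lscale (g2 M)) (ra M) \<and>
     (\<forall>\<zeta> \<xi> X. la M (lbracket (g2 M) \<zeta> \<xi>) X = la M \<zeta> (la M \<xi> X) - la M \<xi> (la M \<zeta> X)) \<and>
     (\<forall>\<zeta> X Y. ra M \<zeta> (lbracket (g1 M) X Y) = ra M (ra M \<zeta> X) Y - ra M (ra M \<zeta> Y) X) \<and>
     (\<forall>\<zeta> X Y. la M \<zeta> (lbracket (g1 M) X Y)
        = lbracket (g1 M) (la M \<zeta> X) Y + lbracket (g1 M) X (la M \<zeta> Y)
          + la M (ra M \<zeta> X) Y - la M (ra M \<zeta> Y) X) \<and>
     (\<forall>\<zeta> \<xi> X. ra M (lbracket (g2 M) \<zeta> \<xi>) X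
        = lbracket (g2 M) (ra M \<zeta> X) \<xi> + lbracket (g2 M) \<zeta> (ra M \<xi> X)
          + ra M \<zeta> (la M \<xi> X) - ra M \<xi> (la M \<zeta> X))"

text \<open>The bracket of \<open>X + \<xi>\<close> and \<open>Y + \<zeta>\<close>, expanded with
  \<open>[\<xi>, Y] = \<xi> \<triangleright> Y + \<xi> \<triangleleft> Y\<close> and \<open>[X, \<zeta>] = - (\<zeta> \<triangleright> X) - (\<zeta> \<triangleleft> X)\<close>.\<close>

definition double_crossed_sum ::
  "('a::ab_group_add, 'b::ab_group_add) lie_pair \<Rightarrow> ('a \<times> 'b) lie" where
  "double_crossed_sum M =
     \<lparr> lscale = (\<lambda>c (X, \<xi>). (lscale (g1 M) c X, lscale (g2 M) c \<xi>)),
       lbracket = (\<lambda>(X, \<xi>) (Y, \<zeta>).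
         (lbracket (g1 M) X Y + la M \<xi> Y - la M \<zeta> X,
          lbracket (g2 M) \<xi> \<zeta> + ra M \<xi> Y - ra M \<zeta> X)) \<rparr>"


section \<open>Universal enveloping algebras\<close>

text \<open>
  The free algebra on the set of all elements of \<open>'a\<close> consists of the finitely supported functions
  on words, with concatenation of words as product. The linearity relations together with the
  commutator relations generate the ideal by which it is divided; dividing by the linearity
  relations alone yields the tensor algebra.
\<close>

instantiation list :: (type) monoid_add
begin
definition "(0 :: 'a list) = []"
definition "(xs :: 'a list) + ys = xs @ ys"
instance by standard (simp_all add: zero_list_def plus_list_def)
end

type_synonym 'a free_alg = "'a list \<Rightarrow>\<^sub>0 complex"
type_synonym 'a ue = "'a free_alg set"

definition FA :: "'a free_alg ring" where
  "FA = \<lparr> carrier = UNIV, mult = (*), one = 1, zero = 0, add = (+) \<rparr>"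

definition const :: "complex \<Rightarrow> 'a free_alg" where
  "const c = Poly_Mapping.single [] c"

definition word :: "'a list \<Rightarrow> 'a free_alg" where
  "word w = Poly_Mapping.single w 1"

abbreviation gen :: "'a \<Rightarrow> 'a free_alg" where
  "gen x \<equiv> word [x]"

text \<open>Linear extension of a function on words.\<close>

definition lin_ext :: "(complex \<Rightarrow> 'c \<Rightarrow> 'c) \<Rightarrow> ('a list \<Rightarrow> 'c::comm_monoid_add) \<Rightarrow> 'a free_alg \<Rightarrow> 'c" where
  "lin_ext s g x = (\<Sum>w\<in>Poly_Mapping.keys x. s (Poly_Mapping.lookup x w) (g w))"

definition uea_relations :: "'a::ab_group_add lie \<Rightarrow> 'a free_alg set" where
  "uea_relations L =
     {gen (x + y) - gen x - gen y | x y. True} \<union>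
     {gen (lscale L c x) - const c * gen x | c x. True} \<union>
     {gen x * gen y - gen y * gen x - gen (lbracket L x y) | x y. True}"

definition uea_ideal :: "'a::ab_group_add lie \<Rightarrow> 'a free_alg set" where
  "uea_ideal L = Idl\<^bsub>FA\<^esub> (uea_relations L)"

definition UEA :: "'a::ab_group_add lie \<Rightarrow> 'a ue ring" where
  "UEA L = FA Quot (uea_ideal L)"

definition uclass :: "'a::ab_group_add lie \<Rightarrow> 'a free_alg \<Rightarrow> 'a ue" where
  "uclass L x = uea_ideal L +>\<^bsub>FA\<^esub> x"

definition \<iota> :: "'a::ab_group_add lie \<Rightarrow> 'a \<Rightarrow> 'a ue" where
  "\<iota> L x = uclass L (gen x)"

definition uscale :: "'a::ab_group_add lie \<Rightarrow> complex \<Rightarrow> 'a ue \<Rightarrow> 'a ue" where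
  "uscale L c u = uclass L (const c) \<otimes>\<^bsub>UEA L\<^esub> u"

text \<open>Maps out of the quotient are given on representatives, and \<^const>\<open>the_elem\<close> extracts the
  common value on a class. The counit sends all nonempty words to 0, so it reads off the
  coefficient of the empty word.\<close>

definition ucounit :: "'a ue \<Rightarrow> complex" where
  "ucounit u = the_elem ((\<lambda>x. Poly_Mapping.lookup x []) ` u)"

definition umap :: "'b::ab_group_add lie \<Rightarrow> ('a \<Rightarrow> 'b) \<Rightarrow> 'a ue \<Rightarrow> 'b ue" where
  "umap L h u =
     the_elem ((\<lambda>x. uclass L (lin_ext (\<lambda>c y. const c * y) (\<lambda>w. word (map h w)) x)) ` u)"

text \<open>The action of the enveloping algebra on a Lie algebra module.\<close>

definition uact ::
  "(complex \<Rightarrow> 'v \<Rightarrow> 'v) \<Rightarrow> ('a \<Rightarrow> 'v::ab_group_add \<Rightarrow> 'v) \<Rightarrow> 'a ue \<Rightarrow> 'v \<Rightarrow> 'v" where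
  "uact s act u v = the_elem ((\<lambda>x. lin_ext s (\<lambda>w. foldr act w v) x) ` u)"


section \<open>Mutual actions of the enveloping algebras\<close>

text \<open>\<open>factorisation M u' u n p q\<close>: in the enveloping algebra of the double crossed sum,
  \<open>u' u = (\<Sum>i<n. p i * q i)\<close>. Multiplication is an isomorphism from the tensor product of the two
  enveloping algebras, so the factorisation exists, and the sums in \<open>mutual_left\<close> and
  \<open>mutual_right\<close> do not depend on its choice.\<close>

definition factorisation ::
  "('a::ab_group_add, 'b::ab_group_add) lie_pair \<Rightarrow> 'b ue \<Rightarrow> 'a ue \<Rightarrow>
    nat \<Rightarrow> (nat \<Rightarrow> 'a ue) \<Rightarrow> (nat \<Rightarrow> 'b ue) \<Rightarrow> bool" where
  "factorisation M u' u n p q \<longleftrightarrow>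
     (let D = double_crossed_sum M; i1 = umap D (\<lambda>X. (X, 0)); i2 = umap D (\<lambda>\<xi>. (0, \<xi>)) in
      p \<in> {..<n} \<rightarrow> carrier (UEA (g1 M)) \<and> q \<in> {..<n} \<rightarrow> carrier (UEA (g2 M)) \<and>
      i2 u' \<otimes>\<^bsub>UEA D\<^esub> i1 u = (\<Oplus>\<^bsub>UEA D\<^esub> i\<in>{..<n}. i1 (p i) \<otimes>\<^bsub>UEA D\<^esub> i2 (q i)))"

definition mutual_left ::
  "('a::ab_group_add, 'b::ab_group_add) lie_pair \<Rightarrow> 'b ue \<Rightarrow> 'a ue \<Rightarrow> 'a ue" where
  "mutual_left M u' u =
     (THE w. \<exists>n p q. factorisation M u' u n p q \<and>
        w = (\<Oplus>\<^bsub>UEA (g1 M)\<^esub> i\<in>{..<n}. uscale (g1 M) (ucounit (q i)) (p i)))"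

definition mutual_right ::
  "('a::ab_group_add, 'b::ab_group_add) lie_pair \<Rightarrow> 'b ue \<Rightarrow> 'a ue \<Rightarrow> 'b ue" where
  "mutual_right M u' u =
     (THE w. \<exists>n p q. factorisation M u' u n p q \<and>
        w = (\<Oplus>\<^bsub>UEA (g2 M)\<^esub> i\<in>{..<n}. uscale (g2 M) (ucounit (p i)) (q i)))"


section \<open>Tensor products\<close>

record 'a cvs =
  vcar :: "'a set"
  vadd :: "'a \<Rightarrow> 'a \<Rightarrow> 'a"
  vscale :: "complex \<Rightarrow> 'a \<Rightarrow> 'a"

definition whole_space :: "(complex \<Rightarrow> 'a \<Rightarrow> 'a) \<Rightarrow> 'a::ab_group_add cvs" where
  "whole_space s = \<lparr> vcar = UNIV, vadd = (+), vscale = s \<rparr>"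

definition uea_space :: "'a::ab_group_add lie \<Rightarrow> 'a ue cvs" where
  "uea_space L = \<lparr> vcar = carrier (UEA L), vadd = add (UEA L), vscale = uscale L \<rparr>"

definition fscale :: "complex \<Rightarrow> ('x \<Rightarrow> complex) \<Rightarrow> 'x \<Rightarrow> complex" where
  "fscale c f = (\<lambda>x. c * f x)"

definition function_space :: "('x \<Rightarrow> complex) set \<Rightarrow> ('x \<Rightarrow> complex) cvs" where
  "function_space F = \<lparr> vcar = F, vadd = (+), vscale = fscale \<rparr>"

definition bilinear_form :: "'a cvs \<Rightarrow> 'b cvs \<Rightarrow> ('a \<Rightarrow> 'b \<Rightarrow> complex) \<Rightarrow> bool" where
  "bilinear_form A B \<beta> \<longleftrightarrow>
     (\<forall>a\<in>vcar A. \<forall>a'\<in>vcar A. \<forall>b\<in>vcar B. \<beta> (vadd A a a') b = \<beta> a b + \<beta> a' b) \<and>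
     (\<forall>a\<in>vcar A. \<forall>b\<in>vcar B. \<forall>b'\<in>vcar B. \<beta> a (vadd B b b') = \<beta> a b + \<beta> a b') \<and>
     (\<forall>c. \<forall>a\<in>vcar A. \<forall>b\<in>vcar B. \<beta> (vscale A c a) b = c * \<beta> a b) \<and>
     (\<forall>c. \<forall>a\<in>vcar A. \<forall>b\<in>vcar B. \<beta> a (vscale B c b) = c * \<beta> a b)"

text \<open>
  Over a field, evaluation embeds the tensor product of two vector spaces into the dual of the
  space of bilinear forms. The tensor product is modelled as the image of this embedding, so that
  equality of tensors is equality in HOL; its universal property is proved below.
\<close>

type_synonym ('a, 'b) tensor = "('a \<Rightarrow> 'b \<Rightarrow> complex) \<Rightarrow> complex"

definition tens :: "'a cvs \<Rightarrow> 'b cvs \<Rightarrow> 'a \<Rightarrow> 'b \<Rightarrow> ('a, 'b) tensor" where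
  "tens A B a b = (\<lambda>\<beta>. if bilinear_form A B \<beta> then \<beta> a b else 0)"

definition tensor_rep ::
  "'a cvs \<Rightarrow> 'b cvs \<Rightarrow> ('a, 'b) tensor \<Rightarrow> nat \<Rightarrow> (nat \<Rightarrow> 'a) \<Rightarrow> (nat \<Rightarrow> 'b) \<Rightarrow> bool" where
  "tensor_rep A B t n a b \<longleftrightarrow>
     a \<in> {..<n} \<rightarrow> vcar A \<and> b \<in> {..<n} \<rightarrow> vcar B \<and> t = (\<Sum>i<n. tens A B (a i) (b i))"

definition tensor_product :: "'a cvs \<Rightarrow> 'b cvs \<Rightarrow> ('a, 'b) tensor cvs" where
  "tensor_product A B = function_space {t. \<exists>n a b. tensor_rep A B t n a b}"

text \<open>Sweedler notation: \<open>tlift A B F t\<close> is the sum of all \<open>F t\<^sub>0 t\<^sub>1\<close> for the tensor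
  \<open>t = t\<^sub>0 \<otimes> t\<^sub>1\<close>. It is independent of the representation of \<open>t\<close> if \<open>F\<close> is bilinear.\<close>

definition tlift ::
  "'a cvs \<Rightarrow> 'b cvs \<Rightarrow> ('a \<Rightarrow> 'b \<Rightarrow> 'c::comm_monoid_add) \<Rightarrow> ('a, 'b) tensor \<Rightarrow> 'c" where
  "tlift A B F t = (THE z. \<exists>n a b. tensor_rep A B t n a b \<and> z = (\<Sum>i<n. F (a i) (b i)))"

lemma sum_fun_apply: "(\<Sum>i\<in>I. f i) x = (\<Sum>i\<in>I. f i x :: complex)"
  by (induction I rule: infinite_finite_induct) auto

lemma tlift_eq:
  fixes F :: "'a \<Rightarrow> 'b \<Rightarrow> 'c::ab_group_add"
  assumes s: "vector_space s"
    and F: "\<And>a a' b. a \<in> vcar A \<Longrightarrow> a' \<in> vcar A \<Longrightarrow> b \<in> vcar B \<Longrightarrow> F (vadd A a a') b = F a b + F a' b"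
      "\<And>a b b'. a \<in> vcar A \<Longrightarrow> b \<in> vcar B \<Longrightarrow> b' \<in> vcar B \<Longrightarrow> F a (vadd B b b') = F a b + F a b'"
      "\<And>c a b. a \<in> vcar A \<Longrightarrow> b \<in> vcar B \<Longrightarrow> F (vscale A c a) b = s c (F a b)"
      "\<And>c a b. a \<in> vcar A \<Longrightarrow> b \<in> vcar B \<Longrightarrow> F a (vscale B c b) = s c (F a b)"
    and t: "tensor_rep A B t n a b"
  shows "tlift A B F t = (\<Sum>i<n. F (a i) (b i))"
  unfolding tlift_def
proof (rule the_equality)
  show "\<exists>n' a' b'. tensor_rep A B t n' a' b' \<and> (\<Sum>i<n. F (a i) (b i)) = (\<Sum>i<n'. F (a' i) (b' i))"
    using t by blast
next
  fix z
  assume "\<exists>n' a' b'. tensor_rep A B t n' a' b' \<and> z = (\<Sum>i<n'. F (a' i) (b' i))"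
  then obtain n' a' b' where t': "tensor_rep A B t n' a' b'" and z: "z = (\<Sum>i<n'. F (a' i) (b' i))"
    by blast
  interpret vector_space s by (rule s)
  interpret C: vector_space "(*) :: complex \<Rightarrow> complex \<Rightarrow> complex"
    by standard (auto simp: algebra_simps)
  interpret P: vector_space_pair s "(*) :: complex \<Rightarrow> complex \<Rightarrow> complex" ..
  define w where "w = (\<Sum>i<n. F (a i) (b i))"
  show "z = w"
  proof (rule ccontr)
    assume "z \<noteq> w"
    then have "independent {z - w}"
      by simp
    then obtain g where g: "Vector_Spaces.linear s (*) g" and g1: "g (z - w) = 1"
      using P.linear_independent_extend[of "{z - w}" "\<lambda>_. 1"] by auto
    interpret g: Vector_Spaces.linear s "(*)" g by (rule g)
    have "bilinear_form A B (\<lambda>a b. g (F a b))"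
      by (auto simp: bilinear_form_def F g.add g.scale)
    then have eval: "(\<Sum>i<m. tens A B (x i) (y i)) (\<lambda>a b. g (F a b)) = g (\<Sum>i<m. F (x i) (y i))"
      for m :: nat and x y
      by (simp add: sum_fun_apply tens_def g.sum)
    have "g z = t (\<lambda>a b. g (F a b))"
      using t' by (simp add: tensor_rep_def z eval)
    moreover have "g w = t (\<lambda>a b. g (F a b))"
      using t by (simp add: tensor_rep_def w_def eval)
    ultimately show False
      using g1 by (simp add: g.diff)
  qed
qed


section \<open>The Hopf algebra \<open>R(\<gg>)\<close>\<close>

text \<open>The comultiplication of the enveloping algebra: on words it is the sum over all splittings
  into two complementary subwords, which is the multiplicative extension of
  \<open>x \<mapsto> x \<otimes> 1 + 1 \<otimes> x\<close>.\<close>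

fun splittings :: "'a list \<Rightarrow> ('a list \<times> 'a list) list" where
  "splittings [] = [([], [])]"
| "splittings (x # w) = concat (map (\<lambda>(a, b). [(x # a, b), (a, x # b)]) (splittings w))"

definition ucomult :: "'a::ab_group_add lie \<Rightarrow> 'a ue \<Rightarrow> ('a ue, 'a ue) tensor" where
  "ucomult L u =
     the_elem ((\<lambda>x. lin_ext fscale (\<lambda>w. \<Sum>(a, b)\<leftarrow>splittings w.
       tens (uea_space L) (uea_space L) (uclass L (word a)) (uclass L (word b))) x) ` u)"

text \<open>Linear functionals on the enveloping algebra; they vanish off the carrier so that they are
  determined by their values on it.\<close>

definition udual :: "'a::ab_group_add lie \<Rightarrow> ('a ue \<Rightarrow> complex) set" where
  "udual L = {f.
     (\<forall>u\<in>carrier (UEA L). \<forall>v\<in>carrier (UEA L). f (u \<oplus>\<^bsub>UEA L\<^esub> v) = f u + f v) \<and>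
     (\<forall>c. \<forall>u\<in>carrier (UEA L). f (uscale L c u) = c * f u) \<and>
     (\<forall>u. u \<notin> carrier (UEA L) \<longrightarrow> f u = 0)}"

definition ukernel :: "'a::ab_group_add lie \<Rightarrow> ('a ue \<Rightarrow> complex) \<Rightarrow> 'a ue set" where
  "ukernel L f = {u \<in> carrier (UEA L). f u = 0}"

definition finite_dim_quotient :: "'a::ab_group_add lie \<Rightarrow> 'a ue set \<Rightarrow> 'a ue set \<Rightarrow> bool" where
  "finite_dim_quotient L K I \<longleftrightarrow>
     (\<exists>B. finite B \<and> B \<subseteq> K \<and>
       (\<forall>u\<in>K. \<exists>c. \<exists>i\<in>I. u = (\<Oplus>\<^bsub>UEA L\<^esub> b\<in>B. uscale L (c b) b) \<oplus>\<^bsub>UEA L\<^esub> i))"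

definition R_alg :: "'a::ab_group_add lie \<Rightarrow> ('a ue \<Rightarrow> complex) set" where
  "R_alg L = {f \<in> udual L. \<exists>I. ideal I (UEA L) \<and> I \<subseteq> ukernel L f \<and> finite_dim_quotient L (ukernel L f) I}"

abbreviation R_space :: "'a::ab_group_add lie \<Rightarrow> ('a ue \<Rightarrow> complex) cvs" where
  "R_space L \<equiv> function_space (R_alg L)"

definition R_mult ::
  "'a::ab_group_add lie \<Rightarrow> ('a ue \<Rightarrow> complex) \<Rightarrow> ('a ue \<Rightarrow> complex) \<Rightarrow> 'a ue \<Rightarrow> complex" where
  "R_mult L f g = (\<lambda>u. if u \<in> carrier (UEA L)
     then tlift (uea_space L) (uea_space L) (\<lambda>u1 u2. f u1 * g u2) (ucomult L u) else 0)"

definition R_comult ::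
  "'a::ab_group_add lie \<Rightarrow> ('a ue \<Rightarrow> complex) \<Rightarrow> ('a ue \<Rightarrow> complex, 'a ue \<Rightarrow> complex) tensor" where
  "R_comult L f = (THE t. t \<in> vcar (tensor_product (R_space L) (R_space L)) \<and>
     (\<forall>u\<in>carrier (UEA L). \<forall>v\<in>carrier (UEA L).
        tlift (R_space L) (R_space L) (\<lambda>f1 f2. f1 u * f2 v) t = f (u \<otimes>\<^bsub>UEA L\<^esub> v)))"

definition R_counit :: "'a::ab_group_add lie \<Rightarrow> ('a ue \<Rightarrow> complex) \<Rightarrow> complex" where
  "R_counit L f = f \<one>\<^bsub>UEA L\<^esub>"


section \<open>Induced modules\<close>

definition R_act ::
  "('a::ab_group_add, 'b::ab_group_add) lie_pair \<Rightarrow> 'a \<Rightarrow> ('b ue \<Rightarrow> complex) \<Rightarrow> 'b ue \<Rightarrow> complex" where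
  "R_act M X f = (\<lambda>u'. if u' \<in> carrier (UEA (g2 M)) then f (mutual_right M u' (\<iota> (g1 M) X)) else 0)"

text \<open>Since \<open>\<iota>\<close> is injective (Poincare-Birkhoff-Witt), the tensor chosen here is unique.\<close>

definition g1_coact ::
  "('a::ab_group_add, 'b::ab_group_add) lie_pair \<Rightarrow> 'a \<Rightarrow> ('a, 'b ue \<Rightarrow> complex) tensor" where
  "g1_coact M X =
     (let A = whole_space (lscale (g1 M)); B = R_space (g2 M) in
      SOME t. t \<in> vcar (tensor_product A B) \<and>
        (\<forall>u'\<in>carrier (UEA (g2 M)). mutual_left M u' (\<iota> (g1 M) X)
           = \<iota> (g1 M) (tlift A B (\<lambda>X0 X1. lscale (g1 M) (X1 u') X0) t)))"

text \<open>Coassociativity is stated in \<open>(V \<otimes> R(\<gg>)) \<otimes> R(\<gg>)\<close>.\<close>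

definition R_comodule ::
  "'b::ab_group_add lie \<Rightarrow> (complex \<Rightarrow> 'v \<Rightarrow> 'v) \<Rightarrow>
    ('v::ab_group_add \<Rightarrow> ('v, 'b ue \<Rightarrow> complex) tensor) \<Rightarrow> bool" where
  "R_comodule L s coact \<longleftrightarrow>
     (let V = whole_space s; H = R_space L; VH = tensor_product V H in
      vector_space s \<and>
      (\<forall>v. coact v \<in> vcar VH) \<and>
      (\<forall>v w. coact (v + w) = coact v + coact w) \<and>
      (\<forall>c v. coact (s c v) = fscale c (coact v)) \<and>
      (\<forall>v. tlift V H (\<lambda>v0 v1. tens VH H (coact v0) v1) (coact v)
         = tlift V H (\<lambda>v0 v1. tlift H H (\<lambda>f1 f2. tens VH H (tens V H v0 f1) f2) (R_comult L v1)) (coact v)) \<and>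
      (\<forall>v. tlift V H (\<lambda>v0 v1. s (R_counit L v1) v0) (coact v) = v))"

definition induced_module ::
  "('a::ab_group_add, 'b::ab_group_add) lie_pair \<Rightarrow> (complex \<Rightarrow> 'v \<Rightarrow> 'v) \<Rightarrow>
    ('a \<Rightarrow> 'v::ab_group_add \<Rightarrow> 'v) \<Rightarrow> ('v \<Rightarrow> ('v, 'b ue \<Rightarrow> complex) tensor) \<Rightarrow> bool" where
  "induced_module M s act coact \<longleftrightarrow>
     lie_module (g1 M) s act \<and> R_comodule (g2 M) s coact \<and>
     (let V = whole_space s; G = whole_space (lscale (g1 M)); H = R_space (g2 M) in
      \<forall>X v. coact (act X v)
        = tlift G H (\<lambda>X0 X1. tlift V H (\<lambda>v0 v1. tens V H (act X0 v0) (R_mult (g2 M) X1 v1)) (coact v))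
            (g1_coact M X)
          + tlift V H (\<lambda>v0 v1. tens V H v0 (R_act M X v1)) (coact v))"

text \<open>\<open>coact\<close> takes values in \<open>V \<otimes> R(\<gg>)\<close> and satisfies \<open>u' \<cdot> v = v\<^sub>1(u') v\<^sub>0\<close> for all \<open>u'\<close> in the
  enveloping algebra.\<close>

definition associated_coaction ::
  "'b::ab_group_add lie \<Rightarrow> (complex \<Rightarrow> 'v \<Rightarrow> 'v) \<Rightarrow> ('b \<Rightarrow> 'v::ab_group_add \<Rightarrow> 'v) \<Rightarrow>
    ('v \<Rightarrow> ('v, 'b ue \<Rightarrow> complex) tensor) \<Rightarrow> bool" where
  "associated_coaction L s act coact \<longleftrightarrow>
     (let V = whole_space s; H = R_space L in
      (\<forall>v. coact v \<in> vcar (tensor_product V H)) \<and>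
      (\<forall>u'\<in>carrier (UEA L). \<forall>v.
         uact s act u' v = tlift V H (\<lambda>v0 v1. s (v1 u') v0) (coact v)))"

end

theory Submission
  imports Defs
begin

text \<open>
  Write \<open>U\<^sub>1\<close>, \<open>U\<^sub>2\<close> and \<open>U\<close> for the enveloping algebras of \<open>\<gg>\<^sub>1\<close>, \<open>\<gg>\<^sub>2\<close> and the double crossed sum. A locally
  finite \<open>U\<^sub>2\<close>-module is the same as an \<open>R(\<gg>\<^sub>2)\<close>-comodule: the matrix coefficients of the action are
  representative functions (\<open>locally_finite_tensor\<close>), and conversely evaluating a coaction at elements
  of \<open>U\<^sub>2\<close> is an action, associative and unital precisely because the coaction is coassociative and
  counital (\<open>comodule_iff\<close>). Everything is tested by such evaluations, because a tensor in
  \<open>V \<otimes> R(\<gg>\<^sub>2)\<close> is determined by its values on \<open>U\<^sub>2\<close> (\<open>tensor_eqI\<close>).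

  It remains to compare the compatibility condition of induced modules with the action of the mixed
  brackets \<open>[\<xi>, X]\<close>. Evaluated at \<open>u\<close>, the condition reads
  \<open>u \<cdot> (X \<cdot> v) = (u\<^sub>1 \<triangleright> X) \<cdot> (u\<^sub>2 \<cdot> v) + (u \<triangleleft> X) \<cdot> v\<close> (\<open>induced_rhs_eval\<close>). For \<open>u = \<xi>\<close>
  this is \<open>[\<xi>, X] \<cdot> v = \<xi> \<cdot> (X \<cdot> v) - X \<cdot> (\<xi> \<cdot> v)\<close>, so an induced module carries a module structure
  over the double crossed sum (\<open>induced_module_arises\<close>). Conversely, if the relation holds for
  Lie algebra elements, then it holds for every word \<open>u\<close> by induction on its length
  (\<open>word_ext_res2\<close>), because \<open>(u \<xi>) \<triangleleft> X = (u \<triangleleft> X) \<xi> + u \<triangleleft> (\<xi> \<triangleright> X) + u (\<xi> \<triangleleft> X)\<close>.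

  That recursion, and \<open>u \<triangleright> X = u \<cdot> X\<close> for the module structure of \<open>\<gg>\<^sub>1\<close> over \<open>\<gg>\<^sub>2\<close>, have to be extracted
  from the definition of the mutual actions by normal ordering in \<open>U\<close>. The values do not depend on the
  normal ordering because there are linear maps \<open>U \<rightarrow> U\<^sub>1\<close> and \<open>U \<rightarrow> U\<^sub>2\<close> with \<open>p q \<mapsto> \<epsilon>(q) p\<close> and
  \<open>p q \<mapsto> \<epsilon>(p) q\<close>. The first one is \<open>z \<mapsto> z \<cdot> 1\<close> for an action of \<open>U\<close> on \<open>U\<^sub>1\<close> that is written down on words
  and descends to the quotient by the axioms of a matched pair; the second one is the first one for
  the opposite matched pair. The mutual actions describe the coaction of \<open>R(\<gg>\<^sub>2)\<close> on \<open>\<gg>\<^sub>1\<close> inside \<open>U\<^sub>1\<close>,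
  and a module structure over \<open>\<gg>\<^sub>1\<close> factors through the image of \<open>\<gg>\<^sub>1\<close> in \<open>U\<^sub>1\<close> (\<open>act_cong\<close>).
\<close>

section \<open>Linear maps out of the free algebra\<close>

abbreviation tscale :: "complex \<Rightarrow> 'a free_alg \<Rightarrow> 'a free_alg" where
  "tscale c x \<equiv> const c * x"

lemma word_mult: "word u * word v = word (u @ v)"
  by (simp add: word_def mult_single plus_list_def)

lemma word_Nil [simp]: "word [] = 1"
  by (simp add: word_def flip: zero_list_def)

lemma word_Cons: "word (x # w) = gen x * word w"
  by (simp add: word_mult)

lemma word_snoc: "word (w @ [x]) = word w * gen x"
  by (simp add: word_mult)

lemma lookup_tscale: "Poly_Mapping.lookup (tscale c x) w = c * Poly_Mapping.lookup x w"
proof -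
  have "tscale c x = Poly_Mapping.map ((*) c) x"
    by (simp add: const_def mult_map_scale_conv_mult flip: zero_list_def)
  then show ?thesis
    by (simp add: Poly_Mapping.map.rep_eq when_def)
qed

lemma const_0 [simp]: "const 0 = 0"
  and const_1 [simp]: "const 1 = 1"
  and const_add: "const (c + d) = const c + const d"
  by (simp_all add: const_def single_add flip: zero_list_def)

lemma const_mult: "const (c * d) = const c * const d"
  by (simp add: const_def mult_single plus_list_def)

lemma tscale_vector_space: "vector_space tscale"
  by standard (simp_all add: algebra_simps const_add const_mult)

lemma free_alg_induct [case_names word scale add]:
  assumes word: "\<And>w. P (word w)"
    and scale: "\<And>c x. P x \<Longrightarrow> P (tscale c x)"
    and add: "\<And>x y. P x \<Longrightarrow> P y \<Longrightarrow> P (x + y)"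
  shows "P x"
proof (induction x rule: update_induct)
  case const
  show ?case
    using scale[OF word, of 0] by simp
next
  case (update x w c)
  have "Poly_Mapping.update w c x = x + tscale c (word w)"
    using update(1) by (intro poly_mapping_eqI)
      (auto simp: lookup_update lookup_add lookup_tscale word_def lookup_single in_keys_iff when_def)
  then show ?case
    using update add scale word by simp
qed

lemma const_commute: "x * const c = const c * x"
proof (induction x rule: free_alg_induct)
  case (word w)
  then show ?case
    by (simp add: word_def const_def mult_single plus_list_def)
next
  case (scale d x)
  have "const d * x * const c = const (d * c) * x"
    by (simp add: scale const_mult mult.assoc)
  also have "\<dots> = const c * (const d * x)"
    by (simp add: const_mult mult.commute[of d] mult.assoc)
  finally show ?case .
qed (simp add: algebra_simps)

lemma mult_tscale: "x * tscale c y = tscale c (x * y)"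
  by (simp add: const_commute[of x] flip: mult.assoc)

context
  fixes s :: "complex \<Rightarrow> 'c::ab_group_add \<Rightarrow> 'c"
  assumes s: "vector_space s"
begin

interpretation vector_space s by (rule s)

lemma lin_ext_superset:
  assumes "finite A" "Poly_Mapping.keys x \<subseteq> A"
  shows "lin_ext s g x = (\<Sum>w\<in>A. s (Poly_Mapping.lookup x w) (g w))"
  unfolding lin_ext_def by (rule sum.mono_neutral_left) (use assms in \<open>auto simp: in_keys_iff\<close>)

lemma lin_ext_add: "lin_ext s g (x + y) = lin_ext s g x + lin_ext s g y"
proof -
  let ?A = "Poly_Mapping.keys x \<union> Poly_Mapping.keys y"
  have "Poly_Mapping.keys (x + y) \<subseteq> ?A"
    by (rule keys_add)
  then show ?thesis
    by (simp add: lin_ext_superset[of ?A] lookup_add scale_left_distrib sum.distrib)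
qed

lemma lin_ext_tscale: "lin_ext s g (tscale c x) = s c (lin_ext s g x)"
proof -
  have "Poly_Mapping.keys (tscale c x) \<subseteq> Poly_Mapping.keys x"
    by (auto simp: in_keys_iff lookup_tscale)
  then show ?thesis
    by (simp add: lin_ext_superset[of "Poly_Mapping.keys x"] lookup_tscale scale_sum_right)
qed

lemma lin_ext_word [simp]: "lin_ext s g (word w) = g w"
  by (simp add: lin_ext_def word_def)

lemma lin_ext_0 [simp]: "lin_ext s g 0 = 0"
  by (simp add: lin_ext_def)

lemma lin_ext_1 [simp]: "lin_ext s g 1 = g []"
  using lin_ext_word[of g "[]"] by simp

lemma lin_ext_diff: "lin_ext s g (x - y) = lin_ext s g x - lin_ext s g y"
  using lin_ext_add[of g "x - y" y] by (simp add: algebra_simps)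

lemma lin_ext_minus: "lin_ext s g (- x) = - lin_ext s g x"
  using lin_ext_diff[of g 0 x] by simp

end

section \<open>The enveloping algebra as a quotient\<close>

lemma FA_simps [simp]:
  "carrier FA = UNIV" "mult FA = (*)" "add FA = (+)" "one FA = 1" "zero FA = 0"
  by (simp_all add: FA_def)

lemma FA_ring: "ring FA"
proof (rule ringI)
  show "abelian_group FA"
    by (rule abelian_groupI) (auto simp: algebra_simps intro: exI[of _ "- _"] add.left_inverse)
  show "Group.monoid FA"
    by (rule monoidI) (auto simp: algebra_simps)
qed (auto simp: algebra_simps)

lemma FA_a_minus: "a_inv FA x = - x"
proof -
  interpret ring FA by (rule FA_ring)
  show ?thesis
    by (metis FA_simps(1,3,5) UNIV_I add.left_inverse minus_equality)
qed

lemma FA_idealI: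
  assumes "0 \<in> J" "\<And>x y. x \<in> J \<Longrightarrow> y \<in> J \<Longrightarrow> x + y \<in> J"
    "\<And>x y. x \<in> J \<Longrightarrow> y * x \<in> J" "\<And>x y. x \<in> J \<Longrightarrow> x * y \<in> J"
  shows "ideal J FA"
proof (rule idealI[OF FA_ring])
  interpret ring FA by (rule FA_ring)
  have "- x \<in> J" if "x \<in> J" for x
    using assms(3)[OF that, of "-1"] by simp
  then show "subgroup J (add_monoid FA)"
    by (intro subgroup.intro) (simp_all add: assms FA_a_minus[unfolded a_inv_def, simplified])
qed (use assms in auto)

lemma uea_ideal_is_ideal: "ideal (uea_ideal L) FA"
  unfolding uea_ideal_def by (rule ring.genideal_ideal[OF FA_ring]) simp

lemma uea_ideal_closed:
  shows uea_ideal_0 [simp]: "0 \<in> uea_ideal L"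
    and uea_ideal_add: "x \<in> uea_ideal L \<Longrightarrow> y \<in> uea_ideal L \<Longrightarrow> x + y \<in> uea_ideal L"
    and uea_ideal_mult_left: "x \<in> uea_ideal L \<Longrightarrow> z * x \<in> uea_ideal L"
    and uea_ideal_mult_right: "x \<in> uea_ideal L \<Longrightarrow> x * z \<in> uea_ideal L"
proof -
  interpret ideal "uea_ideal L" FA by (rule uea_ideal_is_ideal)
  show "0 \<in> uea_ideal L" "x \<in> uea_ideal L \<Longrightarrow> y \<in> uea_ideal L \<Longrightarrow> x + y \<in> uea_ideal L"
    using additive_subgroup.zero_closed[OF additive_subgroup_axioms]
      additive_subgroup.a_closed[OF additive_subgroup_axioms, of x y] by simp_all
  show "x \<in> uea_ideal L \<Longrightarrow> z * x \<in> uea_ideal L" "x \<in> uea_ideal L \<Longrightarrow> x * z \<in> uea_ideal L"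
    using I_l_closed[of x z] I_r_closed[of x z] by simp_all
qed

lemma uea_ideal_minus: "x \<in> uea_ideal L \<Longrightarrow> - x \<in> uea_ideal L"
  using uea_ideal_mult_left[of x L "-1"] by simp

lemma uea_ideal_diff: "x \<in> uea_ideal L \<Longrightarrow> y \<in> uea_ideal L \<Longrightarrow> x - y \<in> uea_ideal L"
  using uea_ideal_add[of x L "- y"] uea_ideal_minus[of y L] by simp

lemma uea_ideal_relations:
  shows uea_rel_add: "gen (x + y) - gen x - gen y \<in> uea_ideal L"
    and uea_rel_scale: "gen (lscale L c x) - const c * gen x \<in> uea_ideal L"
    and uea_rel_bracket: "gen x * gen y - gen y * gen x - gen (lbracket L x y) \<in> uea_ideal L"
proof -
  have "uea_relations L \<subseteq> uea_ideal L"
    unfolding uea_ideal_def by (rule ring.genideal_self[OF FA_ring]) simp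
  then show "gen (x + y) - gen x - gen y \<in> uea_ideal L"
    "gen (lscale L c x) - const c * gen x \<in> uea_ideal L"
    "gen x * gen y - gen y * gen x - gen (lbracket L x y) \<in> uea_ideal L"
    unfolding uea_relations_def by blast+
qed

text \<open>The ideal is spanned by the products \<open>a * r * b\<close> with \<open>r\<close> a defining relation. Absorbing
  \<open>b\<close> into the base cases leaves only multiplication by generators from the left to be checked,
  which suits functions that are given by recursion on words.\<close>

lemma uea_ideal_induct [consumes 1, case_names add scale gen rel_add rel_scale rel_bracket]:
  assumes z: "z \<in> uea_ideal L"
    and add: "\<And>x y. P x \<Longrightarrow> P y \<Longrightarrow> P (x + y)"
    and scale: "\<And>c x. P x \<Longrightarrow> P (const c * x)"
    and gen: "\<And>X x. x \<in> uea_ideal L \<Longrightarrow> P x \<Longrightarrow> P (gen X * x)"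
    and rel_add: "\<And>X Y b. P ((gen (X + Y) - gen X - gen Y) * b)"
    and rel_scale: "\<And>c X b. P ((gen (lscale L c X) - const c * gen X) * b)"
    and rel_bracket: "\<And>X Y b. P ((gen X * gen Y - gen Y * gen X - gen (lbracket L X Y)) * b)"
  shows "P z"
proof -
  let ?J = "{x \<in> uea_ideal L. \<forall>b. P (x * b)}"
  have P0: "P 0"
    using scale[OF rel_add, of 0] by simp
  have word_left: "P (word w * x)" if "P x" "x \<in> uea_ideal L" for w x
  proof (induction w)
    case (Cons X w)
    then show ?case
      using gen[OF uea_ideal_mult_left[OF that(2)]] that by (simp add: word_Cons[of X w] mult.assoc)
  qed (use that in simp)
  have left: "P (y * x)" if "P x" "x \<in> uea_ideal L" for x y
    by (induction y rule: free_alg_induct) (simp_all add: word_left that distrib_right add scale mult.assoc)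
  have "ideal ?J FA"
  proof (rule FA_idealI)
    show "y * x \<in> ?J" "x * y \<in> ?J" if "x \<in> ?J" for x y
      using that by (auto simp: mult.assoc uea_ideal_mult_left uea_ideal_mult_right intro: left)
  qed (simp_all add: P0 uea_ideal_add add distrib_right)
  moreover have "uea_relations L \<subseteq> ?J"
    unfolding uea_relations_def
    by (auto intro: rel_add rel_scale rel_bracket uea_ideal_relations)
  ultimately have "uea_ideal L \<subseteq> ?J"
    unfolding uea_ideal_def by (rule ring.genideal_minimal[OF FA_ring])
  then have "P (z * 1)"
    using z by blast
  then show ?thesis
    by simp
qed

lemma uclass_eq: "uclass L x = {x + h | h. h \<in> uea_ideal L}"
  unfolding uclass_def a_r_coset_def' by (auto simp: add.commute)

lemma uclass_eq_iff: "uclass L x = uclass L y \<longleftrightarrow> x - y \<in> uea_ideal L"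
proof
  assume "uclass L x = uclass L y"
  moreover have "x \<in> uclass L x"
    unfolding uclass_eq using uea_ideal_0 by force
  ultimately show "x - y \<in> uea_ideal L"
    unfolding uclass_eq by auto
next
  assume *: "x - y \<in> uea_ideal L"
  have "uclass L x \<subseteq> uclass L y" if "x - y \<in> uea_ideal L" for x y
    unfolding uclass_eq
  proof safe
    fix h assume "h \<in> uea_ideal L"
    then have "x - y + h \<in> uea_ideal L"
      using that uea_ideal_add by blast
    then show "\<exists>h'. x + h = y + h' \<and> h' \<in> uea_ideal L"
      by (intro exI[of _ "x - y + h"]) simp
  qed
  then show "uclass L x = uclass L y"
    using * uea_ideal_minus[OF *] by (metis minus_diff_eq subset_antisym)
qed

lemma UEA_ring: "ring (UEA L)"
  unfolding UEA_def by (rule ideal.quotient_is_ring[OF uea_ideal_is_ideal])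

lemma UEA_carrier: "carrier (UEA L) = range (uclass L)"
  unfolding UEA_def FactRing_def A_RCOSETS_def' uclass_def by auto

lemma uclass_in_carrier [simp]: "uclass L x \<in> carrier (UEA L)"
  by (simp add: UEA_carrier)

lemma carrier_cases: "u \<in> carrier (UEA L) \<Longrightarrow> (\<And>x. u = uclass L x \<Longrightarrow> P) \<Longrightarrow> P"
  by (auto simp: UEA_carrier)

lemma uclass_mult: "uclass L x \<otimes>\<^bsub>UEA L\<^esub> uclass L y = uclass L (x * y)"
  using ideal.rcoset_mult_add[OF uea_ideal_is_ideal] by (simp add: UEA_def FactRing_def uclass_def)

lemma uclass_add: "uclass L x \<oplus>\<^bsub>UEA L\<^esub> uclass L y = uclass L (x + y)"
proof -
  interpret ideal "uea_ideal L" FA by (rule uea_ideal_is_ideal)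
  show ?thesis
    using a_rcos_sum[of x y] by (simp add: UEA_def FactRing_def uclass_def)
qed

lemma UEA_one: "\<one>\<^bsub>UEA L\<^esub> = uclass L 1"
  by (simp add: UEA_def FactRing_def uclass_def)

lemma UEA_zero: "\<zero>\<^bsub>UEA L\<^esub> = uclass L 0"
  by (auto simp: UEA_def FactRing_def uclass_eq)

lemma uscale_uclass: "uscale L c (uclass L x) = uclass L (tscale c x)"
  by (simp add: uscale_def uclass_mult)

lemma finsum_uclass:
  "finite A \<Longrightarrow> (\<Oplus>\<^bsub>UEA L\<^esub> i\<in>A. uclass L (f i)) = uclass L (\<Sum>i\<in>A. f i)"
proof (induction A rule: finite_induct)
  interpret ring "UEA L" by (rule UEA_ring)
  {
    case empty
    show ?case by (simp add: UEA_zero)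
  next
    case (insert i A)
    then show ?case by (subst finsum_insert) (auto simp: uclass_add)
  }
qed

lemma the_elem_uclass:
  assumes "\<And>h. h \<in> uea_ideal L \<Longrightarrow> g (x + h) = g x"
  shows "the_elem (g ` uclass L x) = g x"
proof -
  have "g ` uclass L x = {g x}"
    using assms uea_ideal_0[of L] unfolding uclass_eq by force
  then show ?thesis
    by simp
qed

section \<open>Modules modulo a subspace\<close>

definition word_ext ::
  "(complex \<Rightarrow> 'v \<Rightarrow> 'v) \<Rightarrow> ('a \<Rightarrow> 'v::ab_group_add \<Rightarrow> 'v) \<Rightarrow> 'a free_alg \<Rightarrow> 'v \<Rightarrow> 'v" where
  "word_ext s op x v = lin_ext s (\<lambda>w. foldr op w v) x"

locale linear_ops = vector_space s
  for s :: "complex \<Rightarrow> 'v::ab_group_add \<Rightarrow> 'v" +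
  fixes op :: "'a::ab_group_add \<Rightarrow> 'v \<Rightarrow> 'v"
  assumes op_add: "op X (v + w) = op X v + op X w"
    and op_scale: "op X (s c v) = s c (op X v)"
begin

lemma word_ext_word [simp]: "word_ext s op (word w) v = foldr op w v"
  and word_ext_plus: "word_ext s op (x + y) v = word_ext s op x v + word_ext s op y v"
  and word_ext_tscale: "word_ext s op (tscale c x) v = s c (word_ext s op x v)"
  and word_ext_minus: "word_ext s op (x - y) v = word_ext s op x v - word_ext s op y v"
  by (simp_all add: word_ext_def vector_space_axioms lin_ext_add lin_ext_tscale lin_ext_diff)

lemma word_ext_0 [simp]: "word_ext s op 0 v = 0"
  and word_ext_1 [simp]: "word_ext s op 1 v = v"
  by (simp_all add: word_ext_def vector_space_axioms)

lemma word_ext_add_right: "word_ext s op x (v + w) = word_ext s op x v + word_ext s op x w"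
  and word_ext_scale_right: "word_ext s op x (s c v) = s c (word_ext s op x v)"
proof -
  have foldr: "foldr op u (v + w) = foldr op u v + foldr op u w" "foldr op u (s c v) = s c (foldr op u v)" for u
    by (induction u) (simp_all add: op_add op_scale)
  show "word_ext s op x (v + w) = word_ext s op x v + word_ext s op x w"
    by (induction x rule: free_alg_induct) (simp_all add: word_ext_plus word_ext_tscale foldr algebra_simps scale_right_distrib)
  show "word_ext s op x (s c v) = s c (word_ext s op x v)"
    by (induction x rule: free_alg_induct) (simp_all add: word_ext_plus word_ext_tscale foldr scale_right_distrib scale_left_commute)
qed

lemma word_ext_diff_right: "word_ext s op x (v - w) = word_ext s op x v - word_ext s op x w"
  using word_ext_add_right[of x "v - w" w] by (simp add: algebra_simps)

lemma word_ext_mult: "word_ext s op (x * y) v = word_ext s op x (word_ext s op y v)"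
proof (induction y rule: free_alg_induct)
  case (word w)
  show ?case
    by (induction x rule: free_alg_induct) (simp_all add: word_ext_plus word_ext_tscale distrib_right mult.assoc word_mult)
next
  case (scale c y)
  then show ?case by (simp add: mult_tscale word_ext_tscale word_ext_scale_right)
next
  case (add y z)
  then show ?case by (simp add: distrib_left word_ext_plus word_ext_add_right)
qed

lemma word_ext_gen [simp]: "word_ext s op (gen X) v = op X v"
  by simp

text \<open>Operators that satisfy the axioms of a module over \<open>L\<close> up to an invariant subspace \<open>N\<close>
  make the enveloping algebra act on the quotient by \<open>N\<close>. Taking for \<open>N\<close> the ideal of another
  enveloping algebra gives maps between enveloping algebras on representatives.\<close>

lemma word_ext_uea_ideal:
  assumes N: "subspace N"
    and inv: "\<And>X v. v \<in> N \<Longrightarrow> op X v \<in> N"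
    and add: "\<And>X Y v. op (X + Y) v - op X v - op Y v \<in> N"
    and scale: "\<And>c X v. op (lscale L c X) v - s c (op X v) \<in> N"
    and bracket: "\<And>X Y v. op X (op Y v) - op Y (op X v) - op (lbracket L X Y) v \<in> N"
    and z: "z \<in> uea_ideal L"
  shows "word_ext s op z v \<in> N"
  using z
proof (induction z rule: uea_ideal_induct)
  case (add x y)
  then show ?case by (simp add: word_ext_plus subspace_add[OF N])
next
  case (scale c x)
  then show ?case by (simp add: word_ext_tscale subspace_scale[OF N])
next
  case (gen X x)
  then show ?case by (simp add: word_ext_mult inv)
next
  case (rel_add X Y b)
  show ?case by (simp add: word_ext_mult word_ext_minus add)
next
  case (rel_scale c X b)
  show ?case by (simp add: word_ext_mult[of _ b] word_ext_minus word_ext_tscale scale)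
next
  case (rel_bracket X Y b)
  show ?case by (simp add: word_ext_mult word_ext_minus bracket)
qed

end

lemma tscale_linear_opsI:
  assumes "\<And>X v w. op X (v + w) = op X v + op X w" "\<And>X c v. op X (tscale c v) = tscale c (op X v)"
  shows "linear_ops tscale op"
  using tscale_vector_space assms by (intro linear_ops.intro linear_ops_axioms.intro)

lemma uea_ideal_subspace: "module.subspace tscale (uea_ideal L)"
proof -
  interpret vector_space tscale by (rule tscale_vector_space)
  show ?thesis
    by (intro subspaceI uea_ideal_closed) auto
qed

section \<open>Actions, homomorphisms and the counit on classes\<close>

lemma bilinear_mapD:
  assumes "bilinear_map sa sb sc f"
  shows "vector_space sa" "vector_space sb" "vector_space sc"
    "f (x + y) z = f x z + f y z" "f x (z + z') = f x z + f x z'"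
    "f (sa c x) z = sc c (f x z)" "f x (sb c z) = sc c (f x z)"
    "f 0 z = 0" "f x 0 = 0"
    "f (x - y) z = f x z - f y z" "f x (z - z') = f x z - f x z'"
    "f (- x) z = - f x z" "f x (- z) = - f x z"
proof -
  have l1: "Vector_Spaces.linear sa sc (\<lambda>x. f x z)" and l2: "Vector_Spaces.linear sb sc (f x)" for x z
    using assms by (auto simp: bilinear_map_def)
  show "vector_space sa" "vector_space sb" "vector_space sc"
    using l1 l2 by (auto simp: Vector_Spaces.linear_def)
  interpret A: Vector_Spaces.linear sa sc "\<lambda>x. f x z" for z by (rule l1)
  interpret B: Vector_Spaces.linear sb sc "f x" for x by (rule l2)
  show "f (x + y) z = f x z + f y z" "f x (z + z') = f x z + f x z'"
    "f (sa c x) z = sc c (f x z)" "f x (sb c z) = sc c (f x z)"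
    "f 0 z = 0" "f x 0 = 0" "f (x - y) z = f x z - f y z" "f x (z - z') = f x z - f x z'"
    "f (- x) z = - f x z" "f x (- z) = - f x z"
    using A.add A.scale A.zero A.diff A.neg B.add B.scale B.zero B.diff B.neg by auto
qed

lemma lie_moduleD:
  assumes "lie_module L s act"
  shows "bilinear_map (lscale L) s s act"
    "act (lbracket L x y) v = act x (act y v) - act y (act x v)"
  using assms by (auto simp: lie_module_def)

lemma lie_module_linear_ops: "lie_module L s act \<Longrightarrow> linear_ops s act"
  by (auto simp: linear_ops_def linear_ops_axioms_def dest!: lie_moduleD(1) dest: bilinear_mapD)

lemma uact_uclass:
  assumes "lie_module L s act"
  shows "uact s act (uclass L x) v = word_ext s act x v"
proof -
  interpret linear_ops s act by (rule lie_module_linear_ops[OF assms])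
  note act = lie_moduleD[OF assms] bilinear_mapD[OF lie_moduleD(1)[OF assms]]
  have "word_ext s act h v \<in> {0}" if "h \<in> uea_ideal L" for h
    by (rule word_ext_uea_ideal[OF _ _ _ _ _ that]) (simp_all add: act)
  then have "word_ext s act (x + h) v = word_ext s act x v" if "h \<in> uea_ideal L" for h
    using that by (simp add: word_ext_plus)
  then show ?thesis
    unfolding uact_def word_ext_def[symmetric] by (rule the_elem_uclass)
qed

text \<open>The algebra homomorphism and the algebra antihomomorphism that extend a map \<open>h\<close> of generators.\<close>

definition tmap :: "('a \<Rightarrow> 'b) \<Rightarrow> 'a free_alg \<Rightarrow> 'b free_alg" where
  "tmap h = lin_ext tscale (\<lambda>w. word (map h w))"

definition trev :: "('a \<Rightarrow> 'b) \<Rightarrow> 'a free_alg \<Rightarrow> 'b free_alg" where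
  "trev h = lin_ext tscale (\<lambda>w. word (rev (map h w)))"

lemma tmap_simps [simp]:
  "tmap h (word w) = word (map h w)" "tmap h (x + y) = tmap h x + tmap h y"
  "tmap h (tscale c x) = tscale c (tmap h x)" "tmap h 0 = 0" "tmap h 1 = 1"
  "tmap h (x - y) = tmap h x - tmap h y" "tmap h (- x) = - tmap h x"
  by (simp_all add: tmap_def tscale_vector_space lin_ext_add lin_ext_tscale lin_ext_diff lin_ext_minus)

lemma trev_simps [simp]:
  "trev h (word w) = word (rev (map h w))" "trev h (x + y) = trev h x + trev h y"
  "trev h (tscale c x) = tscale c (trev h x)" "trev h 0 = 0" "trev h 1 = 1"
  "trev h (x - y) = trev h x - trev h y" "trev h (- x) = - trev h x"
  by (simp_all add: trev_def tscale_vector_space lin_ext_add lin_ext_tscale lin_ext_diff lin_ext_minus)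

lemma tmap_const [simp]: "tmap h (const c) = const c"
  and trev_const [simp]: "trev h (const c) = const c"
  using tmap_simps(3)[of h c 1] trev_simps(3)[of h c 1] by (simp_all del: tmap_simps(3) trev_simps(3))

lemma tmap_mult [simp]: "tmap h (x * y) = tmap h x * tmap h y"
proof (induction y rule: free_alg_induct)
  case (word w)
  show ?case
    by (induction x rule: free_alg_induct) (simp_all add: distrib_right mult.assoc word_mult)
next
  case (scale c y)
  then show ?case
    by (simp add: mult_tscale[of x] mult_tscale[of "tmap h x"])
qed (simp add: distrib_left)

lemma trev_mult [simp]: "trev h (x * y) = trev h y * trev h x"
proof (induction y rule: free_alg_induct)
  case (word w)
  show ?case
  proof (induction x rule: free_alg_induct)
    case (scale c x)
    then show ?case
      by (simp add: mult_tscale[of "word _"] mult.assoc)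
  qed (simp_all add: distrib_left distrib_right word_mult)
next
  case (scale c y)
  then show ?case
    by (simp add: mult_tscale[of x] mult.assoc)
qed (simp add: distrib_left distrib_right)

lemma trev_trev [simp]: "trev h (trev k x) = tmap (\<lambda>a. h (k a)) x"
  by (induction x rule: free_alg_induct) (simp_all add: rev_map comp_def)

lemma tmap_tmap [simp]: "tmap h (tmap k x) = tmap (\<lambda>a. h (k a)) x"
  by (induction x rule: free_alg_induct) (simp_all add: comp_def)

lemma tmap_ident [simp]: "tmap (\<lambda>x. x) x = x" "tmap id x = x"
  by (induction x rule: free_alg_induct) simp_all

lemma hom_maps_uea_ideal:
  assumes f: "\<And>x y. f (x + y) = f x + f y" "\<And>c x. f (tscale c x) = tscale c (f x)"
    and mult: "(\<forall>x y. f (x * y) = f x * f y) \<or> (\<forall>x y. f (x * y) = f y * f x)"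
    and hom_add: "\<And>X Y. f (gen (X + Y)) - f (gen X) - f (gen Y) \<in> uea_ideal L'"
    and hom_scale: "\<And>c X. f (gen (lscale L c X)) - tscale c (f (gen X)) \<in> uea_ideal L'"
    and hom_bracket: "\<And>X Y. f (gen X * gen Y - gen Y * gen X) - f (gen (lbracket L X Y)) \<in> uea_ideal L'"
    and z: "z \<in> uea_ideal L"
  shows "f z \<in> uea_ideal L'"
proof -
  have diff: "f (x - y) = f x - f y" for x y
    using f(1)[of "x - y" y] by (simp add: algebra_simps)
  have times: "f (x * y) \<in> uea_ideal L'" if "f x \<in> uea_ideal L' \<or> f y \<in> uea_ideal L'" for x y
    using mult that by (metis uea_ideal_mult_left uea_ideal_mult_right)
  show ?thesis
    using z
  proof (induction z rule: uea_ideal_induct)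
    case (rel_add X Y b)
    show ?case by (rule times) (simp add: diff hom_add)
  next
    case (rel_scale c X b)
    show ?case by (rule times) (simp add: diff f hom_scale)
  next
    case (rel_bracket X Y b)
    show ?case by (rule times) (simp add: diff[of "_ - _"] hom_bracket)
  qed (simp_all add: f times uea_ideal_add uea_ideal_mult_left)
qed

lemma tmap_uea_ideal:
  assumes "\<And>X Y. h (X + Y) = h X + h Y" "\<And>c X. h (lscale L c X) = lscale L' c (h X)"
    "\<And>X Y. h (lbracket L X Y) = lbracket L' (h X) (h Y)" "z \<in> uea_ideal L"
  shows "tmap h z \<in> uea_ideal L'"
  using assms(4)
  by (rule hom_maps_uea_ideal[rotated -1]) (auto simp: assms uea_ideal_relations)

lemma trev_uea_ideal:
  assumes "\<And>X Y. h (X + Y) = h X + h Y" "\<And>c X. h (lscale L c X) = lscale L' c (h X)"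
    "\<And>X Y. h (lbracket L X Y) = lbracket L' (h Y) (h X)" "z \<in> uea_ideal L"
  shows "trev h z \<in> uea_ideal L'"
  using assms(4)
  by (rule hom_maps_uea_ideal[rotated -1]) (auto simp: assms const_commute uea_ideal_relations)

lemma umap_uclass:
  assumes "\<And>X Y. h (X + Y) = h X + h Y" "\<And>c X. h (lscale L c X) = lscale L' c (h X)"
    "\<And>X Y. h (lbracket L X Y) = lbracket L' (h X) (h Y)"
  shows "umap L' h (uclass L x) = uclass L' (tmap h x)"
  unfolding umap_def
  by (subst the_elem_uclass)
    (auto simp: uclass_eq_iff tmap_uea_ideal[OF assms] simp flip: tmap_def)

lemma lookup_word_Nil [simp]: "Poly_Mapping.lookup (word w) [] = (if w = [] then 1 else 0)"
  by (simp add: word_def lookup_single when_def)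

lemma lookup_Nil_mult:
  fixes x y :: "'a free_alg"
  shows "Poly_Mapping.lookup (x * y) [] = Poly_Mapping.lookup x [] * Poly_Mapping.lookup y []"
proof (induction y rule: free_alg_induct)
  case (word w)
  show ?case
    by (induction x rule: free_alg_induct)
      (simp_all add: distrib_right lookup_add mult.assoc lookup_tscale word_mult)
next
  case (scale c y)
  then show ?case
    by (simp add: mult_tscale[of x] lookup_tscale)
qed (simp add: distrib_left lookup_add)

lemma lookup_Nil_uea_ideal: "z \<in> uea_ideal L \<Longrightarrow> Poly_Mapping.lookup z [] = 0"
  by (induction z rule: uea_ideal_induct)
    (simp_all add: lookup_add lookup_tscale lookup_Nil_mult lookup_minus)

lemma ucounit_uclass: "ucounit (uclass L x) = Poly_Mapping.lookup x []"
  unfolding ucounit_def by (subst the_elem_uclass) (auto simp: lookup_add lookup_Nil_uea_ideal)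

section \<open>Normal ordering in the double crossed sum\<close>

lemma double_crossed_sum_simps [simp]:
  "lscale (double_crossed_sum M) c (X, \<xi>) = (lscale (g1 M) c X, lscale (g2 M) c \<xi>)"
  "lbracket (double_crossed_sum M) (X, \<xi>) (Y, \<zeta>) =
     (lbracket (g1 M) X Y + la M \<xi> Y - la M \<zeta> X, lbracket (g2 M) \<xi> \<zeta> + ra M \<xi> Y - ra M \<zeta> X)"
  by (simp_all add: double_crossed_sum_def)

text \<open>The left action of \<open>\<xi>\<close> on the enveloping algebra of the first Lie algebra, viewed as the
  quotient of the enveloping algebra of the double crossed sum by the left ideal that the second
  Lie algebra generates: \<open>\<xi>\<close> is commuted to the right and annihilates the unit.\<close>

fun cross_word :: "('a::ab_group_add, 'b::ab_group_add) lie_pair \<Rightarrow> 'b \<Rightarrow> 'a list \<Rightarrow> 'a free_alg" where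
  "cross_word M \<xi> [] = 0"
| "cross_word M \<xi> (X # w) =
     gen X * cross_word M \<xi> w + gen (la M \<xi> X) * word w + cross_word M (ra M \<xi> X) w"

definition cross :: "('a::ab_group_add, 'b::ab_group_add) lie_pair \<Rightarrow> 'b \<Rightarrow> 'a free_alg \<Rightarrow> 'a free_alg" where
  "cross M \<xi> = lin_ext tscale (cross_word M \<xi>)"

text \<open>Elements of the first Lie algebra act on \<open>U\<^sub>1\<close> by left multiplication. The orbit map at \<open>1\<close> of the
  resulting module over the double crossed sum is \<open>p q \<mapsto> \<epsilon>(q) p\<close>.\<close>

definition sum_op :: "('a::ab_group_add, 'b::ab_group_add) lie_pair \<Rightarrow> 'a \<times> 'b \<Rightarrow> 'a free_alg \<Rightarrow> 'a free_alg" where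
  "sum_op M = (\<lambda>(X, \<xi>) t. gen X * t + cross M \<xi> t)"

definition proj1 :: "('a::ab_group_add, 'b::ab_group_add) lie_pair \<Rightarrow> ('a \<times> 'b) free_alg \<Rightarrow> 'a free_alg" where
  "proj1 M z = word_ext tscale (sum_op M) z 1"

abbreviation emb1 :: "'a free_alg \<Rightarrow> ('a \<times> 'b::zero) free_alg" where
  "emb1 \<equiv> tmap (\<lambda>X. (X, 0))"

abbreviation emb2 :: "'b free_alg \<Rightarrow> ('a::zero \<times> 'b) free_alg" where
  "emb2 \<equiv> tmap (\<lambda>\<xi>. (0, \<xi>))"

lemma lookup_1_Nil [simp]: "Poly_Mapping.lookup (1 :: 'a free_alg) [] = 1"
  using lookup_word_Nil[of "[]"] by simp

abbreviation counit :: "'a free_alg \<Rightarrow> complex" where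
  "counit x \<equiv> Poly_Mapping.lookup x []"

text \<open>Up to the defining ideal, the generator map and the operators of the second Lie algebra are
  additive in the Lie algebra element. They therefore turn the axioms of a matched pair, which are
  identities between sums with few terms, into congruences; the three shapes below are the ones that
  occur.\<close>

lemma additive_mod:
  fixes f :: "'c::ab_group_add \<Rightarrow> 'a::ab_group_add free_alg"
  assumes f: "\<And>x y. f (x + y) - f x - f y \<in> uea_ideal L"
  shows additive_mod_zero: "f 0 \<in> uea_ideal L"
    and additive_mod_3: "a + c = b \<Longrightarrow> f b - f c - f a \<in> uea_ideal L"
    and additive_mod_4: "a + d = b + c \<Longrightarrow> f b + f c - f d - f a \<in> uea_ideal L"
    and additive_mod_5: "a + d = b + c + e \<Longrightarrow> f b + f c + f e - f d - f a \<in> uea_ideal L"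
proof -
  show "f 0 \<in> uea_ideal L"
    using uea_ideal_minus[OF f[of 0 0]] by simp
  show "f b - f c - f a \<in> uea_ideal L" if "a + c = b"
    using f[of a c] that by (simp add: algebra_simps)
  show 4: "f b + f c - f d - f a \<in> uea_ideal L" if "a + d = b + c" for a b c d
    using uea_ideal_diff[OF f[of a d] f[of b c]] that by (simp add: algebra_simps)
  show "f b + f c + f e - f d - f a \<in> uea_ideal L" if "a + d = b + c + e"
    using uea_ideal_diff[OF 4[OF that] f[of b c]] by (simp add: algebra_simps)
qed

lemmas gen_additive = additive_mod[where f = "\<lambda>x. gen x", OF uea_rel_add]

locale matched =
  fixes M :: "('a::ab_group_add, 'b::ab_group_add) lie_pair"
  assumes matched: "matched_pair M"
begin

abbreviation L1 where "L1 \<equiv> g1 M"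
abbreviation L2 where "L2 \<equiv> g2 M"
abbreviation D where "D \<equiv> double_crossed_sum M"
abbreviation lact (infixr "\<triangleright>" 75) where "\<xi> \<triangleright> X \<equiv> la M \<xi> X"
abbreviation ract (infixl "\<triangleleft>" 75) where "\<xi> \<triangleleft> X \<equiv> ra M \<xi> X"
abbreviation br1 where "br1 \<equiv> lbracket (g1 M)"
abbreviation br2 where "br2 \<equiv> lbracket (g2 M)"

lemma finite_dim: "finite_dim_lie_algebra L1" "finite_dim_lie_algebra L2"
  using matched by (auto simp: matched_pair_def)

lemma lie: "lie_algebra L1" "lie_algebra L2"
  using finite_dim by (auto simp: finite_dim_lie_algebra_def)

lemma
  shows la_bilinear: "bilinear_map (lscale L2) (lscale L1) (lscale L1) (la M)"
    and ra_bilinear: "bilinear_map (lscale L2) (lscale L1) (lscale L2) (ra M)"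
    and br1_bilinear: "bilinear_map (lscale L1) (lscale L1) (lscale L1) br1"
    and br2_bilinear: "bilinear_map (lscale L2) (lscale L2) (lscale L2) br2"
  using matched lie by (auto simp: matched_pair_def lie_algebra_def)

lemmas la_simps = bilinear_mapD(4-)[OF la_bilinear]
lemmas ra_simps = bilinear_mapD(4-)[OF ra_bilinear]
lemmas br1_simps = bilinear_mapD(4-)[OF br1_bilinear]
lemmas br2_simps = bilinear_mapD(4-)[OF br2_bilinear]

lemma scale1: "vector_space (lscale L1)" and scale2: "vector_space (lscale L2)"
  using bilinear_mapD(1,2)[OF la_bilinear] by blast+

lemma
  shows la_bracket2: "br2 \<zeta> \<xi> \<triangleright> X = \<zeta> \<triangleright> \<xi> \<triangleright> X - \<xi> \<triangleright> \<zeta> \<triangleright> X"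
    and ra_bracket1: "\<zeta> \<triangleleft> br1 X Y = \<zeta> \<triangleleft> X \<triangleleft> Y - \<zeta> \<triangleleft> Y \<triangleleft> X"
    and la_bracket1: "\<zeta> \<triangleright> br1 X Y =
      br1 (\<zeta> \<triangleright> X) Y + br1 X (\<zeta> \<triangleright> Y) + (\<zeta> \<triangleleft> X) \<triangleright> Y - (\<zeta> \<triangleleft> Y) \<triangleright> X"
    and ra_bracket2: "br2 \<zeta> \<xi> \<triangleleft> X =
      br2 (\<zeta> \<triangleleft> X) \<xi> + br2 \<zeta> (\<xi> \<triangleleft> X) + \<zeta> \<triangleleft> (\<xi> \<triangleright> X) - \<xi> \<triangleleft> (\<zeta> \<triangleright> X)"
  using matched unfolding matched_pair_def by blast+

lemma cross_simps [simp]: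
  "cross M \<xi> (word w) = cross_word M \<xi> w" "cross M \<xi> (x + y) = cross M \<xi> x + cross M \<xi> y"
  "cross M \<xi> (tscale c x) = tscale c (cross M \<xi> x)" "cross M \<xi> 0 = 0" "cross M \<xi> 1 = 0"
  "cross M \<xi> (x - y) = cross M \<xi> x - cross M \<xi> y"
  by (simp_all add: cross_def tscale_vector_space lin_ext_add lin_ext_tscale lin_ext_diff)

lemma cross_gen_mult:
  "cross M \<xi> (gen X * x) = gen X * cross M \<xi> x + gen (\<xi> \<triangleright> X) * x + cross M (\<xi> \<triangleleft> X) x"
proof (induction x rule: free_alg_induct)
  case (word w)
  show ?case
    by (simp add: word_mult)
next
  case (scale c x)
  then show ?case
    by (simp add: mult_tscale[of "gen _"] distrib_left)
qed (simp add: algebra_simps)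

lemma cross_add: "cross M (\<xi> + \<zeta>) x - cross M \<xi> x - cross M \<zeta> x \<in> uea_ideal L1"
proof (induction x rule: free_alg_induct)
  case (word w)
  show ?case
  proof (induction w arbitrary: \<xi> \<zeta>)
    case (Cons X w)
    have "cross M (\<xi> + \<zeta>) (word (X # w)) - cross M \<xi> (word (X # w)) - cross M \<zeta> (word (X # w))
       = gen X * (cross M (\<xi> + \<zeta>) (word w) - cross M \<xi> (word w) - cross M \<zeta> (word w))
       + (gen (\<xi> \<triangleright> X + \<zeta> \<triangleright> X) - gen (\<xi> \<triangleright> X) - gen (\<zeta> \<triangleright> X)) * word w
       + (cross M (\<xi> \<triangleleft> X + \<zeta> \<triangleleft> X) (word w) - cross M (\<xi> \<triangleleft> X) (word w) - cross M (\<zeta> \<triangleleft> X) (word w))"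
      by (simp add: la_simps ra_simps algebra_simps)
    also have "\<dots> \<in> uea_ideal L1"
      by (intro uea_ideal_add uea_ideal_mult_left uea_ideal_mult_right uea_rel_add Cons)
    finally show ?case .
  qed simp
next
  case (scale c x)
  then show ?case
    using uea_ideal_mult_left[OF scale, of "const c"] by (simp add: algebra_simps)
next
  case (add x y)
  then show ?case
    using uea_ideal_add[OF add] by (simp add: algebra_simps)
qed

lemma cross_scale: "cross M (lscale L2 c \<xi>) x - tscale c (cross M \<xi> x) \<in> uea_ideal L1"
proof (induction x rule: free_alg_induct)
  case (word w)
  show ?case
  proof (induction w arbitrary: \<xi>)
    case (Cons X w)
    have "cross M (lscale L2 c \<xi>) (word (X # w)) - tscale c (cross M \<xi> (word (X # w)))
       = gen X * (cross M (lscale L2 c \<xi>) (word w) - tscale c (cross M \<xi> (word w)))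
       + (gen (lscale L1 c (\<xi> \<triangleright> X)) - tscale c (gen (\<xi> \<triangleright> X))) * word w
       + (cross M (lscale L2 c (\<xi> \<triangleleft> X)) (word w) - tscale c (cross M (\<xi> \<triangleleft> X) (word w)))"
      by (simp add: la_simps ra_simps algebra_simps mult_tscale[of "gen _"])
    also have "\<dots> \<in> uea_ideal L1"
      by (intro uea_ideal_add uea_ideal_mult_left uea_ideal_mult_right uea_rel_scale Cons)
    finally show ?case .
  qed simp
next
  case (scale d x)
  have "const c * (const d * y) = const d * (const c * y)" for y :: "'a free_alg"
    by (simp add: mult.commute[of c] flip: mult.assoc const_mult)
  then show ?case
    using uea_ideal_mult_left[OF scale, of "const d"] by (simp add: right_diff_distrib)
next
  case (add x y)
  then show ?case
    using uea_ideal_add[OF add] by (simp add: algebra_simps)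
qed

lemmas cross_additive = additive_mod[where f = "\<lambda>\<xi>. cross M \<xi> x" for x, OF cross_add]

text \<open>The commutator relation is preserved because of the two axioms for \<open>\<zeta> \<triangleright> [X, Y]\<close> and
  \<open>\<zeta> \<triangleleft> [X, Y]\<close>; the equation in the last case sorts the terms by the axiom that makes them cancel.\<close>

lemma cross_uea_ideal: "z \<in> uea_ideal L1 \<Longrightarrow> cross M \<xi> z \<in> uea_ideal L1"
proof (induction z arbitrary: \<xi> rule: uea_ideal_induct)
  case (add x y)
  then show ?case by (simp add: uea_ideal_add)
next
  case (scale c x)
  then show ?case by (simp add: uea_ideal_mult_left)
next
  case (gen X x)
  then show ?case by (simp add: cross_gen_mult uea_ideal_add uea_ideal_mult_left)
next
  case (rel_add X Y b)
  have "cross M \<xi> ((gen (X + Y) - gen X - gen Y) * b)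
    = (gen (X + Y) - gen X - gen Y) * cross M \<xi> b
      + (gen (\<xi> \<triangleright> X + \<xi> \<triangleright> Y) - gen (\<xi> \<triangleright> X) - gen (\<xi> \<triangleright> Y)) * b
      + (cross M (\<xi> \<triangleleft> X + \<xi> \<triangleleft> Y) b - cross M (\<xi> \<triangleleft> X) b - cross M (\<xi> \<triangleleft> Y) b)"
    by (simp add: left_diff_distrib cross_gen_mult la_simps ra_simps)
  also have "\<dots> \<in> uea_ideal L1"
    by (intro uea_ideal_add uea_ideal_mult_right uea_rel_add cross_add)
  finally show ?case .
next
  case (rel_scale c X b)
  have "cross M \<xi> ((gen (lscale L1 c X) - tscale c (gen X)) * b)
    = (gen (lscale L1 c X) - tscale c (gen X)) * cross M \<xi> b
      + (gen (lscale L1 c (\<xi> \<triangleright> X)) - tscale c (gen (\<xi> \<triangleright> X))) * b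
      + (cross M (lscale L2 c (\<xi> \<triangleleft> X)) b - tscale c (cross M (\<xi> \<triangleleft> X) b))"
    by (simp add: left_diff_distrib mult.assoc cross_gen_mult la_simps ra_simps distrib_left)
  also have "\<dots> \<in> uea_ideal L1"
    by (intro uea_ideal_add uea_ideal_mult_right uea_rel_scale cross_scale)
  finally show ?case .
next
  case (rel_bracket X Y b)
  \<comment> \<open>the axioms for \<open>\<xi> \<triangleright> [X, Y]\<close> and \<open>\<xi> \<triangleleft> [X, Y]\<close>, modulo the ideal\<close>
  have m4: "gen (br1 X (\<xi> \<triangleright> Y)) + gen (br1 (\<xi> \<triangleright> X) Y) + gen ((\<xi> \<triangleleft> X) \<triangleright> Y)
      - gen ((\<xi> \<triangleleft> Y) \<triangleright> X) - gen (\<xi> \<triangleright> br1 X Y) \<in> uea_ideal L1"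
    by (rule gen_additive(4)) (simp add: la_bracket1)
  have m5: "cross M (\<xi> \<triangleleft> X \<triangleleft> Y) b - cross M (\<xi> \<triangleleft> Y \<triangleleft> X) b - cross M (\<xi> \<triangleleft> br1 X Y) b \<in> uea_ideal L1"
    by (rule cross_additive(2)) (simp add: ra_bracket1)
  have "cross M \<xi> ((gen X * gen Y - gen Y * gen X - gen (br1 X Y)) * b)
    = (gen X * gen Y - gen Y * gen X - gen (br1 X Y)) * cross M \<xi> b
      + (gen X * gen (\<xi> \<triangleright> Y) - gen (\<xi> \<triangleright> Y) * gen X - gen (br1 X (\<xi> \<triangleright> Y))) * b
      + (gen (\<xi> \<triangleright> X) * gen Y - gen Y * gen (\<xi> \<triangleright> X) - gen (br1 (\<xi> \<triangleright> X) Y)) * b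
      + (gen (br1 X (\<xi> \<triangleright> Y)) + gen (br1 (\<xi> \<triangleright> X) Y) + gen ((\<xi> \<triangleleft> X) \<triangleright> Y)
          - gen ((\<xi> \<triangleleft> Y) \<triangleright> X) - gen (\<xi> \<triangleright> br1 X Y)) * b
      + (cross M (\<xi> \<triangleleft> X \<triangleleft> Y) b - cross M (\<xi> \<triangleleft> Y \<triangleleft> X) b - cross M (\<xi> \<triangleleft> br1 X Y) b)"
    by (simp add: left_diff_distrib distrib_left distrib_right mult.assoc cross_gen_mult algebra_simps)
  also have "\<dots> \<in> uea_ideal L1"
    by (intro uea_ideal_add[OF uea_ideal_add] uea_ideal_add m4 m5 uea_ideal_mult_right uea_rel_bracket)
  finally show ?case .
qed

text \<open>On generators this is the content of the two axioms for \<open>[\<zeta>, \<xi>] \<triangleright> X\<close> and \<open>[\<zeta>, \<xi>] \<triangleleft> X\<close>. The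
  induction has to be over all \<open>\<xi>\<close> and \<open>\<zeta>\<close> at once, because moving past \<open>X\<close> replaces \<open>\<xi>\<close> by \<open>\<xi> \<triangleleft> X\<close>.\<close>

lemma cross_bracket:
  "cross M \<xi> (cross M \<zeta> x) - cross M \<zeta> (cross M \<xi> x) - cross M (br2 \<xi> \<zeta>) x \<in> uea_ideal L1"
proof (induction x rule: free_alg_induct)
  case (word w)
  show ?case
  proof (induction w arbitrary: \<xi> \<zeta>)
    case (Cons X w)
    let ?C = "\<lambda>\<xi> \<zeta>. cross M \<xi> (cross M \<zeta> (word w)) - cross M \<zeta> (cross M \<xi> (word w)) - cross M (br2 \<xi> \<zeta>) (word w)"
    have m3: "gen (\<xi> \<triangleright> \<zeta> \<triangleright> X) - gen (\<zeta> \<triangleright> \<xi> \<triangleright> X) - gen (br2 \<xi> \<zeta> \<triangleright> X) \<in> uea_ideal L1"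
      by (rule gen_additive(2)) (simp add: la_bracket2)
    have m5: "cross M (br2 (\<xi> \<triangleleft> X) \<zeta>) (word w) + cross M (br2 \<xi> (\<zeta> \<triangleleft> X)) (word w)
        + cross M (\<xi> \<triangleleft> (\<zeta> \<triangleright> X)) (word w) - cross M (\<zeta> \<triangleleft> (\<xi> \<triangleright> X)) (word w)
        - cross M (br2 \<xi> \<zeta> \<triangleleft> X) (word w) \<in> uea_ideal L1"
      by (rule cross_additive(4)) (simp add: ra_bracket2)
    have "cross M \<xi> (cross M \<zeta> (gen X * word w)) - cross M \<zeta> (cross M \<xi> (gen X * word w))
        - cross M (br2 \<xi> \<zeta>) (gen X * word w)
      = gen X * ?C \<xi> \<zeta> + ?C (\<xi> \<triangleleft> X) \<zeta> + ?C \<xi> (\<zeta> \<triangleleft> X)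
        + (gen (\<xi> \<triangleright> \<zeta> \<triangleright> X) - gen (\<zeta> \<triangleright> \<xi> \<triangleright> X) - gen (br2 \<xi> \<zeta> \<triangleright> X)) * word w
        + (cross M (br2 (\<xi> \<triangleleft> X) \<zeta>) (word w) + cross M (br2 \<xi> (\<zeta> \<triangleleft> X)) (word w)
        + cross M (\<xi> \<triangleleft> (\<zeta> \<triangleright> X)) (word w) - cross M (\<zeta> \<triangleleft> (\<xi> \<triangleright> X)) (word w)
        - cross M (br2 \<xi> \<zeta> \<triangleleft> X) (word w))"
      by (simp only: cross_gen_mult cross_simps(2) algebra_simps)
    also have "\<dots> \<in> uea_ideal L1"
      by (intro uea_ideal_add[OF uea_ideal_add] uea_ideal_add m3 m5 uea_ideal_mult_right uea_ideal_mult_left Cons)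
    finally show ?case
      by (simp only: word_Cons[of X w])
  qed simp
next
  case (scale c x)
  then show ?case
    using uea_ideal_mult_left[OF scale, of "const c"] by (simp add: algebra_simps)
next
  case (add x y)
  then show ?case
    using uea_ideal_add[OF add] by (simp add: algebra_simps)
qed

lemma sum_op_linear_ops: "linear_ops tscale (sum_op M)"
  by (rule tscale_linear_opsI) (auto simp: sum_op_def distrib_left mult_tscale[of "gen _"])

sublocale sum_op: linear_ops tscale "sum_op M"
  by (rule sum_op_linear_ops)

lemma sum_op_ideal: "t \<in> uea_ideal L1 \<Longrightarrow> sum_op M x t \<in> uea_ideal L1"
  by (auto simp: sum_op_def split: prod.split intro!: uea_ideal_add uea_ideal_mult_left cross_uea_ideal)

lemma word_ext_sum_op_ideal: "t \<in> uea_ideal L1 \<Longrightarrow> word_ext tscale (sum_op M) z t \<in> uea_ideal L1"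
proof (induction z rule: free_alg_induct)
  case (word w)
  then show ?case by (induction w) (simp_all add: sum_op_ideal)
qed (simp_all add: sum_op.word_ext_plus sum_op.word_ext_tscale uea_ideal_add uea_ideal_mult_left)

text \<open>Of the three parts of the bracket in the double crossed sum, two are the module structures already
  present, and the mixed one is the recursion by which the action of \<open>\<xi>\<close> was defined.\<close>

lemma sum_op_bracket:
  "sum_op M x (sum_op M y t) - sum_op M y (sum_op M x t) - sum_op M (lbracket D x y) t \<in> uea_ideal L1"
proof -
  obtain X \<xi> Y \<zeta> where xy: "x = (X, \<xi>)" "y = (Y, \<zeta>)"
    by (metis surj_pair)
  have m1: "gen (br1 X Y) + gen (\<xi> \<triangleright> Y) - gen (\<zeta> \<triangleright> X) - gen (br1 X Y + \<xi> \<triangleright> Y - \<zeta> \<triangleright> X) \<in> uea_ideal L1"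
    by (rule gen_additive(3)) simp
  have m2: "cross M (br2 \<xi> \<zeta>) t + cross M (\<xi> \<triangleleft> Y) t - cross M (\<zeta> \<triangleleft> X) t
      - cross M (br2 \<xi> \<zeta> + \<xi> \<triangleleft> Y - \<zeta> \<triangleleft> X) t \<in> uea_ideal L1"
    by (rule cross_additive(3)) simp
  have "sum_op M x (sum_op M y t) - sum_op M y (sum_op M x t) - sum_op M (lbracket D x y) t
    = (gen X * gen Y - gen Y * gen X - gen (br1 X Y)) * t
      + (cross M \<xi> (cross M \<zeta> t) - cross M \<zeta> (cross M \<xi> t) - cross M (br2 \<xi> \<zeta>) t)
      + (gen (br1 X Y) + gen (\<xi> \<triangleright> Y) - gen (\<zeta> \<triangleright> X) - gen (br1 X Y + \<xi> \<triangleright> Y - \<zeta> \<triangleright> X)) * t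
      + (cross M (br2 \<xi> \<zeta>) t + cross M (\<xi> \<triangleleft> Y) t - cross M (\<zeta> \<triangleleft> X) t
          - cross M (br2 \<xi> \<zeta> + \<xi> \<triangleleft> Y - \<zeta> \<triangleleft> X) t)"
    unfolding xy double_crossed_sum_simps
    by (simp only: sum_op_def prod.case cross_gen_mult cross_simps(2) algebra_simps)
  also have "\<dots> \<in> uea_ideal L1"
    by (intro uea_ideal_add[OF uea_ideal_add] uea_ideal_add m1 m2 uea_ideal_mult_right uea_rel_bracket cross_bracket)
  finally show ?thesis .
qed

lemma proj1_uea_ideal:
  assumes "z \<in> uea_ideal D"
  shows "proj1 M z \<in> uea_ideal L1"
  unfolding proj1_def
proof (rule sum_op.word_ext_uea_ideal[OF uea_ideal_subspace sum_op_ideal _ _ sum_op_bracket assms])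
  fix x y :: "'a \<times> 'b" and c t
  obtain X \<xi> Y \<zeta> where xy: "x = (X, \<xi>)" "y = (Y, \<zeta>)"
    by (metis surj_pair)
  show "sum_op M (x + y) t - sum_op M x t - sum_op M y t \<in> uea_ideal L1"
    using uea_ideal_add[OF uea_ideal_mult_right[OF uea_rel_add] cross_add]
    by (simp add: xy sum_op_def algebra_simps)
  show "sum_op M (lscale D c x) t - tscale c (sum_op M x t) \<in> uea_ideal L1"
    using uea_ideal_add[OF uea_ideal_mult_right[OF uea_rel_scale] cross_scale]
    by (simp add: xy sum_op_def algebra_simps)
qed

lemma proj1_simps [simp]:
  "proj1 M (x + y) = proj1 M x + proj1 M y" "proj1 M (tscale c x) = tscale c (proj1 M x)"
  "proj1 M (x - y) = proj1 M x - proj1 M y" "proj1 M 0 = 0" "proj1 M 1 = 1"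
  by (simp_all add: proj1_def sum_op.word_ext_plus sum_op.word_ext_tscale sum_op.word_ext_minus)

lemma proj1_gen_mult: "proj1 M (gen x * z) = sum_op M x (proj1 M z)"
  by (simp add: proj1_def sum_op.word_ext_mult)

lemma proj1_emb1: "proj1 M (emb1 p * z) - p * proj1 M z \<in> uea_ideal L1"
proof (induction p rule: free_alg_induct)
  case (word w)
  show ?case
  proof (induction w)
    case (Cons X w)
    have "proj1 M (emb1 (gen X * word w) * z) - gen X * word w * proj1 M z
      = gen X * (proj1 M (emb1 (word w) * z) - word w * proj1 M z) + cross M 0 (proj1 M (emb1 (word w) * z))"
      by (simp add: proj1_gen_mult mult.assoc) (simp add: sum_op_def algebra_simps)
    also have "\<dots> \<in> uea_ideal L1"
      by (intro uea_ideal_add uea_ideal_mult_left Cons cross_additive(1))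
    finally show ?case
      by (simp only: word_Cons[of X w])
  qed simp
next
  case (scale c p)
  then show ?case
    using uea_ideal_mult_left[OF scale, of "const c"] by (simp add: algebra_simps)
next
  case (add p q)
  then show ?case
    using uea_ideal_add[OF add] by (simp add: algebra_simps)
qed

text \<open>The last letter \<open>\<xi>\<close> of a nonempty word in \<open>U\<^sub>2\<close> already annihilates \<open>1\<close>.\<close>

lemma proj1_emb2: "proj1 M (z * emb2 q) - tscale (counit q) (proj1 M z) \<in> uea_ideal L1"
proof -
  have *: "proj1 M (emb2 q) - const (counit q) \<in> uea_ideal L1"
  proof (induction q rule: free_alg_induct)
    case (word w)
    show ?case
    proof (cases w rule: rev_cases)
      case (snoc v \<xi>)
      have "sum_op M (0, \<xi>) 1 \<in> uea_ideal L1"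
        by (simp add: sum_op_def gen_additive(1))
      then show ?thesis
        using word_ext_sum_op_ideal[of _ "emb2 (word v)"] by (simp add: snoc proj1_def)
    qed simp
  next
    case (scale c q)
    then show ?case
      using uea_ideal_mult_left[OF scale, of "const c"] by (simp add: lookup_tscale const_mult algebra_simps)
  next
    case (add p q)
    then show ?case
      using uea_ideal_add[OF add] by (simp add: lookup_add const_add algebra_simps)
  qed
  have "proj1 M (z * emb2 q) - tscale (counit q) (proj1 M z)
      = word_ext tscale (sum_op M) z (proj1 M (emb2 q) - tscale (counit q) 1)"
    by (simp only: proj1_def sum_op.word_ext_mult sum_op.word_ext_diff_right sum_op.word_ext_scale_right)
  also have "\<dots> \<in> uea_ideal L1"
    using * by (intro word_ext_sum_op_ideal) simp
  finally show ?thesis .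
qed

end

section \<open>Opposite matched pairs\<close>

definition opposite :: "'a lie \<Rightarrow> 'a lie" where
  "opposite L = \<lparr>lscale = lscale L, lbracket = (\<lambda>x y. lbracket L y x)\<rparr>"

text \<open>Passing to opposite Lie algebras reverses all products and thereby exchanges the two factors of
  a double crossed sum.\<close>

definition opposite_pair :: "('a, 'b) lie_pair \<Rightarrow> ('b, 'a) lie_pair" where
  "opposite_pair M = \<lparr>g1 = opposite (g2 M), g2 = opposite (g1 M), la = (\<lambda>X \<xi>. ra M \<xi> X), ra = (\<lambda>X \<xi>. la M \<xi> X)\<rparr>"

lemma opposite_simps [simp]:
  "lscale (opposite L) = lscale L" "lbracket (opposite L) x y = lbracket L y x"
  by (simp_all add: opposite_def)

lemma opposite_pair_simps [simp]:
  "g1 (opposite_pair M) = opposite (g2 M)" "g2 (opposite_pair M) = opposite (g1 M)"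
  "la (opposite_pair M) X \<xi> = ra M \<xi> X" "ra (opposite_pair M) X \<xi> = la M \<xi> X"
  by (simp_all add: opposite_pair_def)

lemma bilinear_map_flip:
  "bilinear_map sa sb sc f \<Longrightarrow> bilinear_map sb sa sc (\<lambda>x y. f y x)"
  by (simp add: bilinear_map_def)

lemma opposite_finite_dim:
  assumes "finite_dim_lie_algebra L"
  shows "finite_dim_lie_algebra (opposite L)"
proof -
  have "lbracket (opposite L) = (\<lambda>x y. lbracket L y x)"
    by (simp add: opposite_def)
  moreover have L: "lie_algebra L"
    using assms by (simp add: finite_dim_lie_algebra_def)
  moreover have "lbracket L (lbracket L z y) x + lbracket L (lbracket L x z) y + lbracket L (lbracket L y x) z = 0" for x y z
  proof -
    have bil: "bilinear_map (lscale L) (lscale L) (lscale L) (lbracket L)"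
      and alt: "\<And>x. lbracket L x x = 0"
      using L by (auto simp: lie_algebra_def)
    note b = bilinear_mapD[OF bil]
    have anti: "lbracket L x y = - lbracket L y x" for x y
    proof -
      have "0 = lbracket L (x + y) (x + y)"
        by (rule alt[symmetric])
      also have "\<dots> = lbracket L x y + lbracket L y x"
        by (simp only: b(4,5)) (simp add: alt)
      finally show ?thesis
        by (metis eq_neg_iff_add_eq_0)
    qed
    have "lbracket L x (lbracket L y z) + lbracket L y (lbracket L z x) + lbracket L z (lbracket L x y) = 0"
      using L by (simp add: lie_algebra_def)
    then show ?thesis
      using anti[of "lbracket L z y" x] anti[of "lbracket L x z" y] anti[of "lbracket L y x" z]
        anti[of z y] anti[of x z] anti[of y x] by (simp add: b algebra_simps)
  qed
  ultimately show ?thesis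
    using assms by (simp add: finite_dim_lie_algebra_def lie_algebra_def bilinear_map_flip)
qed

context matched
begin

lemma opposite_matched: "matched (opposite_pair M)"
proof
  have "la (opposite_pair M) = (\<lambda>X \<xi>. \<xi> \<triangleleft> X)" "ra (opposite_pair M) = (\<lambda>X \<xi>. \<xi> \<triangleright> X)"
    by (simp_all add: opposite_pair_def)
  then show "matched_pair (opposite_pair M)"
    using bilinear_map_flip[OF la_bilinear] bilinear_map_flip[OF ra_bilinear]
    by (simp add: matched_pair_def opposite_finite_dim finite_dim la_bracket1 la_bracket2 ra_bracket1 ra_bracket2)
qed

abbreviation reverse_sum :: "('a \<times> 'b) free_alg \<Rightarrow> ('b \<times> 'a) free_alg" where
  "reverse_sum \<equiv> trev (\<lambda>(X, \<xi>). (\<xi>, X))"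

text \<open>Reversal of words carries \<open>p q\<close> to a product of the same normally ordered form for the opposite
  matched pair, where \<open>q\<close> now belongs to the first factor and survives.\<close>

definition proj2 :: "('a \<times> 'b) free_alg \<Rightarrow> 'b free_alg" where
  "proj2 z = trev id (proj1 (opposite_pair M) (reverse_sum z))"

lemma trev_id_uea_ideal:
  "z \<in> uea_ideal (opposite L) \<Longrightarrow> trev id z \<in> uea_ideal L"
  by (erule trev_uea_ideal[rotated -1]) simp_all

lemma counit_trev: "counit (trev h p) = counit p"
  by (induction p rule: free_alg_induct) (simp_all add: lookup_add lookup_tscale const_commute)

lemma proj2_uea_ideal:
  assumes "z \<in> uea_ideal D"
  shows "proj2 z \<in> uea_ideal L2"
proof -
  interpret op: matched "opposite_pair M" by (rule opposite_matched)
  have "reverse_sum z \<in> uea_ideal op.D"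
    using assms by (rule trev_uea_ideal[rotated -1]) auto
  then show ?thesis
    using op.proj1_uea_ideal by (simp add: proj2_def trev_id_uea_ideal)
qed

lemma proj2_simps [simp]:
  "proj2 (x + y) = proj2 x + proj2 y" "proj2 (tscale c x) = tscale c (proj2 x)"
  "proj2 (x - y) = proj2 x - proj2 y" "proj2 0 = 0" "proj2 1 = 1"
proof -
  interpret op: matched "opposite_pair M" by (rule opposite_matched)
  show "proj2 (x + y) = proj2 x + proj2 y" "proj2 (tscale c x) = tscale c (proj2 x)"
    "proj2 (x - y) = proj2 x - proj2 y" "proj2 0 = 0" "proj2 1 = 1"
    unfolding proj2_def trev_simps op.proj1_simps by simp_all
qed

lemma proj2_emb1: "proj2 (emb1 p * z) - tscale (counit p) (proj2 z) \<in> uea_ideal L2"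
proof -
  interpret op: matched "opposite_pair M" by (rule opposite_matched)
  have "trev (\<lambda>(X, \<xi>). (\<xi>, X)) (emb1 p) = (emb2 (trev id p) :: ('b \<times> 'a) free_alg)"
    by (induction p rule: free_alg_induct) (simp_all add: rev_map comp_def)
  then show ?thesis
    using trev_id_uea_ideal[OF op.proj1_emb2[of "reverse_sum z" "trev id p", unfolded opposite_pair_simps]]
    by (simp add: proj2_def counit_trev const_commute)
qed

lemma proj2_emb2: "proj2 (z * emb2 q) - proj2 z * q \<in> uea_ideal L2"
proof -
  interpret op: matched "opposite_pair M" by (rule opposite_matched)
  have "trev (\<lambda>(X, \<xi>). (\<xi>, X)) (emb2 q) = (emb1 (trev id q) :: ('b \<times> 'a) free_alg)"
    by (induction q rule: free_alg_induct) (simp_all add: rev_map comp_def)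
  then show ?thesis
    using trev_id_uea_ideal[OF op.proj1_emb1[of "trev id q" "reverse_sum z", unfolded opposite_pair_simps]]
    by (simp add: proj2_def flip: id_def)
qed

end

section \<open>The mutual actions on generators\<close>

lemma sum_append:
  fixes f :: "nat \<Rightarrow> 'c::comm_monoid_add"
  shows "(\<Sum>i<n + m. f i) = (\<Sum>i<n. f i) + (\<Sum>i<m. f (n + i))"
  by (induction m) (simp_all add: add.assoc)

context matched
begin

lemma scale_zero: "lscale L1 c 0 = 0" "lscale L2 c 0 = 0"
proof -
  interpret V1: vector_space "lscale L1" by (rule scale1)
  interpret V2: vector_space "lscale L2" by (rule scale2)
  show "lscale L1 c 0 = 0" "lscale L2 c 0 = 0"
    by (rule V1.scale_zero_right V2.scale_zero_right)+
qed

text \<open>Existence of a factorisation, on representatives and with an arbitrary element of the free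
  algebra in place of \<open>u' u\<close>, so that it can be shown by induction.\<close>

definition ordered :: "('a \<times> 'b) free_alg \<Rightarrow> bool" where
  "ordered z \<longleftrightarrow> (\<exists>(n::nat) p q. z - (\<Sum>i<n. emb1 (p i) * emb2 (q i)) \<in> uea_ideal D)"

lemma umap1: "umap D (\<lambda>X. (X, 0)) (uclass L1 x) = uclass D (emb1 x)"
  and umap2: "umap D (\<lambda>\<xi>. (0, \<xi>)) (uclass L2 y) = uclass D (emb2 y)"
  by (rule umap_uclass; simp add: la_simps ra_simps br1_simps br2_simps
      scale_zero)+

lemma ordered_cong:
  assumes "ordered z" and yz: "y - z \<in> uea_ideal D"
  shows "ordered y"
proof -
  obtain n :: nat and p q where "z - (\<Sum>i<n. emb1 (p i) * emb2 (q i)) \<in> uea_ideal D"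
    using assms unfolding ordered_def by blast
  from uea_ideal_add[OF yz this] show ?thesis
    unfolding ordered_def by auto
qed

lemma ordered_product: "ordered (emb1 p * emb2 q)"
  unfolding ordered_def by (intro exI[of _ "1::nat"] exI[of _ "\<lambda>_. p"] exI[of _ "\<lambda>_. q"]) simp

lemma ordered_add:
  assumes "ordered y" "ordered z"
  shows "ordered (y + z)"
proof -
  obtain n m :: nat and p q p' q'
    where y: "y - (\<Sum>i<n. emb1 (p i) * emb2 (q i)) \<in> uea_ideal D"
      and z: "z - (\<Sum>i<m. emb1 (p' i) * emb2 (q' i)) \<in> uea_ideal D"
    using assms unfolding ordered_def by blast
  let ?p = "\<lambda>i. if i < n then p i else p' (i - n)" and ?q = "\<lambda>i. if i < n then q i else q' (i - n)"
  have "(\<Sum>i<n+m. emb1 (?p i) * emb2 (?q i))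
      = (\<Sum>i<n. emb1 (p i) * emb2 (q i)) + (\<Sum>i<m. emb1 (p' i) * emb2 (q' i))"
    by (simp add: sum_append)
  then show ?thesis
    unfolding ordered_def using uea_ideal_add[OF y z]
    by (intro exI[of _ "n + m"] exI[of _ ?p] exI[of _ ?q]) (simp only: add_diff_add)
qed

lemma ordered_mult_emb2:
  assumes "ordered z"
  shows "ordered (z * emb2 y)"
proof -
  obtain n :: nat and p q where z: "z - (\<Sum>i<n. emb1 (p i) * emb2 (q i)) \<in> uea_ideal D"
    using assms unfolding ordered_def by blast
  show ?thesis
    unfolding ordered_def
    using uea_ideal_mult_right[OF z, of "emb2 y"]
    by (intro exI[of _ n] exI[of _ p] exI[of _ "\<lambda>i. q i * y"])
      (simp add: left_diff_distrib sum_distrib_right mult.assoc)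
qed

lemma ordered_tscale:
  assumes "ordered z"
  shows "ordered (tscale c z)"
  using ordered_mult_emb2[OF assms, of "const c"] by (simp add: const_commute)

lemma cross_relation:
  "gen (0, \<xi>) * gen (X, 0) - (gen (X, 0) * gen (0, \<xi>) + gen (\<xi> \<triangleright> X, 0) + gen (0, \<xi> \<triangleleft> X)) \<in> uea_ideal D"
proof -
  have "gen (0, \<xi>) * gen (X, 0) - gen (X, 0) * gen (0, \<xi>) - gen (\<xi> \<triangleright> X, \<xi> \<triangleleft> X) \<in> uea_ideal D"
    using uea_rel_bracket[of "(0, \<xi>)" "(X, 0)" D] by (simp add: br1_simps br2_simps la_simps ra_simps)
  from uea_ideal_add[OF this uea_rel_add[of "(\<xi> \<triangleright> X, 0)" "(0, \<xi> \<triangleleft> X)" D]]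
  show ?thesis
    by (simp add: algebra_simps)
qed

text \<open>The relation that drives all inductions on words in \<open>U\<^sub>2\<close>: the last letter \<open>\<xi>\<close> is moved past \<open>X\<close>,
  so that only shorter words remain to the left of an element of \<open>\<gg>\<^sub>1\<close>.\<close>

lemma snoc_relation:
  "emb2 (x * gen \<xi>) * gen (X, 0)
    - (emb2 x * gen (X, 0) * emb2 (gen \<xi>) + emb2 x * gen (\<xi> \<triangleright> X, 0) + emb2 (x * gen (\<xi> \<triangleleft> X))) \<in> uea_ideal D"
  using uea_ideal_mult_left[OF cross_relation[of \<xi> X], of "emb2 x"] by (simp add: algebra_simps)

lemma ordered_emb2_gen: "ordered (emb2 x * gen (X, 0))"
proof (induction x arbitrary: X rule: free_alg_induct)
  case (word w)
  show ?case
  proof (induction w arbitrary: X rule: rev_induct)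
    case Nil
    show ?case using ordered_product[of "gen X" 1] by simp
  next
    case (snoc \<xi> w)
    have "ordered (emb2 (word w * gen (\<xi> \<triangleleft> X)))"
      using ordered_product[of 1 "word w * gen (\<xi> \<triangleleft> X)"] by (simp del: tmap_mult)
    then have "ordered (emb2 (word w * gen \<xi>) * gen (X, 0))"
      by (rule ordered_cong[OF ordered_add[OF ordered_add[OF ordered_mult_emb2[OF snoc] snoc]] snoc_relation])
    then show ?case
      by (simp add: word_mult del: tmap_mult)
  qed
next
  case (scale c x)
  show ?case using ordered_tscale[OF scale] by (simp add: mult.assoc)
next
  case (add x y)
  show ?case using ordered_add[OF add] by (simp add: distrib_right)
qed

lemma factorisation_iff:
  "factorisation M (uclass L2 x) (uclass L1 y) n p q \<longleftrightarrow>
     (\<exists>p' q'. (\<forall>i<n. p i = uclass L1 (p' i) \<and> q i = uclass L2 (q' i)) \<and>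
        emb2 x * emb1 y - (\<Sum>i<n. emb1 (p' i) * emb2 (q' i)) \<in> uea_ideal D)" (is "_ \<longleftrightarrow> ?R")
proof
  have *: "(\<Oplus>\<^bsub>UEA D\<^esub>i\<in>{..<n}. umap D (\<lambda>X. (X, 0)) (p i) \<otimes>\<^bsub>UEA D\<^esub> umap D (\<lambda>\<xi>. (0, \<xi>)) (q i))
      = uclass D (\<Sum>i<n. emb1 (p' i) * emb2 (q' i))"
    if pq: "\<forall>i<n. p i = uclass L1 (p' i) \<and> q i = uclass L2 (q' i)" for p' q'
  proof -
    interpret ring "UEA D" by (rule UEA_ring)
    have "(\<Oplus>\<^bsub>UEA D\<^esub>i\<in>{..<n}. umap D (\<lambda>X. (X, 0)) (p i) \<otimes>\<^bsub>UEA D\<^esub> umap D (\<lambda>\<xi>. (0, \<xi>)) (q i))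
        = (\<Oplus>\<^bsub>UEA D\<^esub>i\<in>{..<n}. uclass D (emb1 (p' i) * emb2 (q' i)))"
      using pq by (intro finsum_cong') (auto simp: umap1 umap2 uclass_mult)
    then show ?thesis
      by (simp add: finsum_uclass)
  qed
  {
    assume f: "factorisation M (uclass L2 x) (uclass L1 y) n p q"
    have "\<exists>x. p i = uclass L1 x" "\<exists>x. q i = uclass L2 x" if "i < n" for i
      using f that unfolding factorisation_def Let_def UEA_carrier by blast+
    then obtain p' q' where pq: "\<forall>i<n. p i = uclass L1 (p' i) \<and> q i = uclass L2 (q' i)"
      by metis
    then show ?R
      using f unfolding factorisation_def Let_def *[OF pq] umap1 umap2 uclass_mult uclass_eq_iff by blast
  next
    assume ?R
    then obtain p' q' where pq: "\<forall>i<n. p i = uclass L1 (p' i) \<and> q i = uclass L2 (q' i)"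
      and z: "emb2 x * emb1 y - (\<Sum>i<n. emb1 (p' i) * emb2 (q' i)) \<in> uea_ideal D"
      by blast
    then show "factorisation M (uclass L2 x) (uclass L1 y) n p q"
      unfolding factorisation_def Let_def *[OF pq] umap1 umap2 uclass_mult uclass_eq_iff by auto
  }
qed

lemma
  shows proj1_sum: "proj1 M (\<Sum>i<n::nat. emb1 (p i) * emb2 (q i)) - (\<Sum>i<n. tscale (counit (q i)) (p i)) \<in> uea_ideal L1"
    and proj2_sum: "proj2 (\<Sum>i<n::nat. emb1 (p i) * emb2 (q i)) - (\<Sum>i<n. tscale (counit (p i)) (q i)) \<in> uea_ideal L2"
proof -
  have 1: "proj1 M (emb1 p * emb2 q) - tscale (counit q) p \<in> uea_ideal L1" for p q
    using uea_ideal_add[OF proj1_emb2[of "emb1 p" q] uea_ideal_mult_left[OF proj1_emb1[of p 1], of "const (counit q)"]]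
    by (simp add: right_diff_distrib)
  have 2: "proj2 (emb1 p * emb2 q) - tscale (counit p) q \<in> uea_ideal L2" for p q
    using uea_ideal_add[OF proj2_emb1[of p "emb2 q"] uea_ideal_mult_left[OF proj2_emb2[of 1 q], of "const (counit p)"]]
    by (simp add: right_diff_distrib)
  show "proj1 M (\<Sum>i<n::nat. emb1 (p i) * emb2 (q i)) - (\<Sum>i<n. tscale (counit (q i)) (p i)) \<in> uea_ideal L1"
  proof (induction n)
    case (Suc n)
    then show ?case
      using uea_ideal_add[OF Suc 1[of "p n" "q n"]] by (simp add: algebra_simps)
  qed simp
  show "proj2 (\<Sum>i<n::nat. emb1 (p i) * emb2 (q i)) - (\<Sum>i<n. tscale (counit (p i)) (q i)) \<in> uea_ideal L2"
  proof (induction n)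
    case (Suc n)
    then show ?case
      using uea_ideal_add[OF Suc 2[of "p n" "q n"]] by (simp add: algebra_simps)
  qed simp
qed

text \<open>The sums that define the mutual actions are the projections of \<open>u' u\<close>, which know nothing of the
  factorisation.\<close>

lemma factorisation_values:
  assumes "factorisation M (uclass L2 x) (uclass L1 y) n p q"
  shows "(\<Oplus>\<^bsub>UEA L1\<^esub>i\<in>{..<n}. uscale L1 (ucounit (q i)) (p i)) = uclass L1 (proj1 M (emb2 x * emb1 y))"
    and "(\<Oplus>\<^bsub>UEA L2\<^esub>i\<in>{..<n}. uscale L2 (ucounit (p i)) (q i)) = uclass L2 (proj2 (emb2 x * emb1 y))"
proof -
  obtain p' q' where pq: "\<And>i. i < n \<Longrightarrow> p i = uclass L1 (p' i) \<and> q i = uclass L2 (q' i)"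
    and z: "emb2 x * emb1 y - (\<Sum>i<n. emb1 (p' i) * emb2 (q' i)) \<in> uea_ideal D"
    using assms unfolding factorisation_iff by blast
  have "(\<Oplus>\<^bsub>UEA L1\<^esub>i\<in>{..<n}. uscale L1 (ucounit (q i)) (p i))
      = (\<Oplus>\<^bsub>UEA L1\<^esub>i\<in>{..<n}. uclass L1 (tscale (counit (q' i)) (p' i)))"
  proof -
    interpret ring "UEA L1" by (rule UEA_ring)
    show ?thesis
      using pq by (intro finsum_cong') (auto simp: uscale_uclass ucounit_uclass)
  qed
  also have "\<dots> = uclass L1 (proj1 M (emb2 x * emb1 y))"
    using uea_ideal_minus[OF uea_ideal_add[OF proj1_uea_ideal[OF z] proj1_sum[where n = n and p = p' and q = q']]]
    by (simp add: finsum_uclass uclass_eq_iff)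
  finally show "(\<Oplus>\<^bsub>UEA L1\<^esub>i\<in>{..<n}. uscale L1 (ucounit (q i)) (p i)) = uclass L1 (proj1 M (emb2 x * emb1 y))" .
  have "(\<Oplus>\<^bsub>UEA L2\<^esub>i\<in>{..<n}. uscale L2 (ucounit (p i)) (q i))
      = (\<Oplus>\<^bsub>UEA L2\<^esub>i\<in>{..<n}. uclass L2 (tscale (counit (p' i)) (q' i)))"
  proof -
    interpret ring "UEA L2" by (rule UEA_ring)
    show ?thesis
      using pq by (intro finsum_cong') (auto simp: uscale_uclass ucounit_uclass)
  qed
  also have "\<dots> = uclass L2 (proj2 (emb2 x * emb1 y))"
    using uea_ideal_minus[OF uea_ideal_add[OF proj2_uea_ideal[OF z] proj2_sum[where n = n and p = p' and q = q']]]
    by (simp add: finsum_uclass uclass_eq_iff)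
  finally show "(\<Oplus>\<^bsub>UEA L2\<^esub>i\<in>{..<n}. uscale L2 (ucounit (p i)) (q i)) = uclass L2 (proj2 (emb2 x * emb1 y))" .
qed

definition right_mutual :: "'b free_alg \<Rightarrow> 'a \<Rightarrow> 'b free_alg" where
  "right_mutual x X = proj2 (emb2 x * gen (X, 0))"

lemma
  shows mutual_left_proj1: "mutual_left M (uclass L2 x) (\<iota> L1 X) = uclass L1 (proj1 M (emb2 x * gen (X, 0)))"
    and mutual_right_uclass: "mutual_right M (uclass L2 x) (\<iota> L1 X) = uclass L2 (right_mutual x X)"
proof -
  obtain n :: nat and p q where "emb2 x * gen (X, 0) - (\<Sum>i<n. emb1 (p i) * emb2 (q i)) \<in> uea_ideal D"
    using ordered_emb2_gen[of x X] unfolding ordered_def by blast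
  then have f: "factorisation M (uclass L2 x) (uclass L1 (gen X)) n (\<lambda>i. uclass L1 (p i)) (\<lambda>i. uclass L2 (q i))"
    unfolding factorisation_iff by auto
  note v = factorisation_values[where y = "gen X"]
  show "mutual_left M (uclass L2 x) (\<iota> L1 X) = uclass L1 (proj1 M (emb2 x * gen (X, 0)))"
    unfolding mutual_left_def \<iota>_def
    by (rule the_equality) (use v f in \<open>fastforce+\<close>)
  show "mutual_right M (uclass L2 x) (\<iota> L1 X) = uclass L2 (right_mutual x X)"
    unfolding mutual_right_def right_mutual_def \<iota>_def
    by (rule the_equality) (use v f in \<open>fastforce+\<close>)
qed

lemma la_linear_ops: "linear_ops (lscale L1) (la M)"
  using scale1 by (simp add: linear_ops_def linear_ops_axioms_def la_simps)

text \<open>In the normal ordering of \<open>w \<xi> X\<close> the terms \<open>w X \<xi>\<close> and \<open>w (\<xi> \<triangleleft> X)\<close> are killed by the counit of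
  \<open>U\<^sub>2\<close>, which leaves \<open>w (\<xi> \<triangleright> X)\<close>.\<close>

lemma mutual_left_uclass:
  "mutual_left M (uclass L2 x) (\<iota> L1 X) = \<iota> L1 (word_ext (lscale L1) (la M) x X)"
proof -
  interpret la: linear_ops "lscale L1" "la M" by (rule la_linear_ops)
  have "proj1 M (emb2 x * gen (X, 0)) - gen (word_ext (lscale L1) (la M) x X) \<in> uea_ideal L1"
  proof (induction x arbitrary: X rule: free_alg_induct)
    case (word w)
    show ?case
    proof (induction w arbitrary: X rule: rev_induct)
      case Nil
      show ?case
        using proj1_emb1[of "gen X" 1] by simp
    next
      case (snoc \<xi> w)
      have 1: "proj1 M (emb2 (word w) * gen (X, 0) * emb2 (gen \<xi>)) \<in> uea_ideal L1"
        using proj1_emb2[of "emb2 (word w) * gen (X, 0)" "gen \<xi>"] by simp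
      have 2: "proj1 M (emb2 (word w * gen (\<xi> \<triangleleft> X))) \<in> uea_ideal L1"
        using proj1_emb2[of 1 "word w * gen (\<xi> \<triangleleft> X)"] by (simp add: lookup_Nil_mult)
      show ?case
        using uea_ideal_add[OF uea_ideal_add[OF proj1_uea_ideal[OF snoc_relation[of "word w" \<xi> X]] 1]
            uea_ideal_add[OF 2 snoc[of "\<xi> \<triangleright> X"]]]
        by (simp add: word_mult algebra_simps del: tmap_mult)
    qed
  next
    case (scale c x)
    show ?case
      using uea_ideal_diff[OF uea_ideal_mult_left[OF scale[of X], of "const c"]
        uea_rel_scale[of L1 c "word_ext (lscale L1) (la M) x X"]]
      by (simp add: la.word_ext_tscale mult.assoc algebra_simps)
  next
    case (add x y)
    show ?case
      using uea_ideal_diff[OF uea_ideal_add[OF add(1)[of X] add(2)[of X]]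
        uea_rel_add[of "word_ext (lscale L1) (la M) x X" "word_ext (lscale L1) (la M) y X" L1]]
      by (simp add: la.word_ext_plus algebra_simps)
  qed
  then show ?thesis
    unfolding mutual_left_proj1 \<iota>_def[of L1 "word_ext _ _ _ _"] uclass_eq_iff .
qed

lemma right_mutual_simps [simp]:
  "right_mutual (x + y) X = right_mutual x X + right_mutual y X"
  "right_mutual (tscale c x) X = tscale c (right_mutual x X)"
  by (simp_all add: right_mutual_def distrib_right mult.assoc)

lemma right_mutual_add: "right_mutual x (X + Y) - (right_mutual x X + right_mutual x Y) \<in> uea_ideal L2"
  using proj2_uea_ideal[OF uea_ideal_mult_left[OF uea_rel_add[of "(X, 0)" "(Y, 0)" D]], of "emb2 x"]
  by (simp add: right_mutual_def algebra_simps)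

lemma right_mutual_scale: "right_mutual x (lscale L1 c X) - tscale c (right_mutual x X) \<in> uea_ideal L2"
  using proj2_uea_ideal[OF uea_ideal_mult_left[OF uea_rel_scale[of D c "(X, 0)"]], of "emb2 x"]
  by (simp add: right_mutual_def right_diff_distrib mult_tscale[of "emb2 x"]
      scale_zero)

lemma right_mutual_1: "right_mutual 1 X \<in> uea_ideal L2"
  using proj2_emb1[of "gen X" 1] by (simp add: right_mutual_def)

lemma right_mutual_snoc:
  "right_mutual (x * gen \<xi>) X
    - (right_mutual x X * gen \<xi> + right_mutual x (\<xi> \<triangleright> X) + x * gen (\<xi> \<triangleleft> X)) \<in> uea_ideal L2"
proof -
  have 1: "proj2 (emb2 x * gen (X, 0) * emb2 (gen \<xi>)) - proj2 (emb2 x * gen (X, 0)) * gen \<xi> \<in> uea_ideal L2"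
    by (rule proj2_emb2)
  have 2: "proj2 (emb2 (x * gen (\<xi> \<triangleleft> X))) - x * gen (\<xi> \<triangleleft> X) \<in> uea_ideal L2"
    using proj2_emb2[of 1 "x * gen (\<xi> \<triangleleft> X)"] by simp
  show ?thesis
    using uea_ideal_add[OF proj2_uea_ideal[OF snoc_relation[of x \<xi> X]] uea_ideal_add[OF 1 2]]
    by (simp add: right_mutual_def algebra_simps del: tmap_mult)
qed

end

section \<open>Representative functions\<close>

declare plus_fun_apply [simp del] zero_fun_apply [simp del] minus_apply [simp del]

lemma fscale_apply: "fscale c f x = c * f x"
  by (simp add: fscale_def)

lemmas fn_apply = plus_fun_apply zero_fun_apply minus_apply fscale_apply

lemma fscale_vector_space: "vector_space fscale"
  by standard (auto simp: fun_eq_iff fn_apply algebra_simps)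

interpretation fn: vector_space fscale
  by (rule fscale_vector_space)

lemma uclass_apply [simp]:
  "fscale c f (uclass L x) = c * f (uclass L x)" "(f + g) (uclass L x) = f (uclass L x) + g (uclass L x)"
  "(0 :: _ \<Rightarrow> complex) (uclass L x) = 0" "(f - g) (uclass L x) = f (uclass L x) - (g (uclass L x) :: complex)"
  by (rule fn_apply)+

lemma udual_iff: "f \<in> udual L \<longleftrightarrow>
   (\<forall>x y. f (uclass L (x + y)) = f (uclass L x) + f (uclass L y)) \<and>
   (\<forall>c x. f (uclass L (tscale c x)) = c * f (uclass L x)) \<and>
   (\<forall>u. u \<notin> carrier (UEA L) \<longrightarrow> f u = 0)"
  unfolding udual_def by (auto simp: UEA_carrier uclass_add uscale_uclass)

lemma udualD:
  assumes "f \<in> udual L"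
  shows "f (uclass L (x + y)) = f (uclass L x) + f (uclass L y)"
    "f (uclass L (tscale c x)) = c * f (uclass L x)"
    "u \<notin> carrier (UEA L) \<Longrightarrow> f u = 0"
    "f (uclass L 0) = 0"
    "f (uclass L (x - y)) = f (uclass L x) - f (uclass L y)"
proof -
  show a: "f (uclass L (x + y)) = f (uclass L x) + f (uclass L y)"
    "f (uclass L (tscale c x)) = c * f (uclass L x)"
    "u \<notin> carrier (UEA L) \<Longrightarrow> f u = 0" for x y c u
    using assms by (auto simp: udual_iff)
  show "f (uclass L 0) = 0"
    using a(1)[of 0 0] by simp
  show "f (uclass L (x - y)) = f (uclass L x) - f (uclass L y)"
    using a(1)[of "x - y" y] by simp
qed

lemma udual_eqI:
  assumes "f \<in> udual L" "g \<in> udual L" "\<And>x. f (uclass L x) = g (uclass L x)"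
  shows "f = g"
proof
  fix u
  show "f u = g u"
    using assms by (cases "u \<in> carrier (UEA L)") (auto simp: udualD UEA_carrier)
qed

lemma udual_subspace: "fn.subspace (udual L)"
  by (rule fn.subspaceI) (auto simp: udual_iff fn_apply algebra_simps)

definition on_uea :: "'a::ab_group_add lie \<Rightarrow> ('a ue \<Rightarrow> complex) \<Rightarrow> 'a ue \<Rightarrow> complex" where
  "on_uea L f = (\<lambda>u. if u \<in> carrier (UEA L) then f u else 0)"

lemma on_uea_uclass [simp]: "on_uea L f (uclass L x) = f (uclass L x)"
  by (simp add: on_uea_def)

lemma on_uea_outside [simp]: "u \<notin> carrier (UEA L) \<Longrightarrow> on_uea L f u = 0"
  by (simp add: on_uea_def)

text \<open>Right multiplication in the enveloping algebra makes functionals a left module.\<close>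

definition translate :: "'a::ab_group_add lie \<Rightarrow> 'a ue \<Rightarrow> ('a ue \<Rightarrow> complex) \<Rightarrow> 'a ue \<Rightarrow> complex" where
  "translate L v f = on_uea L (\<lambda>u. f (u \<otimes>\<^bsub>UEA L\<^esub> v))"

lemma translate_uclass [simp]: "translate L (uclass L y) f (uclass L x) = f (uclass L (x * y))"
  by (simp add: translate_def uclass_mult)

lemma translate_gen [simp]: "translate L (\<iota> L X) f (uclass L x) = f (uclass L (x * gen X))"
  by (simp add: \<iota>_def)

lemma translate_outside [simp]: "u \<notin> carrier (UEA L) \<Longrightarrow> translate L v f u = 0"
  by (simp add: translate_def)

lemma translate_udual: "f \<in> udual L \<Longrightarrow> translate L (uclass L y) f \<in> udual L"
  by (auto simp: udual_iff distrib_right mult.assoc)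

lemma translate_gen_udual: "f \<in> udual L \<Longrightarrow> translate L (\<iota> L X) f \<in> udual L"
  by (simp add: \<iota>_def translate_udual)

lemma translate_plus: "translate L v (f + g) = translate L v f + translate L v g"
  and translate_fscale: "translate L v (fscale c f) = fscale c (translate L v f)"
  and translate_0: "translate L v 0 = 0"
  by (auto simp: translate_def on_uea_def fun_eq_iff fn_apply)

text \<open>For the enveloping algebra, the functionals that vanish on an ideal of finite codimension are
  those whose right translates span a finite-dimensional space; stability needs only be tested on
  generators.\<close>

definition representative :: "'a::ab_group_add lie \<Rightarrow> ('a ue \<Rightarrow> complex) \<Rightarrow> bool" where
  "representative L f \<longleftrightarrow> (\<exists>F. finite F \<and> F \<subseteq> udual L \<and> f \<in> fn.span F \<and>
     (\<forall>g\<in>F. \<forall>X. translate L (\<iota> L X) g \<in> fn.span F))"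

lemma span_udual: "F \<subseteq> udual L \<Longrightarrow> fn.span F \<subseteq> udual L"
  by (rule fn.span_minimal[OF _ udual_subspace])

lemma translate_span:
  assumes F: "F \<subseteq> udual L" and gen: "\<And>g X. g \<in> F \<Longrightarrow> translate L (\<iota> L X) g \<in> fn.span F"
    and g: "g \<in> fn.span F"
  shows "translate L (uclass L y) g \<in> fn.span F"
  using g
proof (induction y arbitrary: g rule: free_alg_induct)
  case (word w)
  then show ?case
  proof (induction w arbitrary: g)
    case Nil
    have "translate L (uclass L 1) g = g"
      using Nil span_udual[OF F] by (intro udual_eqI[of _ L]) (auto intro: translate_udual)
    then show ?case
      using Nil by simp
  next
    case (Cons X w)
    have step: "translate L (\<iota> L X) h \<in> fn.span F" if "h \<in> fn.span F" for h
      using that by (induction rule: fn.span_induct_alt)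
        (auto simp: translate_0 translate_plus translate_fscale fn.span_zero intro!: fn.span_add fn.span_scale gen)
    have "translate L (uclass L (word (X # w))) g = translate L (\<iota> L X) (translate L (uclass L (word w)) g)"
      using Cons span_udual[OF F]
      by (intro udual_eqI[of _ L]) (auto simp: word_Cons[of X w] mult.assoc intro: translate_udual translate_gen_udual)
    then show ?case
      using step[OF Cons.IH[OF Cons.prems]] by simp
  qed
next
  case (scale c y)
  have "translate L (uclass L (tscale c y)) g = fscale c (translate L (uclass L y) g)"
    using scale.prems span_udual[OF F]
    by (intro udual_eqI[of _ L] fn.subspace_scale[OF udual_subspace])
      (auto simp: udualD mult_tscale intro: translate_udual)
  then show ?case
    using fn.span_scale[OF scale.IH[OF scale.prems]] by simp
next
  case (add x y)
  have "translate L (uclass L (x + y)) g = translate L (uclass L x) g + translate L (uclass L y) g"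
    using add.prems span_udual[OF F]
    by (intro udual_eqI[of _ L] fn.subspace_add[OF udual_subspace])
      (auto simp: udualD distrib_left intro: translate_udual)
  then show ?case
    using fn.span_add[OF add.IH(1)[OF add.prems] add.IH(2)[OF add.prems]] by simp
qed

text \<open>Each point cuts out a subspace of codimension at most one.\<close>

lemma finite_dim_of_separating_points:
  assumes "finite P" "fn.subspace W" "\<And>g. g \<in> W \<Longrightarrow> (\<And>p. p \<in> P \<Longrightarrow> g p = 0) \<Longrightarrow> g = 0"
  shows "\<exists>F. finite F \<and> F \<subseteq> W \<and> W \<subseteq> fn.span F"
  using assms
proof (induction P arbitrary: W rule: finite_induct)
  case empty
  then show ?case by (intro exI[of _ "{}"]) auto
next
  case (insert p P)
  let ?W = "{g \<in> W. g p = 0}"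
  have sub: "fn.subspace ?W"
    using insert.prems(1) unfolding fn.subspace_def by (simp add: fn_apply)
  obtain F where F: "finite F" "F \<subseteq> ?W" "?W \<subseteq> fn.span F"
    using insert.IH[OF sub] insert.prems(2) by auto
  show ?case
  proof (cases "W = ?W")
    case True
    then show ?thesis using F by blast
  next
    case False
    then obtain g where g: "g \<in> W" "g p \<noteq> 0"
      by blast
    have "h \<in> fn.span (insert g F)" if "h \<in> W" for h
    proof -
      have "h - fscale (h p / g p) g \<in> ?W"
        using that g fn.subspace_diff[OF insert.prems(1) _ fn.subspace_scale[OF insert.prems(1)]]
        by (simp add: minus_apply fscale_apply[of _ g p])
      then show ?thesis
        using F(3) fn.span_breakdown_eq by blast
    qed
    then show ?thesis
      using F g by (intro exI[of _ "insert g F"]) auto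
  qed
qed

text \<open>The functionals that vanish on the ideal form a stable space. It is finite-dimensional, since they are
  determined by their values on a finite set that spans the kernel modulo the ideal and at one further
  point outside of the kernel.\<close>

lemma representative_if_R_alg:
  assumes "f \<in> R_alg L"
  shows "representative L f"
proof -
  obtain I where f: "f \<in> udual L" and I: "ideal I (UEA L)" and IK: "I \<subseteq> ukernel L f"
    and fd: "finite_dim_quotient L (ukernel L f) I"
    using assms unfolding R_alg_def by blast
  obtain B where B: "finite B" "B \<subseteq> ukernel L f"
    and BI: "\<forall>u\<in>ukernel L f. \<exists>c. \<exists>i\<in>I. u = (\<Oplus>\<^bsub>UEA L\<^esub> b\<in>B. uscale L (c b) b) \<oplus>\<^bsub>UEA L\<^esub> i"
    using fd unfolding finite_dim_quotient_def by (elim exE conjE) (rule that)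
  interpret I: ideal I "UEA L" by (rule I)
  define W where "W = {g \<in> udual L. \<forall>i\<in>I. g i = 0}"
  have W: "fn.subspace W"
    using udual_subspace[of L] unfolding W_def fn.subspace_def by (auto simp: fn_apply)
  define r where "r = inv_into UNIV (uclass L)"
  have r: "uclass L (r b) = b" if "b \<in> B" for b
    unfolding r_def using that B(2) by (intro f_inv_into_f) (auto simp: ukernel_def UEA_carrier)
  have vanish: "g u = 0" if g: "g \<in> W" "\<And>b. b \<in> B \<Longrightarrow> g b = 0" and u: "u \<in> ukernel L f" for g u
  proof -
    have gd: "g \<in> udual L"
      using g(1) by (simp add: W_def)
    obtain c i where i: "i \<in> I" and u: "u = (\<Oplus>\<^bsub>UEA L\<^esub> b\<in>B. uscale L (c b) b) \<oplus>\<^bsub>UEA L\<^esub> i"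
      using bspec[OF BI u] by blast
    obtain y where y: "i = uclass L y"
      using subsetD[OF I.a_subset i] by (rule carrier_cases)
    have "(\<Oplus>\<^bsub>UEA L\<^esub> b\<in>B. uscale L (c b) b) = (\<Oplus>\<^bsub>UEA L\<^esub> b\<in>B. uclass L (tscale (c b) (r b)))"
    proof (rule I.finsum_cong')
      show "uscale L (c b) b = uclass L (tscale (c b) (r b))" if "b \<in> B" for b
        using uscale_uclass[of L "c b" "r b"] by (simp add: r[OF that])
    qed auto
    then have "g u = g (uclass L ((\<Sum>b\<in>B. tscale (c b) (r b)) + y))"
      by (simp add: u y finsum_uclass[OF B(1)] uclass_add)
    also have "\<dots> = g (uclass L (\<Sum>b\<in>B. tscale (c b) (r b))) + g i"
      by (simp add: udualD[OF gd] y)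
    also have "g i = 0"
      using g(1) i by (simp add: W_def)
    also have "g (uclass L (\<Sum>b\<in>A. tscale (c b) (r b))) = 0" if "finite A" "A \<subseteq> B" for A
      using that
    proof (induction A rule: finite_induct)
      case (insert b A)
      then have "g (uclass L (r b)) = 0"
        using g(2)[of b] r[of b] by simp
      with insert show ?case
        by (simp add: udualD[OF gd])
    qed (simp add: udualD[OF gd])
    from this[OF B(1)] have "g (uclass L (\<Sum>b\<in>B. tscale (c b) (r b))) = 0"
      by simp
    finally show "g u = 0" by simp
  qed
  obtain P where P: "finite P" "\<And>g. g \<in> W \<Longrightarrow> (\<And>p. p \<in> P \<Longrightarrow> g p = 0) \<Longrightarrow> g = 0"
  proof (cases "f = 0")
    case True
    have "g = 0" if g: "g \<in> W" "\<And>b. b \<in> B \<Longrightarrow> g b = 0" for g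
    proof (rule udual_eqI[of _ L])
      show "g (uclass L x) = 0 (uclass L x)" for x
        using vanish[OF g, of "uclass L x"] True by (simp add: ukernel_def)
    qed (use g in \<open>auto simp: W_def intro: fn.subspace_0[OF udual_subspace]\<close>)
    then show ?thesis by (rule that[OF B(1)])
  next
    case False
    then obtain x0 where x0: "f (uclass L x0) \<noteq> 0"
      using udual_eqI[OF f fn.subspace_0[OF udual_subspace]] by auto
    have "g = 0" if g: "g \<in> W" "\<And>b. b \<in> insert (uclass L x0) B \<Longrightarrow> g b = 0" for g
    proof (rule udual_eqI[of _ L])
      have gd: "g \<in> udual L" using g(1) by (simp add: W_def)
      then show "g \<in> udual L" .
      fix x
      let ?c = "f (uclass L x) / f (uclass L x0)"
      have "g (uclass L (x - tscale ?c x0)) = 0"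
      proof (rule vanish)
        show "uclass L (x - tscale ?c x0) \<in> ukernel L f"
          using x0 by (simp add: ukernel_def udualD[OF f])
      qed (use g in auto)
      then show "g (uclass L x) = 0 (uclass L x)"
        using g(2)[of "uclass L x0"] by (simp add: udualD[OF gd])
    qed (rule fn.subspace_0[OF udual_subspace])
    then show ?thesis by (rule that[OF finite.insertI[OF B(1)]])
  qed
  obtain F where F: "finite F" "F \<subseteq> W" "W \<subseteq> fn.span F"
    using finite_dim_of_separating_points[OF P(1) W P(2)] by blast
  have "translate L (\<iota> L X) g \<in> W" if g: "g \<in> W" for g X
  proof -
    have "translate L (\<iota> L X) g i = 0" if i: "i \<in> I" for i
    proof -
      obtain y where y: "i = uclass L y"
        using subsetD[OF I.a_subset i] by (rule carrier_cases)
      have "uclass L y \<otimes>\<^bsub>UEA L\<^esub> uclass L (gen X) \<in> I"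
        using i y by (intro I.I_r_closed) auto
      then show ?thesis
        using g by (simp add: y W_def uclass_mult)
    qed
    then show ?thesis
      using g by (simp add: W_def translate_gen_udual)
  qed
  moreover have "f \<in> W"
    using f IK by (auto simp: W_def ukernel_def)
  moreover have "F \<subseteq> udual L"
    using F(2) by (auto simp: W_def)
  ultimately show ?thesis
    unfolding representative_def using F by (intro exI[of _ F]) blast
qed

text \<open>Coordinates, with respect to a basis \<open>F\<close> of a translation-stable space, of the translates of
  one of its elements: the matrix coefficients of the representation of \<open>U(L)\<close> on the space.\<close>

definition coefficient :: "'a::ab_group_add lie \<Rightarrow> ('a ue \<Rightarrow> complex) set \<Rightarrow>
    ('a ue \<Rightarrow> complex) \<Rightarrow> ('a ue \<Rightarrow> complex) \<Rightarrow> 'a ue \<Rightarrow> complex" where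
  "coefficient L F h g = on_uea L (\<lambda>v. fn.representation F (translate L v g) h)"

locale stable_basis =
  fixes L :: "'a::ab_group_add lie" and F
  assumes finF: "finite F" and F_udual: "F \<subseteq> udual L" and indep: "fn.independent F"
    and stable: "\<And>g X. g \<in> F \<Longrightarrow> translate L (\<iota> L X) g \<in> fn.span F"
begin

lemma translate_in_span: "g \<in> fn.span F \<Longrightarrow> translate L (uclass L y) g \<in> fn.span F"
  by (rule translate_span[OF F_udual stable])

lemma span_in_udual: "g \<in> fn.span F \<Longrightarrow> g \<in> udual L"
  using span_udual[OF F_udual] by blast

lemma coefficient_uclass:
  "coefficient L F h g (uclass L y) = fn.representation F (translate L (uclass L y) g) h"
  by (simp add: coefficient_def)

lemma coefficient_plus:
  assumes "g \<in> fn.span F" "g' \<in> fn.span F"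
  shows "coefficient L F h (g + g') = coefficient L F h g + coefficient L F h g'"
proof
  fix u
  show "coefficient L F h (g + g') u = (coefficient L F h g + coefficient L F h g') u"
    unfolding plus_fun_apply[of _ _ u] using assms by (cases "u \<in> carrier (UEA L)")
      (auto simp: coefficient_def UEA_carrier translate_plus fn.representation_add[OF indep] translate_in_span)
qed

lemma coefficient_fscale:
  assumes "g \<in> fn.span F"
  shows "coefficient L F h (fscale c g) = fscale c (coefficient L F h g)"
proof
  fix u
  show "coefficient L F h (fscale c g) u = fscale c (coefficient L F h g) u"
    unfolding fscale_apply[of _ _ u] using assms by (cases "u \<in> carrier (UEA L)")
      (auto simp: coefficient_def UEA_carrier translate_fscale fn.representation_scale[OF indep] translate_in_span)
qed

lemma coefficient_udual:
  assumes g: "g \<in> fn.span F"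
  shows "coefficient L F h g \<in> udual L"
proof -
  have "translate L (uclass L (x + y)) g = translate L (uclass L x) g + translate L (uclass L y) g" for x y
    by (intro udual_eqI[of _ L] fn.subspace_add[OF udual_subspace] translate_udual span_in_udual g)
      (simp add: distrib_left udualD[OF span_in_udual[OF g]])
  moreover have "translate L (uclass L (tscale c x)) g = fscale c (translate L (uclass L x) g)" for c x
    by (intro udual_eqI[of _ L] fn.subspace_scale[OF udual_subspace] translate_udual span_in_udual g)
      (simp add: mult_tscale udualD[OF span_in_udual[OF g]])
  ultimately show ?thesis
    by (auto simp: udual_iff coefficient_uclass fn.representation_add[OF indep]
        fn.representation_scale[OF indep] translate_in_span g) (simp add: coefficient_def)
qed

lemma coefficient_expansion:
  assumes g: "g \<in> fn.span F"
  shows "g (uclass L (x * y)) = (\<Sum>h\<in>F. coefficient L F h g (uclass L y) * h (uclass L x))"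
proof -
  have "translate L (uclass L y) g = (\<Sum>h\<in>F. fscale (fn.representation F (translate L (uclass L y) g) h) h)"
    by (rule fn.sum_representation_eq[symmetric]) (auto simp: indep finF translate_in_span g)
  then have "translate L (uclass L y) g (uclass L x)
      = (\<Sum>h\<in>F. fscale (fn.representation F (translate L (uclass L y) g) h) h) (uclass L x)"
    by metis
  then show ?thesis
    by (simp add: sum_fun_apply fscale_apply coefficient_uclass)
qed

lemma coefficient_translate:
  assumes g: "g \<in> fn.span F"
  shows "translate L (\<iota> L X) (coefficient L F h g) = coefficient L F h (translate L (\<iota> L X) g)"
proof (rule udual_eqI[of _ L])
  have t: "translate L (\<iota> L X) g \<in> fn.span F"
    using translate_in_span[OF g, of "gen X"] by (simp add: \<iota>_def)
  show "translate L (\<iota> L X) (coefficient L F h g) \<in> udual L"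
    by (intro translate_gen_udual coefficient_udual g)
  show "coefficient L F h (translate L (\<iota> L X) g) \<in> udual L"
    by (intro coefficient_udual t)
  fix y
  have "translate L (uclass L (y * gen X)) g = translate L (uclass L y) (translate L (\<iota> L X) g)"
    by (intro udual_eqI[of _ L] translate_udual translate_gen_udual span_in_udual g) (simp add: mult.assoc)
  then show "translate L (\<iota> L X) (coefficient L F h g) (uclass L y)
    = coefficient L F h (translate L (\<iota> L X) g) (uclass L y)"
    by (simp add: coefficient_uclass)
qed

end

text \<open>An equivariant linear map sends finite-dimensional submodules to finite-dimensional submodules.\<close>

lemma representative_orbit:
  fixes s :: "complex \<Rightarrow> 'v::ab_group_add \<Rightarrow> 'v"
  assumes s: "vector_space s" and B: "finite B"
    and add: "\<And>v w. v \<in> module.span s B \<Longrightarrow> w \<in> module.span s B \<Longrightarrow> \<theta> (v + w) = \<theta> v + \<theta> w"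
    and scale: "\<And>c v. v \<in> module.span s B \<Longrightarrow> \<theta> (s c v) = fscale c (\<theta> v)"
    and dual: "\<And>v. v \<in> module.span s B \<Longrightarrow> \<theta> v \<in> udual L"
    and inv: "\<And>X v. v \<in> module.span s B \<Longrightarrow> A X v \<in> module.span s B"
    and equi: "\<And>X v. v \<in> module.span s B \<Longrightarrow> translate L (\<iota> L X) (\<theta> v) = \<theta> (A X v)"
    and v: "v \<in> module.span s B"
  shows "representative L (\<theta> v)"
proof -
  interpret vector_space s by (rule s)
  have *: "\<theta> w \<in> fn.span (\<theta> ` B)" if "w \<in> span B" for w
  proof -
    have "w \<in> span B \<and> \<theta> w \<in> fn.span (\<theta> ` B)"
      using that
    proof (induction rule: span_induct_alt)
      case base
      have "\<theta> 0 = 0"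
        using scale[OF span_zero, of 0] by (simp add: fun_eq_iff fn_apply)
      then show ?case by (simp add: span_zero fn.span_zero)
    next
      case (step c x y)
      then show ?case
        by (auto simp: add scale span_base span_scale span_add fn.span_base intro!: fn.span_add fn.span_scale)
    qed
    then show ?thesis by blast
  qed
  show ?thesis
    unfolding representative_def using B v
    by (intro exI[of _ "\<theta> ` B"]) (auto simp: * equi span_base inv dual)
qed

lemma representative_basis:
  assumes "representative L f"
  obtains F where "stable_basis L F" "f \<in> fn.span F"
proof -
  obtain F where F: "finite F" "F \<subseteq> udual L" "f \<in> fn.span F"
    "\<forall>g\<in>F. \<forall>X. translate L (\<iota> L X) g \<in> fn.span F"
    using assms unfolding representative_def by blast
  obtain B where B: "B \<subseteq> F" "fn.independent B" "F \<subseteq> fn.span B"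
    using fn.maximal_independent_subset[of F] by blast
  have span: "fn.span B = fn.span F"
    using B by (meson fn.span_eq fn.span_superset subset_trans)
  show ?thesis
  proof (rule that)
    show "stable_basis L B"
      using B F span by unfold_locales (auto intro: finite_subset)
    show "f \<in> fn.span B"
      using F span by simp
  qed
qed

lemma (in stable_basis) representative_span: "g \<in> fn.span F \<Longrightarrow> representative L g"
  unfolding representative_def using finF F_udual stable by blast

lemma (in stable_basis) representative_coefficient:
  assumes "g \<in> fn.span F"
  shows "representative L (coefficient L F h g)"
proof (rule representative_orbit[OF fscale_vector_space finF _ _ _ _ _ assms])
  show "translate L (\<iota> L X) v \<in> fn.span F" if "v \<in> fn.span F" for X v
    using translate_in_span[OF that, of "gen X"] by (simp add: \<iota>_def)
qed (simp_all add: coefficient_plus coefficient_fscale coefficient_udual coefficient_translate)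

text \<open>Finitely many functionals on \<open>K\<close> have a common kernel of finite codimension: \<open>B\<close> spans \<open>K\<close> modulo
  that kernel. The induction adds one functional and at most one vector at a time.\<close>

lemma finite_codimension:
  assumes "finite \<Phi>" "\<Phi> \<subseteq> udual L" "module.subspace tscale K"
  shows "\<exists>B. finite B \<and> B \<subseteq> K \<and>
    (\<forall>x\<in>K. \<exists>b\<in>module.span tscale B. \<forall>\<phi>\<in>\<Phi>. \<phi> (uclass L x) = \<phi> (uclass L b))"
proof -
  interpret vector_space tscale by (rule tscale_vector_space)
  show ?thesis
    using assms
  proof (induction \<Phi> rule: finite_induct)
    case empty
    then show ?case by (intro exI[of _ "{}"]) auto
  next
    case (insert \<phi> \<Phi>)
    then obtain B where B: "finite B" "B \<subseteq> K"
      and app: "\<And>x. x \<in> K \<Longrightarrow> \<exists>b\<in>span B. \<forall>\<phi>\<in>\<Phi>. \<phi> (uclass L x) = \<phi> (uclass L b)"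
      by auto
    have BK: "span B \<subseteq> K"
      using B(2) insert.prems(2) by (rule span_minimal)
    have dual: "\<psi> \<in> udual L" if "\<psi> \<in> insert \<phi> \<Phi>" for \<psi>
      using insert.prems(1) that by blast
    show ?case
    proof (cases "\<exists>y\<in>K. (\<forall>\<psi>\<in>\<Phi>. \<psi> (uclass L y) = 0) \<and> \<phi> (uclass L y) \<noteq> 0")
      case True
      then obtain y where y: "y \<in> K" "\<And>\<psi>. \<psi> \<in> \<Phi> \<Longrightarrow> \<psi> (uclass L y) = 0" "\<phi> (uclass L y) \<noteq> 0"
        by blast
      have "\<exists>b\<in>span (insert y B). \<forall>\<psi>\<in>insert \<phi> \<Phi>. \<psi> (uclass L x) = \<psi> (uclass L b)" if "x \<in> K" for x
      proof -
        obtain b where b: "b \<in> span B" "\<And>\<psi>. \<psi> \<in> \<Phi> \<Longrightarrow> \<psi> (uclass L x) = \<psi> (uclass L b)"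
          using app[OF \<open>x \<in> K\<close>] by blast
        let ?t = "\<phi> (uclass L (x - b)) / \<phi> (uclass L y)"
        have "b + tscale ?t y \<in> span (insert y B)"
          using b(1) span_mono[of B "insert y B"] by (blast intro: span_add span_scale span_base)
        moreover have "\<psi> (uclass L x) = \<psi> (uclass L (b + tscale ?t y))" if "\<psi> \<in> insert \<phi> \<Phi>" for \<psi>
        proof (cases "\<psi> = \<phi>")
          case False
          then have "\<psi> \<in> \<Phi>" using that by simp
          then show ?thesis
            by (simp add: udualD[OF dual[OF that]] b(2) y(2)[of \<psi>])
        qed (use y(3) in \<open>simp add: udualD[OF dual]\<close>)
        ultimately show ?thesis by blast
      qed
      then show ?thesis
        using B y(1) by (intro exI[of _ "insert y B"]) auto
    next
      case False
      have "\<forall>\<psi>\<in>insert \<phi> \<Phi>. \<psi> (uclass L x) = \<psi> (uclass L b)"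
        if "x \<in> K" "b \<in> span B" "\<forall>\<psi>\<in>\<Phi>. \<psi> (uclass L x) = \<psi> (uclass L b)" for x b
      proof -
        have "x - b \<in> K"
          using that BK insert.prems(2) by (auto intro: subspace_diff)
        then have "\<phi> (uclass L (x - b)) = 0"
          using False that(3) by (auto simp: udualD[OF dual])
        then show ?thesis
          using that(3) by (auto simp: udualD[OF dual])
      qed
      then show ?thesis
        using B app by (intro exI[of _ B]) blast
    qed
  qed
qed

text \<open>Distinct elements of \<open>B\<close> may have the same class; their coefficients are then added up.\<close>

lemma uclass_span:
  assumes "finite B" "b \<in> module.span tscale B"
  shows "\<exists>c. uclass L b = (\<Oplus>\<^bsub>UEA L\<^esub> v\<in>uclass L ` B. uscale L (c v) v)"
proof -
  interpret vector_space tscale by (rule tscale_vector_space)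
  interpret R: ring "UEA L" by (rule UEA_ring)
  define r where "r = inv_into B (uclass L)"
  have r: "uclass L (r v) = v" if "v \<in> uclass L ` B" for v
    unfolding r_def using that by (rule f_inv_into_f)
  have fs: "(\<Oplus>\<^bsub>UEA L\<^esub> v\<in>uclass L ` B. uscale L (c v) v) = uclass L (\<Sum>v\<in>uclass L ` B. tscale (c v) (r v))" for c
  proof -
    have "(\<Oplus>\<^bsub>UEA L\<^esub> v\<in>uclass L ` B. uscale L (c v) v) = (\<Oplus>\<^bsub>UEA L\<^esub> v\<in>uclass L ` B. uclass L (tscale (c v) (r v)))"
    proof (rule R.finsum_cong')
      fix v assume "v \<in> uclass L ` B"
      then show "uscale L (c v) v = uclass L (tscale (c v) (r v))"
        using uscale_uclass[of L "c v" "r v"] by (simp add: r)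
    qed auto
    then show ?thesis
      using assms(1) by (simp add: finsum_uclass)
  qed
  show ?thesis
    using assms(2) unfolding fs
  proof (induction rule: span_induct_alt)
    case base
    show ?case by (intro exI[of _ "\<lambda>_. 0"]) simp
  next
    case (step k x y)
    then obtain c where c: "uclass L y = uclass L (\<Sum>v\<in>uclass L ` B. tscale (c v) (r v))"
      by blast
    let ?c = "\<lambda>v. c v + (if v = uclass L x then k else 0)"
    have "(\<Sum>v\<in>uclass L ` B. tscale (if v = uclass L x then k else 0) (r v)) = tscale k (r (uclass L x))"
      using assms(1) step(1) by (subst sum.remove[of _ "uclass L x"]) (auto intro: sum.neutral)
    then have "(\<Sum>v\<in>uclass L ` B. tscale (?c v) (r v))
        = tscale k (r (uclass L x)) + (\<Sum>v\<in>uclass L ` B. tscale (c v) (r v))"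
      by (simp add: const_add distrib_right sum.distrib)
    moreover have "uclass L (tscale k (r (uclass L x))) = uclass L (tscale k x)"
      using r[of "uclass L x"] step(1) by (metis imageI uscale_uclass)
    ultimately have "uclass L (tscale k x + y) = uclass L (\<Sum>v\<in>uclass L ` B. tscale (?c v) (r v))"
      using c by (simp flip: uclass_add)
    then show ?case by (rule exI[of _ ?c])
  qed
qed

text \<open>The annihilator of a finite-dimensional stable space is a two-sided ideal. It has finite codimension
  because it is the common kernel of the finitely many matrix coefficients.\<close>

lemma R_alg_if_representative:
  assumes "representative L f"
  shows "f \<in> R_alg L"
proof -
  obtain F where "stable_basis L F" and f: "f \<in> fn.span F"
    using representative_basis[OF assms] by blast
  interpret stable_basis L F by fact
  have fd: "f \<in> udual L"
    by (rule span_in_udual[OF f])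
  interpret R: ring "UEA L" by (rule UEA_ring)
  define I where "I = {u \<in> carrier (UEA L). \<forall>g\<in>F. \<forall>h\<in>F. coefficient L F h g u = 0}"
  have I_iff: "uclass L y \<in> I \<longleftrightarrow> (\<forall>g\<in>fn.span F. \<forall>x. g (uclass L (x * y)) = 0)" for y
  proof
    assume y: "uclass L y \<in> I"
    have F0: "g (uclass L (x * y)) = 0" if "g \<in> F" for g x
      using y that coefficient_expansion[OF fn.span_base[OF that], of x y] by (simp add: I_def)
    have "g (uclass L (x * y)) = 0" if "g \<in> fn.span F" for g x
      using that by (induction rule: fn.span_induct_alt) (auto simp: F0)
    then show "\<forall>g\<in>fn.span F. \<forall>x. g (uclass L (x * y)) = 0"
      by blast
  next
    assume y: "\<forall>g\<in>fn.span F. \<forall>x. g (uclass L (x * y)) = 0"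
    have "translate L (uclass L y) g = 0" if "g \<in> F" for g
      using that y F_udual
      by (intro udual_eqI[of _ L] translate_udual fn.subspace_0[OF udual_subspace]) (auto simp: fn.span_base)
    then show "uclass L y \<in> I"
      by (auto simp: I_def coefficient_uclass fn.representation_zero fn.span_base)
  qed
  have "ideal I (UEA L)"
  proof (rule idealI[OF UEA_ring])
    show "subgroup I (add_monoid (UEA L))"
    proof (rule R.add.subgroupI)
      show "I \<subseteq> carrier (UEA L)"
        by (auto simp: I_def)
      have "uclass L 0 \<in> I"
        by (auto simp: I_iff udualD dest: span_in_udual)
      then show "I \<noteq> {}" by blast
    next
      fix u assume u: "u \<in> I"
      then obtain x where x: "u = uclass L x"
        by (auto simp: I_def UEA_carrier)
      have "\<ominus>\<^bsub>UEA L\<^esub> u = uclass L (0 - x)"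
        by (rule R.minus_equality) (simp_all add: x uclass_add UEA_zero)
      moreover have "g (uclass L (z * (0 - x))) = 0" if "g \<in> fn.span F" for g z
        using u that unfolding x I_iff right_diff_distrib udualD(5)[OF span_in_udual[OF that]]
        by (simp add: udualD(4)[OF span_in_udual[OF that]])
      ultimately show "\<ominus>\<^bsub>UEA L\<^esub> u \<in> I"
        by (simp only: I_iff) blast
    next
      fix u v assume uv: "u \<in> I" "v \<in> I"
      then obtain x y where xy: "u = uclass L x" "v = uclass L y"
        by (auto simp: I_def UEA_carrier)
      show "u \<oplus>\<^bsub>UEA L\<^esub> v \<in> I"
        using uv unfolding xy uclass_add I_iff distrib_left
        by (auto simp only: udualD(1)[OF span_in_udual] add_0)
    qed
  next
    fix u v assume u: "u \<in> I" and v: "v \<in> carrier (UEA L)"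
    then obtain x y where xy: "u = uclass L x" "v = uclass L y"
      by (auto simp: I_def UEA_carrier)
    show "v \<otimes>\<^bsub>UEA L\<^esub> u \<in> I"
      using u unfolding xy uclass_mult I_iff by (auto simp flip: mult.assoc)
    have "g (uclass L (z * (x * y))) = 0" if "g \<in> fn.span F" for g z
      using u translate_in_span[OF that, of y] unfolding xy I_iff by (auto simp flip: mult.assoc)
    then show "u \<otimes>\<^bsub>UEA L\<^esub> v \<in> I"
      unfolding xy uclass_mult I_iff by blast
  qed
  moreover have "I \<subseteq> ukernel L f"
  proof
    fix u assume u: "u \<in> I"
    then obtain x where x: "u = uclass L x"
      by (auto simp: I_def UEA_carrier)
    have "f (uclass L (1 * x)) = 0"
      using u f unfolding x I_iff by blast
    then show "u \<in> ukernel L f"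
      by (simp add: ukernel_def x)
  qed
  moreover have "finite_dim_quotient L (ukernel L f) I"
  proof -
    let ?K = "{x. f (uclass L x) = 0}" and ?\<Phi> = "(\<lambda>(h, g). coefficient L F h g) ` (F \<times> F)"
    have K: "module.subspace tscale ?K"
    proof -
      interpret vector_space tscale by (rule tscale_vector_space)
      show ?thesis by (rule subspaceI) (auto simp: udualD[OF fd])
    qed
    have dual: "?\<Phi> \<subseteq> udual L"
      using coefficient_udual fn.span_base by auto
    obtain B where B: "finite B" "B \<subseteq> ?K"
      and app: "\<And>x. x \<in> ?K \<Longrightarrow> \<exists>b\<in>module.span tscale B. \<forall>\<phi>\<in>?\<Phi>. \<phi> (uclass L x) = \<phi> (uclass L b)"
      using finite_codimension[OF _ dual K] finF by blast
    show ?thesis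
      unfolding finite_dim_quotient_def
    proof (intro exI[of _ "uclass L ` B"] conjI ballI)
      show "finite (uclass L ` B)" "uclass L ` B \<subseteq> ukernel L f"
        using B by (auto simp: ukernel_def)
      fix u assume "u \<in> ukernel L f"
      then obtain x where x: "u = uclass L x" "x \<in> ?K"
        by (auto simp: ukernel_def UEA_carrier)
      obtain b where b: "b \<in> module.span tscale B"
        and eq: "\<And>g h. g \<in> F \<Longrightarrow> h \<in> F \<Longrightarrow> coefficient L F h g (uclass L x) = coefficient L F h g (uclass L b)"
        using app[OF x(2)] by auto
      obtain c where c: "uclass L b = (\<Oplus>\<^bsub>UEA L\<^esub> v\<in>uclass L ` B. uscale L (c v) v)"
        using uclass_span[OF B(1) b, of L] by blast
      have "uclass L (x - b) \<in> I"
        using eq by (auto simp: I_def udualD[OF coefficient_udual[OF fn.span_base]])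
      moreover have "u = (\<Oplus>\<^bsub>UEA L\<^esub> v\<in>uclass L ` B. uscale L (c v) v) \<oplus>\<^bsub>UEA L\<^esub> uclass L (x - b)"
        by (simp add: x(1) uclass_add flip: c)
      ultimately show "\<exists>c. \<exists>i\<in>I. u = (\<Oplus>\<^bsub>UEA L\<^esub> v\<in>uclass L ` B. uscale L (c v) v) \<oplus>\<^bsub>UEA L\<^esub> i"
        by blast
    qed
  qed
  ultimately show ?thesis
    unfolding R_alg_def using fd by blast
qed

lemma R_alg_iff: "f \<in> R_alg L \<longleftrightarrow> representative L f"
  using representative_if_R_alg R_alg_if_representative by blast

lemma R_alg_udual: "f \<in> R_alg L \<Longrightarrow> f \<in> udual L"
  by (simp add: R_alg_def)

lemma R_alg_subspace: "fn.subspace (R_alg L)"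
proof (rule fn.subspaceI)
  show "0 \<in> R_alg L"
    unfolding R_alg_iff representative_def by (intro exI[of _ "{}"]) auto
next
  fix f g assume "f \<in> R_alg L" "g \<in> R_alg L"
  then obtain F G where F: "finite F" "F \<subseteq> udual L" "f \<in> fn.span F"
    "\<forall>g\<in>F. \<forall>X. translate L (\<iota> L X) g \<in> fn.span F"
    and G: "finite G" "G \<subseteq> udual L" "g \<in> fn.span G"
    "\<forall>g\<in>G. \<forall>X. translate L (\<iota> L X) g \<in> fn.span G"
    unfolding R_alg_iff representative_def by blast
  have "fn.span F \<subseteq> fn.span (F \<union> G)" "fn.span G \<subseteq> fn.span (F \<union> G)"
    by (simp_all add: fn.span_mono)
  then show "f + g \<in> R_alg L"
    unfolding R_alg_iff representative_def using F G
    by (intro exI[of _ "F \<union> G"]) (auto intro!: fn.span_add)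
next
  fix c f assume "f \<in> R_alg L"
  then show "fscale c f \<in> R_alg L"
    unfolding R_alg_iff representative_def using fn.span_scale by blast
qed

section \<open>Tensors\<close>

definition bilinear_on :: "(complex \<Rightarrow> 'c \<Rightarrow> 'c::ab_group_add) \<Rightarrow> 'a cvs \<Rightarrow> 'b cvs \<Rightarrow> ('a \<Rightarrow> 'b \<Rightarrow> 'c) \<Rightarrow> bool" where
  "bilinear_on s A B F \<longleftrightarrow> vector_space s \<and>
     (\<forall>a\<in>vcar A. \<forall>a'\<in>vcar A. \<forall>b\<in>vcar B. F (vadd A a a') b = F a b + F a' b) \<and>
     (\<forall>a\<in>vcar A. \<forall>b\<in>vcar B. \<forall>b'\<in>vcar B. F a (vadd B b b') = F a b + F a b') \<and>
     (\<forall>c. \<forall>a\<in>vcar A. \<forall>b\<in>vcar B. F (vscale A c a) b = s c (F a b)) \<and>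
     (\<forall>c. \<forall>a\<in>vcar A. \<forall>b\<in>vcar B. F a (vscale B c b) = s c (F a b))"

abbreviation tensors (infixl "\<boxtimes>" 70) where
  "A \<boxtimes> B \<equiv> vcar (tensor_product A B)"

lemma bilinear_onI:
  assumes "vector_space s"
    "\<And>a a' b. a \<in> vcar A \<Longrightarrow> a' \<in> vcar A \<Longrightarrow> b \<in> vcar B \<Longrightarrow> F (vadd A a a') b = F a b + F a' b"
    "\<And>a b b'. a \<in> vcar A \<Longrightarrow> b \<in> vcar B \<Longrightarrow> b' \<in> vcar B \<Longrightarrow> F a (vadd B b b') = F a b + F a b'"
    "\<And>c a b. a \<in> vcar A \<Longrightarrow> b \<in> vcar B \<Longrightarrow> F (vscale A c a) b = s c (F a b)"
    "\<And>c a b. a \<in> vcar A \<Longrightarrow> b \<in> vcar B \<Longrightarrow> F a (vscale B c b) = s c (F a b)"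
  shows "bilinear_on s A B F"
  using assms unfolding bilinear_on_def by blast

lemma tlift_rep:
  assumes "bilinear_on s A B F" "tensor_rep A B t n a b"
  shows "tlift A B F t = (\<Sum>i<n. F (a i) (b i))"
  by (rule tlift_eq[OF _ _ _ _ _ assms(2)]) (use assms(1) in \<open>auto simp: bilinear_on_def\<close>)

lemma vcar_tensor: "t \<in> A \<boxtimes> B \<longleftrightarrow> (\<exists>n a b. tensor_rep A B t n a b)"
  and vadd_tensor [simp]: "vadd (tensor_product A B) = (+)"
  and vscale_tensor [simp]: "vscale (tensor_product A B) = fscale"
  by (simp_all add: tensor_product_def function_space_def)

lemma tensor_rep_append:
  assumes "tensor_rep A B t n a b" "tensor_rep A B t' m a' b'"
  shows "tensor_rep A B (t + t') (n + m) (\<lambda>i. if i < n then a i else a' (i - n))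
    (\<lambda>i. if i < n then b i else b' (i - n))"
  using assms by (auto simp: tensor_rep_def sum_append Pi_iff)

lemma tensor_0: "0 \<in> A \<boxtimes> B"
  unfolding vcar_tensor tensor_rep_def by (intro exI[of _ "0::nat"]) auto

lemma tensor_add: "t \<in> A \<boxtimes> B \<Longrightarrow> t' \<in> A \<boxtimes> B \<Longrightarrow>
    t + t' \<in> A \<boxtimes> B"
  unfolding vcar_tensor using tensor_rep_append by blast

lemma tensor_rep_tens: "a \<in> vcar A \<Longrightarrow> b \<in> vcar B \<Longrightarrow> tensor_rep A B (tens A B a b) 1 (\<lambda>_. a) (\<lambda>_. b)"
  by (simp add: tensor_rep_def)

lemma tensor_tens: "a \<in> vcar A \<Longrightarrow> b \<in> vcar B \<Longrightarrow> tens A B a b \<in> A \<boxtimes> B"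
  unfolding vcar_tensor by (intro exI) (rule tensor_rep_tens)

lemma tens_apply: "bilinear_form A B \<beta> \<Longrightarrow> tens A B a b \<beta> = \<beta> a b"
  by (simp add: tens_def)

lemma tensor_sum: "(\<And>i. i \<in> I \<Longrightarrow> f i \<in> A \<boxtimes> B) \<Longrightarrow> sum f I \<in> A \<boxtimes> B"
  by (induction I rule: infinite_finite_induct) (simp_all add: tensor_0 tensor_add)

lemma tensor_induct [consumes 1, case_names zero add]:
  assumes t: "t \<in> A \<boxtimes> B"
    and zero: "P 0"
    and add: "\<And>a b t. a \<in> vcar A \<Longrightarrow> b \<in> vcar B \<Longrightarrow> t \<in> A \<boxtimes> B \<Longrightarrow> P t \<Longrightarrow> P (t + tens A B a b)"
  shows "P t"
proof -
  obtain n a b where r: "tensor_rep A B t n a b"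
    using t unfolding vcar_tensor by blast
  have "P (\<Sum>i<k. tens A B (a i) (b i))" if "k \<le> n" for k
    using that
  proof (induction k)
    case (Suc k)
    then show ?case
      using r by (auto simp: tensor_rep_def Pi_iff intro!: add tensor_sum tensor_tens)
  qed (simp add: zero)
  then show ?thesis
    using r by (auto simp: tensor_rep_def)
qed

lemma tlift_0: "bilinear_on s A B F \<Longrightarrow> tlift A B F 0 = 0"
  by (subst tlift_rep[of s A B F 0 0]) (auto simp: tensor_rep_def)

lemma tlift_tens:
  "bilinear_on s A B F \<Longrightarrow> a \<in> vcar A \<Longrightarrow> b \<in> vcar B \<Longrightarrow> tlift A B F (tens A B a b) = F a b"
  using tlift_rep[OF _ tensor_rep_tens] by fastforce

lemma tlift_add:
  assumes F: "bilinear_on s A B F" and t: "t \<in> A \<boxtimes> B" "t' \<in> A \<boxtimes> B"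
  shows "tlift A B F (t + t') = tlift A B F t + tlift A B F t'"
proof -
  obtain n a b m a' b' where r: "tensor_rep A B t n a b" "tensor_rep A B t' m a' b'"
    using t unfolding vcar_tensor by blast
  show ?thesis
    using tlift_rep[OF F tensor_rep_append[OF r]] tlift_rep[OF F r(1)] tlift_rep[OF F r(2)]
    by (simp add: sum_append)
qed

text \<open>Naturality of Sweedler sums: a map that is additive on a set containing all summands can be moved
  inside.\<close>

lemma tlift_comp:
  assumes F: "bilinear_on s A B F" and G: "bilinear_on s' A B G"
    and h: "h 0 = 0" "\<And>x y. x \<in> S \<Longrightarrow> y \<in> S \<Longrightarrow> h (x + y) = h x + h y"
    and S: "0 \<in> S" "\<And>x y. x \<in> S \<Longrightarrow> y \<in> S \<Longrightarrow> x + y \<in> S"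
    and FG: "\<And>a b. a \<in> vcar A \<Longrightarrow> b \<in> vcar B \<Longrightarrow> F a b \<in> S \<and> h (F a b) = G a b"
    and t: "t \<in> A \<boxtimes> B"
  shows "h (tlift A B F t) = tlift A B G t"
proof -
  have "tlift A B F t \<in> S \<and> h (tlift A B F t) = tlift A B G t"
    using t
    by (induction rule: tensor_induct)
      (simp_all add: tlift_0[OF F] tlift_0[OF G] h S tlift_add[OF F] tlift_add[OF G] tensor_tens
        tlift_tens[OF F] tlift_tens[OF G] FG)
  then show ?thesis by blast
qed

lemma tlift_in:
  assumes F: "bilinear_on s A B F" and S: "0 \<in> S" "\<And>x y. x \<in> S \<Longrightarrow> y \<in> S \<Longrightarrow> x + y \<in> S"
    and FS: "\<And>a b. a \<in> vcar A \<Longrightarrow> b \<in> vcar B \<Longrightarrow> F a b \<in> S"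
    and t: "t \<in> A \<boxtimes> B"
  shows "tlift A B F t \<in> S"
  using t
  by (induction rule: tensor_induct)
    (simp_all add: tlift_0[OF F] S tlift_add[OF F] tensor_tens tlift_tens[OF F] FS)

lemma complex_vector_space: "vector_space ((*) :: complex \<Rightarrow> complex \<Rightarrow> complex)"
  by standard (simp_all add: algebra_simps)

lemma tlift_form:
  assumes F: "bilinear_form A B F" and t: "t \<in> A \<boxtimes> B"
  shows "tlift A B F t = t F"
proof -
  have B: "bilinear_on (*) A B F"
    using F complex_vector_space by (auto simp: bilinear_form_def bilinear_on_def)
  show ?thesis
    using t
    by (induction rule: tensor_induct)
      (simp_all add: tlift_0[OF B] tlift_add[OF B] tensor_tens tlift_tens[OF B] fn_apply(1)[of _ _ F]
        fn_apply(2)[of F] tens_apply F)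
qed

definition is_space :: "(complex \<Rightarrow> 'a \<Rightarrow> 'a::ab_group_add) \<Rightarrow> 'a cvs \<Rightarrow> bool" where
  "is_space s A \<longleftrightarrow> vector_space s \<and> module.subspace s (vcar A) \<and> vadd A = (+) \<and> vscale A = s"

lemma is_spaceD:
  assumes "is_space s A"
  shows "vector_space s" "vadd A = (+)" "vscale A = s" "0 \<in> vcar A"
    "a \<in> vcar A \<Longrightarrow> b \<in> vcar A \<Longrightarrow> a + b \<in> vcar A" "a \<in> vcar A \<Longrightarrow> s c a \<in> vcar A"
    "module.subspace s (vcar A)"
proof -
  interpret vector_space s using assms by (simp add: is_space_def)
  show "vector_space s" "vadd A = (+)" "vscale A = s" "module.subspace s (vcar A)"
    using assms by (auto simp: is_space_def intro: vector_space_axioms)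
  then show "0 \<in> vcar A" "a \<in> vcar A \<Longrightarrow> b \<in> vcar A \<Longrightarrow> a + b \<in> vcar A" "a \<in> vcar A \<Longrightarrow> s c a \<in> vcar A"
    by (auto simp: subspace_0 subspace_add subspace_scale)
qed

lemma whole_space_is_space:
  assumes "vector_space s"
  shows "is_space s (whole_space s)"
proof -
  interpret vector_space s by (rule assms)
  show ?thesis
    using assms by (simp add: is_space_def whole_space_def)
qed

lemma function_space_is_space: "fn.subspace F \<Longrightarrow> is_space fscale (function_space F)"
  by (simp add: is_space_def function_space_def fscale_vector_space)

lemma function_space_simps [simp]:
  "vcar (function_space F) = F" "vadd (function_space F) = (+)" "vscale (function_space F) = fscale"
  by (simp_all add: function_space_def)

lemma whole_space_simps [simp]:
  "vcar (whole_space s) = UNIV" "vadd (whole_space s) = (+)" "vscale (whole_space s) = s"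
  by (simp_all add: whole_space_def)

lemma tens_bilinear: "bilinear_on fscale A B (tens A B)"
proof (rule bilinear_onI[OF fscale_vector_space])
qed (auto simp: tens_def bilinear_form_def fn_apply)

lemma tensor_fscale:
  assumes A: "\<And>c a. a \<in> vcar A \<Longrightarrow> vscale A c a \<in> vcar A" and t: "t \<in> A \<boxtimes> B"
  shows "fscale c t \<in> A \<boxtimes> B"
  using t
proof (induction rule: tensor_induct)
  case zero
  show ?case by (simp add: tensor_0)
next
  case (add a b t)
  have "fscale c (tens A B a b) = tens A B (vscale A c a) b"
    using tens_bilinear[of A B] add(1,2) by (simp add: bilinear_on_def)
  then show ?case
    using add A by (simp add: fn.scale_right_distrib tensor_add tensor_tens)
qed

lemma tensor_is_space:
  assumes "is_space s A"
  shows "is_space fscale (tensor_product A B)"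
  unfolding is_space_def using is_spaceD[OF assms]
  by (auto intro!: fn.subspaceI tensor_0 tensor_add tensor_fscale fscale_vector_space)

lemma tlift_fscale:
  assumes F: "bilinear_on s A B F" and A: "\<And>c a. a \<in> vcar A \<Longrightarrow> vscale A c a \<in> vcar A"
    and t: "t \<in> A \<boxtimes> B"
  shows "tlift A B F (fscale c t) = s c (tlift A B F t)"
proof -
  interpret vector_space s using F by (simp add: bilinear_on_def)
  show ?thesis
    using t
  proof (induction rule: tensor_induct)
    case zero
    show ?case by (simp add: tlift_0[OF F])
  next
    case (add a b t)
    have "fscale c (tens A B a b) = tens A B (vscale A c a) b"
      using tens_bilinear[of A B] add(1,2) by (simp add: bilinear_on_def)
    moreover have "F (vscale A c a) b = s c (F a b)"
      using F add(1,2) by (simp add: bilinear_on_def)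
    ultimately show ?case
      using add tlift_add[OF F tensor_fscale[OF A add(3)] tensor_tens[OF A[OF add(1)] add(2)]] A[OF add(1)]
      by (simp add: fn.scale_right_distrib scale_right_distrib tlift_add[OF F] tlift_tens[OF F] tensor_tens)
  qed
qed

definition tensor_eval :: "(complex \<Rightarrow> 'a \<Rightarrow> 'a) \<Rightarrow> 'a::ab_group_add cvs \<Rightarrow> ('x \<Rightarrow> complex) cvs \<Rightarrow> 'x \<Rightarrow>
    ('a, 'x \<Rightarrow> complex) tensor \<Rightarrow> 'a" where
  "tensor_eval s A H u t = tlift A H (\<lambda>a f. s (f u) a) t"

lemma eval_bilinear:
  assumes A: "is_space s A"
  shows "bilinear_on s A (function_space F) (\<lambda>a f. s (f u) a)"
proof -
  interpret vector_space s by (rule is_spaceD(1)[OF A])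
  show ?thesis
    by (rule bilinear_onI[OF is_spaceD(1)[OF A]])
      (simp_all add: is_spaceD(2,3)[OF A] scale_right_distrib scale_left_distrib fn_apply(1)[of _ _ u]
        fn_apply(4)[of _ _ u] scale_left_commute)
qed

lemma eval_simps:
  assumes A: "is_space s A"
  shows "tensor_eval s A (function_space F) u 0 = 0"
    "t \<in> A \<boxtimes> (function_space F) \<Longrightarrow> t' \<in> A \<boxtimes> (function_space F) \<Longrightarrow>
      tensor_eval s A (function_space F) u (t + t') = tensor_eval s A (function_space F) u t + tensor_eval s A (function_space F) u t'"
    "t \<in> A \<boxtimes> (function_space F) \<Longrightarrow>
      tensor_eval s A (function_space F) u (fscale c t) = s c (tensor_eval s A (function_space F) u t)"
    "a \<in> vcar A \<Longrightarrow> f \<in> F \<Longrightarrow> tensor_eval s A (function_space F) u (tens A (function_space F) a f) = s (f u) a"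
    "t \<in> A \<boxtimes> (function_space F) \<Longrightarrow> tensor_eval s A (function_space F) u t \<in> vcar A"
proof -
  note B = eval_bilinear[OF A, of F u]
  have A': "\<And>c a. a \<in> vcar A \<Longrightarrow> vscale A c a \<in> vcar A"
    using is_spaceD(6)[OF A] by (simp add: is_spaceD(3)[OF A])
  show "tensor_eval s A (function_space F) u 0 = 0"
    unfolding tensor_eval_def by (rule tlift_0[OF B])
  show "tensor_eval s A (function_space F) u (t + t') = tensor_eval s A (function_space F) u t + tensor_eval s A (function_space F) u t'"
    if "t \<in> A \<boxtimes> (function_space F)" "t' \<in> A \<boxtimes> (function_space F)"
    unfolding tensor_eval_def by (rule tlift_add[OF B that])
  show "tensor_eval s A (function_space F) u (fscale c t) = s c (tensor_eval s A (function_space F) u t)"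
    if "t \<in> A \<boxtimes> (function_space F)"
    unfolding tensor_eval_def by (rule tlift_fscale[OF B A' that])
  show "tensor_eval s A (function_space F) u (tens A (function_space F) a f) = s (f u) a"
    if "a \<in> vcar A" "f \<in> F"
    unfolding tensor_eval_def by (rule tlift_tens[OF B]) (use that in simp_all)
  show "tensor_eval s A (function_space F) u t \<in> vcar A"
    if "t \<in> A \<boxtimes> (function_space F)"
    unfolding tensor_eval_def
    by (rule tlift_in[OF B _ _ _ that]) (use is_spaceD(4-6)[OF A] in auto)
qed

text \<open>A tensor in \<open>A \<otimes> F\<close> with \<open>F\<close> a space of functions is determined by its values: in
  \<open>\<Sum> a\<^sub>i \<otimes> f\<^sub>i\<close> the \<open>a\<^sub>i\<close> may be expressed in linearly independent elements, and then all
  coefficient functions have to vanish.\<close>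

lemma tensor_eqI:
  assumes A: "is_space s A" and F: "fn.subspace F"
    and outside: "\<And>f u. f \<in> F \<Longrightarrow> u \<notin> C \<Longrightarrow> f u = 0"
    and t: "t \<in> A \<boxtimes> (function_space F)" "t' \<in> A \<boxtimes> (function_space F)"
    and eq: "\<And>u. u \<in> C \<Longrightarrow> tensor_eval s A (function_space F) u t = tensor_eval s A (function_space F) u t'"
  shows "t = t'"
proof -
  let ?H = "function_space F"
  interpret vector_space s by (rule is_spaceD(1)[OF A])
  have subA: "subspace (vcar A)"
    by (rule is_spaceD(7)[OF A])
  define d where "d = t + fscale (-1) t'"
  have t'': "fscale (-1) t' \<in> A \<boxtimes> ?H"
    using is_spaceD[OF A] by (intro tensor_fscale t) auto
  then have "d \<in> A \<boxtimes> ?H"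
    unfolding d_def by (intro tensor_add t)
  then obtain n a f where r: "tensor_rep A ?H d n a f"
    unfolding vcar_tensor by blast
  then have a: "\<And>i. i < n \<Longrightarrow> a i \<in> vcar A" and f: "\<And>i. i < n \<Longrightarrow> f i \<in> F"
    and d: "d = (\<Sum>i<n. tens A ?H (a i) (f i))"
    by (auto simp: tensor_rep_def)
  have zero: "(\<Sum>i<n. s (f i u) (a i)) = 0" if "u \<in> C" for u
  proof -
    have "(\<Sum>i<n. s (f i u) (a i)) = tensor_eval s A ?H u d"
      unfolding tensor_eval_def by (rule tlift_rep[OF eval_bilinear[OF A] r, symmetric])
    also have "\<dots> = 0"
      unfolding d_def eval_simps(2)[OF A t(1) t''] eval_simps(3)[OF A t(2)] by (simp add: eq[OF that])
    finally show ?thesis .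
  qed
  obtain B where B: "B \<subseteq> a ` {..<n}" "independent B" "a ` {..<n} \<subseteq> span B"
    using maximal_independent_subset[of "a ` {..<n}"] by blast
  have finB: "finite B"
    using B(1) by (rule finite_subset) simp
  have BA: "b \<in> vcar A" if "b \<in> B" for b
    using B(1) that a by auto
  have coeff: "(\<Sum>i<n. representation B (a i) b * f i u) = 0" for b u
  proof (cases "u \<in> C")
    case True
    have "(\<Sum>i<n. representation B (a i) b * f i u) = (\<Sum>i<n. representation B (s (f i u) (a i)) b)"
      using B by (intro sum.cong) (auto simp: representation_scale)
    also have "\<dots> = representation B (\<Sum>i<n. s (f i u) (a i)) b"
      using B by (subst representation_sum) (auto intro: span_scale)
    finally show ?thesis
      by (simp add: zero[OF True] representation_zero)
  qed (simp add: outside[OF f])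
  have left: "\<beta> (\<Sum>b\<in>B. s (c b) b) g = (\<Sum>b\<in>B. c b * \<beta> b g)" if \<beta>: "bilinear_form A ?H \<beta>" and g: "g \<in> F" for \<beta> c g
  proof -
    have \<beta>0: "\<beta> 0 g = 0"
    proof -
      have "\<beta> (vscale A 0 0) g = 0 * \<beta> 0 g"
        using \<beta> g is_spaceD(4)[OF A] unfolding bilinear_form_def function_space_simps by blast
      then show ?thesis by (simp add: is_spaceD(3)[OF A])
    qed
    have "(\<Sum>b\<in>B'. s (c b) b) \<in> vcar A \<and> \<beta> (\<Sum>b\<in>B'. s (c b) b) g = (\<Sum>b\<in>B'. c b * \<beta> b g)" if "finite B'" "B' \<subseteq> B" for B'
      using that
    proof (induction B' rule: finite_induct)
      case (insert b B')
      have "\<beta> (s (c b) b + (\<Sum>b\<in>B'. s (c b) b)) g = \<beta> (s (c b) b) g + \<beta> (\<Sum>b\<in>B'. s (c b) b) g"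
        "\<beta> (s (c b) b) g = c b * \<beta> b g" "s (c b) b + (\<Sum>b\<in>B'. s (c b) b) \<in> vcar A"
        using \<beta> g insert BA[of b] is_spaceD[OF A] by (auto simp: bilinear_form_def)
      then show ?case
        using insert by simp
    qed (simp add: \<beta>0 is_spaceD(4)[OF A])
    then show ?thesis
      using finB by blast
  qed
  have expand: "\<beta> (a i) (f i) = (\<Sum>b\<in>B. representation B (a i) b * \<beta> b (f i))"
    if "bilinear_form A ?H \<beta>" "i < n" for \<beta> i
  proof -
    have "(\<Sum>b\<in>B. s (representation B (a i) b) b) = a i"
      using B(3) that(2) by (intro sum_representation_eq[OF B(2) _ finB order.refl]) auto
    then show ?thesis
      using left[OF that(1) f[OF that(2)], of "representation B (a i)"] by simp
  qed
  have right: "(\<Sum>i<n. c i * \<beta> b (f i)) = \<beta> b (\<Sum>i<n. fscale (c i) (f i))" if \<beta>: "bilinear_form A ?H \<beta>" and b: "b \<in> vcar A" for \<beta> b c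
  proof -
    have \<beta>0: "\<beta> b 0 = 0"
    proof -
      have "\<beta> b (vscale ?H 0 0) = 0 * \<beta> b 0"
        using \<beta> b fn.subspace_0[OF F] unfolding bilinear_form_def function_space_simps by blast
      then show ?thesis by simp
    qed
    have "(\<Sum>i<k. fscale (c i) (f i)) \<in> F \<and> (\<Sum>i<k. c i * \<beta> b (f i)) = \<beta> b (\<Sum>i<k. fscale (c i) (f i))" if "k \<le> n" for k
      using that
    proof (induction k)
      case (Suc k)
      have "\<beta> b ((\<Sum>i<k. fscale (c i) (f i)) + fscale (c k) (f k)) = \<beta> b (\<Sum>i<k. fscale (c i) (f i)) + \<beta> b (fscale (c k) (f k))"
        "\<beta> b (fscale (c k) (f k)) = c k * \<beta> b (f k)" "(\<Sum>i<k. fscale (c i) (f i)) + fscale (c k) (f k) \<in> F"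
        using \<beta> b Suc f[of k] F by (auto simp: bilinear_form_def fn.subspace_add fn.subspace_scale)
      then show ?case
        using Suc by simp
    qed (simp add: \<beta>0 fn.subspace_0[OF F])
    then show ?thesis by blast
  qed
  have "d \<beta> = 0" for \<beta>
  proof (cases "bilinear_form A ?H \<beta>")
    case True
    have "d \<beta> = (\<Sum>i<n. \<beta> (a i) (f i))"
      by (simp add: d sum_fun_apply tens_def True)
    also have "\<dots> = (\<Sum>i<n. \<Sum>b\<in>B. representation B (a i) b * \<beta> b (f i))"
      by (intro sum.cong) (auto simp: expand[OF True])
    also have "\<dots> = (\<Sum>b\<in>B. \<Sum>i<n. representation B (a i) b * \<beta> b (f i))"
      by (rule sum.swap)
    also have "\<dots> = (\<Sum>b\<in>B. \<beta> b (\<Sum>i<n. fscale (representation B (a i) b) (f i)))"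
      by (intro sum.cong) (auto simp: right[OF True BA])
    also have "\<dots> = (\<Sum>b\<in>B. \<beta> b 0)"
    proof (intro sum.cong refl)
      fix b
      have "(\<Sum>i<n. fscale (representation B (a i) b) (f i)) = 0"
        using coeff[of b] by (intro ext) (simp add: sum_fun_apply fscale_def zero_fun_def)
      then show "\<beta> b (\<Sum>i<n. fscale (representation B (a i) b) (f i)) = \<beta> b 0"
        by simp
    qed
    also have "\<dots> = 0"
      using right[OF True BA, where c = "\<lambda>_. 0"] by (intro sum.neutral) auto
    finally show ?thesis .
  qed (simp add: d sum_fun_apply tens_def)
  then have "d = 0"
    by (auto simp: fun_eq_iff fn_apply)
  then have "t - t' = 0"
    by (simp add: d_def fn.scale_minus_left)
  then show ?thesis by simp
qed

section \<open>Product and coproduct of representative functions\<close>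

definition split_sum :: "('a list \<Rightarrow> 'a list \<Rightarrow> 'c::comm_monoid_add) \<Rightarrow> 'a list \<Rightarrow> 'c" where
  "split_sum g w = (\<Sum>(a, b)\<leftarrow>splittings w. g a b)"

lemma split_sum_Nil [simp]: "split_sum g [] = g [] []"
  by (simp add: split_sum_def)

lemma split_sum_Cons: "split_sum g (x # w) = split_sum (\<lambda>a b. g (x # a) b) w + split_sum (\<lambda>a b. g a (x # b)) w"
proof -
  have "(\<Sum>(a, b)\<leftarrow>concat (map (\<lambda>(a, b). [(x # a, b), (a, x # b)]) ps). g a b)
      = (\<Sum>(a, b)\<leftarrow>ps. g (x # a) b) + (\<Sum>(a, b)\<leftarrow>ps. g a (x # b))" for ps
    by (induction ps) (auto simp: algebra_simps)
  then show ?thesis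
    by (simp add: split_sum_def)
qed

lemma split_sum_snoc:
  "split_sum g (w @ [x]) = split_sum (\<lambda>a b. g (a @ [x]) b) w + split_sum (\<lambda>a b. g a (b @ [x])) w"
  by (induction w arbitrary: g) (simp_all add: split_sum_Cons algebra_simps)

lemma split_sum_add: "split_sum (\<lambda>a b. f a b + g a b) w = split_sum f w + split_sum g w"
  by (induction w arbitrary: f g) (simp_all add: split_sum_Cons algebra_simps)

lemma split_sum_hom:
  assumes "\<And>x y. h (x + y) = h x + h y"
  shows "h (split_sum g w) = split_sum (\<lambda>a b. h (g a b)) w"
  by (induction w arbitrary: g) (simp_all add: split_sum_Cons assms)

lemma split_sum_cmult: "split_sum (\<lambda>a b. c * f a b) w = c * (split_sum f w :: complex)"
  by (induction w arbitrary: f) (simp_all add: split_sum_Cons algebra_simps)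

text \<open>The value of a bilinear form at the coproduct of \<open>x\<close>.\<close>

definition cop_form :: "('a free_alg \<Rightarrow> 'a free_alg \<Rightarrow> complex) \<Rightarrow> 'a free_alg \<Rightarrow> complex" where
  "cop_form \<gamma> = lin_ext (*) (split_sum (\<lambda>a b. \<gamma> (word a) (word b)))"

lemma cop_form_simps [simp]:
  "cop_form \<gamma> (word w) = split_sum (\<lambda>a b. \<gamma> (word a) (word b)) w"
  "cop_form \<gamma> (x + y) = cop_form \<gamma> x + cop_form \<gamma> y"
  "cop_form \<gamma> (x - y) = cop_form \<gamma> x - cop_form \<gamma> y"
  "cop_form \<gamma> (tscale c x) = c * cop_form \<gamma> x"
  by (simp_all add: cop_form_def complex_vector_space lin_ext_add lin_ext_diff lin_ext_tscale)

lemma cop_form_plus: "cop_form (\<lambda>p q. \<gamma> p q + \<delta> p q) x = cop_form \<gamma> x + cop_form \<delta> x"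
  by (induction x rule: free_alg_induct) (simp_all add: split_sum_add algebra_simps)

lemma cop_form_cmult: "cop_form (\<lambda>p q. c * \<gamma> p q) x = c * cop_form \<gamma> x"
  by (induction x rule: free_alg_induct) (simp_all add: split_sum_cmult algebra_simps)

lemma cop_form_gen:
  "cop_form \<gamma> (gen X * x) = cop_form (\<lambda>p q. \<gamma> (gen X * p) q) x + cop_form (\<lambda>p q. \<gamma> p (gen X * q)) x"
proof (induction x rule: free_alg_induct)
  case (word w)
  show ?case by (simp add: word_mult split_sum_Cons)
next
  case (scale c x)
  then show ?case by (simp add: mult_tscale[of "gen X"] algebra_simps)
qed (simp add: algebra_simps)

lemma cop_form_mult_gen:
  "cop_form \<gamma> (x * gen X) = cop_form (\<lambda>p q. \<gamma> (p * gen X) q) x + cop_form (\<lambda>p q. \<gamma> p (q * gen X)) x"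
proof (induction x rule: free_alg_induct)
  case (word w)
  show ?case by (simp add: word_mult split_sum_snoc)
qed (simp_all add: algebra_simps)

lemma bilinear_form_uea_iff:
  "bilinear_form (uea_space L) (uea_space L) \<beta> \<longleftrightarrow>
    (\<forall>x y z. \<beta> (uclass L (x + y)) (uclass L z) = \<beta> (uclass L x) (uclass L z) + \<beta> (uclass L y) (uclass L z)) \<and>
    (\<forall>x y z. \<beta> (uclass L x) (uclass L (y + z)) = \<beta> (uclass L x) (uclass L y) + \<beta> (uclass L x) (uclass L z)) \<and>
    (\<forall>c x y. \<beta> (uclass L (tscale c x)) (uclass L y) = c * \<beta> (uclass L x) (uclass L y)) \<and>
    (\<forall>c x y. \<beta> (uclass L x) (uclass L (tscale c y)) = c * \<beta> (uclass L x) (uclass L y))"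
  unfolding bilinear_form_def uea_space_def
  by (auto simp: UEA_carrier uclass_add uscale_uclass)

text \<open>The coproduct respects the defining relations because Lie algebra elements are primitive.\<close>

lemma cop_form_uea_ideal:
  assumes "z \<in> uea_ideal L"
    and "\<And>p p' q. \<gamma> (p + p') q = \<gamma> p q + \<gamma> p' q" "\<And>p q q'. \<gamma> p (q + q') = \<gamma> p q + \<gamma> p q'"
    and "\<And>c p q. \<gamma> (tscale c p) q = c * \<gamma> p q" "\<And>c p q. \<gamma> p (tscale c q) = c * \<gamma> p q"
    and "\<And>p q. p \<in> uea_ideal L \<Longrightarrow> \<gamma> p q = 0" "\<And>p q. q \<in> uea_ideal L \<Longrightarrow> \<gamma> p q = 0"
  shows "cop_form \<gamma> z = 0"
  using assms
proof (induction z arbitrary: \<gamma> rule: uea_ideal_induct)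
  case (gen X x)
  have "cop_form (\<lambda>p q. \<gamma> (gen X * p) q) x = 0" "cop_form (\<lambda>p q. \<gamma> p (gen X * q)) x = 0"
    by (rule gen.IH; simp add: gen.prems distrib_left mult_tscale[of "gen X"] uea_ideal_mult_left)+
  then show ?case
    by (simp add: cop_form_gen)
next
  case (rel_add X Y b)
  have 1: "\<gamma> (gen (X + Y) * p) q = \<gamma> (gen X * p) q + \<gamma> (gen Y * p) q" for p q
  proof -
    have "\<gamma> (gen (X + Y) * p) q = \<gamma> ((gen (X + Y) - gen X - gen Y) * p + (gen X * p + gen Y * p)) q"
      by (simp add: algebra_simps)
    then show ?thesis
      unfolding rel_add(1) rel_add(5)[OF uea_ideal_mult_right[OF uea_rel_add]] by simp
  qed
  have 2: "\<gamma> p (gen (X + Y) * q) = \<gamma> p (gen X * q) + \<gamma> p (gen Y * q)" for p q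
  proof -
    have "\<gamma> p (gen (X + Y) * q) = \<gamma> p ((gen (X + Y) - gen X - gen Y) * q + (gen X * q + gen Y * q))"
      by (simp add: algebra_simps)
    then show ?thesis
      unfolding rel_add(2) rel_add(6)[OF uea_ideal_mult_right[OF uea_rel_add]] by simp
  qed
  show ?case
    by (simp add: left_diff_distrib cop_form_gen 1 2 cop_form_plus)
next
  case (rel_scale c X b)
  have 1: "\<gamma> (gen (lscale L c X) * p) q = c * \<gamma> (gen X * p) q" for p q
  proof -
    have "\<gamma> (gen (lscale L c X) * p) q = \<gamma> ((gen (lscale L c X) - tscale c (gen X)) * p + tscale c (gen X * p)) q"
      by (simp add: algebra_simps)
    then show ?thesis
      unfolding rel_scale(1) rel_scale(3) rel_scale(5)[OF uea_ideal_mult_right[OF uea_rel_scale]] by simp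
  qed
  have 2: "\<gamma> p (gen (lscale L c X) * q) = c * \<gamma> p (gen X * q)" for p q
  proof -
    have "\<gamma> p (gen (lscale L c X) * q) = \<gamma> p ((gen (lscale L c X) - tscale c (gen X)) * q + tscale c (gen X * q))"
      by (simp add: algebra_simps)
    then show ?thesis
      unfolding rel_scale(2) rel_scale(4) rel_scale(6)[OF uea_ideal_mult_right[OF uea_rel_scale]] by simp
  qed
  show ?case
    by (simp add: left_diff_distrib mult.assoc cop_form_gen 1 2 cop_form_cmult algebra_simps)
next
  case (rel_bracket X Y b)
  have 1: "\<gamma> (gen X * (gen Y * p)) q = \<gamma> (gen Y * (gen X * p)) q + \<gamma> (gen (lbracket L X Y) * p) q" for p q
  proof -
    have "\<gamma> (gen X * (gen Y * p)) q = \<gamma> ((gen X * gen Y - gen Y * gen X - gen (lbracket L X Y)) * p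
        + (gen Y * (gen X * p) + gen (lbracket L X Y) * p)) q"
      by (simp add: algebra_simps)
    then show ?thesis
      unfolding rel_bracket(1) rel_bracket(5)[OF uea_ideal_mult_right[OF uea_rel_bracket]] by simp
  qed
  have 2: "\<gamma> p (gen X * (gen Y * q)) = \<gamma> p (gen Y * (gen X * q)) + \<gamma> p (gen (lbracket L X Y) * q)" for p q
  proof -
    have "\<gamma> p (gen X * (gen Y * q)) = \<gamma> p ((gen X * gen Y - gen Y * gen X - gen (lbracket L X Y)) * q
        + (gen Y * (gen X * q) + gen (lbracket L X Y) * q))"
      by (simp add: algebra_simps)
    then show ?thesis
      unfolding rel_bracket(2) rel_bracket(6)[OF uea_ideal_mult_right[OF uea_rel_bracket]] by simp
  qed
  show ?case
    by (simp add: left_diff_distrib mult.assoc cop_form_gen 1 2 cop_form_plus)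
qed simp_all

abbreviation uclass_form :: "'a::ab_group_add lie \<Rightarrow> ('a ue \<Rightarrow> 'a ue \<Rightarrow> complex) \<Rightarrow> 'a free_alg \<Rightarrow> 'a free_alg \<Rightarrow> complex" where
  "uclass_form L \<beta> \<equiv> \<lambda>p q. \<beta> (uclass L p) (uclass L q)"

lemma ucomult_uclass:
  assumes \<beta>: "bilinear_form (uea_space L) (uea_space L) \<beta>"
  shows "ucomult L (uclass L x) \<beta> = cop_form (uclass_form L \<beta>) x"
    and "ucomult L (uclass L x) \<in> (uea_space L) \<boxtimes> (uea_space L)"
proof -
  let ?U = "uea_space L"
  define G where "G = (\<lambda>w. \<Sum>(a, b)\<leftarrow>splittings w. tens ?U ?U (uclass L (word a)) (uclass L (word b)))"
  have G: "G w = split_sum (\<lambda>a b. tens ?U ?U (uclass L (word a)) (uclass L (word b))) w" for w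
    by (simp add: G_def split_sum_def)
  have val: "lin_ext fscale G x \<beta> = cop_form (uclass_form L \<beta>) x" if "bilinear_form ?U ?U \<beta>" for \<beta> x
  proof -
    have "lin_ext fscale G x \<beta> = lin_ext (*) (\<lambda>w. G w \<beta>) x"
      by (simp add: lin_ext_def sum_fun_apply fscale_def)
    also have "(\<lambda>w. G w \<beta>) = split_sum (\<lambda>a b. \<beta> (uclass L (word a)) (uclass L (word b)))"
      unfolding G by (subst split_sum_hom[where h = "\<lambda>t. t \<beta>"]) (auto simp: fn_apply(1)[of _ _ \<beta>] tens_apply[OF that])
    finally show ?thesis by (simp add: cop_form_def)
  qed
  have "lin_ext fscale G (x + h) = lin_ext fscale G x" if h: "h \<in> uea_ideal L" for h
  proof
    fix \<beta>
    show "lin_ext fscale G (x + h) \<beta> = lin_ext fscale G x \<beta>"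
    proof (cases "bilinear_form ?U ?U \<beta>")
      case True
      note b = True[unfolded bilinear_form_uea_iff]
      have "\<beta> (uclass L p) (uclass L q) = 0 \<and> \<beta> (uclass L q) (uclass L p) = 0" if "p \<in> uea_ideal L" for p q
      proof -
        have "\<beta> (uclass L (p + p)) (uclass L q) = \<beta> (uclass L p) (uclass L q) + \<beta> (uclass L p) (uclass L q)"
          "\<beta> (uclass L q) (uclass L (p + p)) = \<beta> (uclass L q) (uclass L p) + \<beta> (uclass L q) (uclass L p)"
          using b by blast+
        moreover have "uclass L (p + p) = uclass L p"
          using that by (simp add: uclass_eq_iff)
        ultimately show ?thesis
          by simp
      qed
      then have "cop_form (uclass_form L \<beta>) h = 0"
        using b by (intro cop_form_uea_ideal[OF h]) simp_all
      then show ?thesis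
        by (simp add: val[OF True])
    next
      case False
      have "lin_ext fscale G y \<beta> = 0" for y
        unfolding lin_ext_def sum_fun_apply fscale_def
      proof (rule sum.neutral, rule ballI)
        fix w
        have "G w \<beta> = split_sum (\<lambda>a b. 0) w"
          unfolding G by (subst split_sum_hom[where h = "\<lambda>t. t \<beta>"]) (auto simp: fn_apply(1)[of _ _ \<beta>] tens_def False)
        also have "\<dots> = 0"
          by (induction w) (simp_all add: split_sum_Cons)
        finally show "Poly_Mapping.lookup y w * G w \<beta> = 0" by simp
      qed
      then show ?thesis by simp
    qed
  qed
  then have u: "ucomult L (uclass L x) = lin_ext fscale G x"
    unfolding ucomult_def G_def[symmetric] by (rule the_elem_uclass)
  show "ucomult L (uclass L x) \<beta> = cop_form (uclass_form L \<beta>) x"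
    unfolding u by (rule val[OF \<beta>])
  have "G w \<in> ?U \<boxtimes> ?U" for w
  proof -
    have "sum_list (map (\<lambda>(a, b). tens ?U ?U (uclass L (word a)) (uclass L (word b))) ps) \<in> ?U \<boxtimes> ?U" for ps
      by (induction ps) (auto simp: tensor_0 uea_space_def intro!: tensor_add tensor_tens)
    then show ?thesis by (simp add: G_def)
  qed
  then show "ucomult L (uclass L x) \<in> ?U \<boxtimes> ?U"
    unfolding u lin_ext_def
    by (intro tensor_sum tensor_fscale) (auto simp: uea_space_def UEA_carrier uscale_uclass)
qed

lemma R_mult_uclass:
  assumes f: "f \<in> udual L" and g: "g \<in> udual L"
  shows "R_mult L f g (uclass L x) = cop_form (\<lambda>p q. f (uclass L p) * g (uclass L q)) x"
proof -
  have "bilinear_form (uea_space L) (uea_space L) (\<lambda>u v. f u * g v)"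
    by (simp add: bilinear_form_uea_iff udualD[OF f] udualD[OF g] algebra_simps)
  then show ?thesis
    by (simp add: R_mult_def tlift_form ucomult_uclass)
qed

lemma R_mult_word:
  assumes "f \<in> udual L" "g \<in> udual L"
  shows "R_mult L f g (uclass L (word w)) = split_sum (\<lambda>a b. f (uclass L (word a)) * g (uclass L (word b))) w"
  by (simp add: R_mult_uclass[OF assms])

lemma R_mult_udual: "f \<in> udual L \<Longrightarrow> g \<in> udual L \<Longrightarrow> R_mult L f g \<in> udual L"
  by (auto simp: udual_iff[of "R_mult L f g"] R_mult_uclass) (simp add: R_mult_def)

lemma R_mult_add:
  assumes "f \<in> udual L" "g \<in> udual L" "h \<in> udual L"
  shows "R_mult L (f + g) h = R_mult L f h + R_mult L g h"
    and "R_mult L h (f + g) = R_mult L h f + R_mult L h g"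
proof -
  note sub = fn.subspace_add[OF udual_subspace]
  show "R_mult L (f + g) h = R_mult L f h + R_mult L g h"
    by (intro udual_eqI[of _ L] sub R_mult_udual assms)
      (simp add: R_mult_uclass sub assms cop_form_plus distrib_right)
  show "R_mult L h (f + g) = R_mult L h f + R_mult L h g"
    by (intro udual_eqI[of _ L] sub R_mult_udual assms)
      (simp add: R_mult_uclass sub assms cop_form_plus distrib_left)
qed

lemma R_mult_scale:
  assumes "f \<in> udual L" "h \<in> udual L"
  shows "R_mult L (fscale c f) h = fscale c (R_mult L f h)"
    and "R_mult L h (fscale c f) = fscale c (R_mult L h f)"
proof -
  note sub = fn.subspace_scale[OF udual_subspace]
  show "R_mult L (fscale c f) h = fscale c (R_mult L f h)"
    by (intro udual_eqI[of _ L] sub R_mult_udual assms)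
      (simp add: R_mult_uclass sub assms mult.assoc cop_form_cmult)
  show "R_mult L h (fscale c f) = fscale c (R_mult L h f)"
    by (intro udual_eqI[of _ L] sub R_mult_udual assms)
      (simp add: R_mult_uclass sub assms mult.left_commute cop_form_cmult)
qed

lemmas R_mult_bilinear = R_mult_add R_mult_scale

text \<open>Translation by a primitive element is a derivation.\<close>

lemma R_mult_translate:
  assumes "f \<in> udual L" "g \<in> udual L"
  shows "translate L (\<iota> L X) (R_mult L f g) = R_mult L (translate L (\<iota> L X) f) g + R_mult L f (translate L (\<iota> L X) g)"
  by (intro udual_eqI[of _ L] fn.subspace_add[OF udual_subspace] R_mult_udual translate_gen_udual assms)
    (simp add: R_mult_uclass translate_gen_udual assms cop_form_mult_gen)

lemma R_mult_span:
  assumes F: "F \<subseteq> udual L" and G: "G \<subseteq> udual L" and f: "f \<in> fn.span F" and g: "g \<in> fn.span G"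
  shows "R_mult L f g \<in> fn.span ((\<lambda>(f, g). R_mult L f g) ` (F \<times> G))" (is "_ \<in> fn.span ?P")
proof -
  have 0: "R_mult L 0 h = 0" "R_mult L h 0 = 0" if "h \<in> udual L" for h
    using R_mult_scale[OF that that, of 0] by simp_all
  have sF: "x \<in> udual L" if "x \<in> fn.span F" for x
    using that span_udual[OF F] by blast
  have sG: "x \<in> udual L" if "x \<in> fn.span G" for x
    using that span_udual[OF G] by blast
  have right: "R_mult L x g \<in> fn.span ?P" if "x \<in> F" for x
  proof -
    have x: "x \<in> udual L" using that F by blast
    have "g \<in> fn.span G \<and> R_mult L x g \<in> fn.span ?P"
      using g
    proof (induction rule: fn.span_induct_alt)
      case base
      show ?case by (simp add: 0 x fn.span_zero)
    next
      case (step c y z)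
      have y: "y \<in> udual L" and z: "z \<in> udual L"
        using step G sG by auto
      have "R_mult L x y \<in> fn.span ?P"
        using step(1) that by (auto intro!: fn.span_base)
      then show ?case
        using step x y z by (simp add: R_mult_bilinear fn.subspace_scale[OF udual_subspace]
            fn.span_add fn.span_scale fn.span_base)
    qed
    then show ?thesis by blast
  qed
  have "f \<in> fn.span F \<and> R_mult L f g \<in> fn.span ?P"
    using f
  proof (induction rule: fn.span_induct_alt)
    case base
    show ?case by (simp add: 0 sG[OF g] fn.span_zero)
  next
    case (step c y z)
    have y: "y \<in> udual L" and z: "z \<in> udual L"
      using step F sF by auto
    then show ?case
      using step sG[OF g] right[OF step(1)] by (simp add: R_mult_bilinear fn.subspace_scale[OF udual_subspace]
          fn.span_add fn.span_scale fn.span_base)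
  qed
  then show ?thesis by blast
qed

lemma R_mult_R_alg:
  assumes "f \<in> R_alg L" "g \<in> R_alg L"
  shows "R_mult L f g \<in> R_alg L"
proof -
  obtain F G where F: "finite F" "F \<subseteq> udual L" "f \<in> fn.span F"
    "\<forall>g\<in>F. \<forall>X. translate L (\<iota> L X) g \<in> fn.span F"
    and G: "finite G" "G \<subseteq> udual L" "g \<in> fn.span G"
    "\<forall>g\<in>G. \<forall>X. translate L (\<iota> L X) g \<in> fn.span G"
    using assms unfolding R_alg_iff representative_def by blast
  let ?P = "(\<lambda>(f, g). R_mult L f g) ` (F \<times> G)"
  have "translate L (\<iota> L X) (R_mult L x y) \<in> fn.span ?P" if "x \<in> F" "y \<in> G" for x y X
  proof -
    have "x \<in> udual L" "y \<in> udual L"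
      using that F G by auto
    then show ?thesis
      using that F G by (simp add: R_mult_translate fn.span_add R_mult_span fn.span_base)
  qed
  moreover have "?P \<subseteq> udual L"
    using F(2) G(2) by (auto intro!: R_mult_udual)
  ultimately show ?thesis
    unfolding R_alg_iff representative_def
    using F G R_mult_span[OF F(2) G(2) F(3) G(3)] by (intro exI[of _ ?P]) auto
qed

lemma R_alg_outside: "f \<in> R_alg L \<Longrightarrow> u \<notin> carrier (UEA L) \<Longrightarrow> f u = 0"
  using udualD(3)[OF R_alg_udual] .

lemma R_space_is_space: "is_space fscale (R_space L)"
  by (rule function_space_is_space[OF R_alg_subspace])

lemma pair_eval_bilinear: "bilinear_on (*) (R_space L) (R_space L) (\<lambda>f1 f2. f1 u * f2 v)"
  by (rule bilinear_onI[OF complex_vector_space]) (simp_all add: fn_apply(1)[of _ _ u] fn_apply(1)[of _ _ v]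
    fn_apply(4)[of _ _ u] fn_apply(4)[of _ _ v] algebra_simps)

lemma pair_eval:
  assumes "t \<in> (R_space L) \<boxtimes> (R_space L)"
  shows "tensor_eval fscale (R_space L) (R_space L) v t u = tlift (R_space L) (R_space L) (\<lambda>f1 f2. f1 u * f2 v) t"
  unfolding tensor_eval_def
  by (rule tlift_comp[OF eval_bilinear[OF R_space_is_space] pair_eval_bilinear _ _ _ _ _ assms, where S = UNIV])
    (simp_all add: fn_apply(1)[of _ _ u] fn_apply(2)[of u] fn_apply(4)[of _ _ u])

lemma R_comult_unique:
  assumes "t \<in> (R_space L) \<boxtimes> (R_space L)" "t' \<in> (R_space L) \<boxtimes> (R_space L)"
    and eq: "\<And>x y. tlift (R_space L) (R_space L) (\<lambda>f1 f2. f1 (uclass L x) * f2 (uclass L y)) t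
      = tlift (R_space L) (R_space L) (\<lambda>f1 f2. f1 (uclass L x) * f2 (uclass L y)) t'"
  shows "t = t'"
proof (rule tensor_eqI[where C = "carrier (UEA L)", OF R_space_is_space[of L] R_alg_subspace _ assms(1,2)])
  show "f u = 0" if "f \<in> R_alg L" "u \<notin> carrier (UEA L)" for f u
    using that by (rule R_alg_outside)
next
  fix v assume "v \<in> carrier (UEA L)"
  then obtain y where y: "v = uclass L y"
    by (rule carrier_cases)
  have "tensor_eval fscale (R_space L) (R_space L) v t'' \<in> udual L"
    if "t'' \<in> (R_space L) \<boxtimes> (R_space L)" for t''
    using eval_simps(5)[OF R_space_is_space that] by (auto dest: R_alg_udual)
  then show "tensor_eval fscale (R_space L) (R_space L) v t = tensor_eval fscale (R_space L) (R_space L) v t'"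
    using assms by (intro udual_eqI[of _ L]) (auto simp: pair_eval y)
qed

text \<open>The matrix coefficients provide the coproduct: \<open>f(u v) = \<Sum> h(u) c\<^sub>h(v)\<close>, where \<open>h\<close> runs through a
  basis of a stable space and \<open>c\<^sub>h(v)\<close> are the coordinates of the translate of \<open>f\<close> by \<open>v\<close>.\<close>

lemma R_comult:
  assumes "f \<in> R_alg L"
  shows R_comult_in: "R_comult L f \<in> (R_space L) \<boxtimes> (R_space L)"
    and R_comult_eval: "tlift (R_space L) (R_space L) (\<lambda>f1 f2. f1 (uclass L x) * f2 (uclass L y)) (R_comult L f)
      = f (uclass L (x * y))"
proof -
  let ?H = "R_space L"
  let ?P = "\<lambda>t. t \<in> ?H \<boxtimes> ?H \<and>
     (\<forall>u\<in>carrier (UEA L). \<forall>v\<in>carrier (UEA L). tlift ?H ?H (\<lambda>f1 f2. f1 u * f2 v) t = f (u \<otimes>\<^bsub>UEA L\<^esub> v))"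
  have P_iff: "?P t \<longleftrightarrow> t \<in> ?H \<boxtimes> ?H \<and>
     (\<forall>x y. tlift ?H ?H (\<lambda>f1 f2. f1 (uclass L x) * f2 (uclass L y)) t = f (uclass L (x * y)))" for t
    by (auto simp: UEA_carrier uclass_mult)
  obtain F where "stable_basis L F" and f: "f \<in> fn.span F"
    using representative_basis assms unfolding R_alg_iff by blast
  interpret stable_basis L F by fact
  let ?t = "\<Sum>h\<in>F. tens ?H ?H h (coefficient L F h f)"
  have FR: "h \<in> R_alg L" if "h \<in> F" for h
    using that by (simp add: R_alg_iff representative_span fn.span_base)
  have CR: "coefficient L F h f \<in> R_alg L" for h
    using f by (simp add: R_alg_iff representative_coefficient)
  have "tlift ?H ?H (\<lambda>f1 f2. f1 u * f2 v) (\<Sum>h\<in>F'. tens ?H ?H h (coefficient L F h f))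
      = (\<Sum>h\<in>F'. h u * coefficient L F h f v)" if "finite F'" "F' \<subseteq> F" for u v F'
    using that
  proof (induction F' rule: finite_induct)
    case empty
    show ?case using tlift_0[OF pair_eval_bilinear] by simp
  next
    case (insert h F')
    have 1: "tens ?H ?H h (coefficient L F h f) \<in> ?H \<boxtimes> ?H"
      using insert FR CR by (intro tensor_tens) auto
    have 2: "(\<Sum>h\<in>F'. tens ?H ?H h (coefficient L F h f)) \<in> ?H \<boxtimes> ?H"
      using insert FR CR by (intro tensor_sum tensor_tens) auto
    show ?case
      using insert FR CR by (simp add: tlift_add[OF pair_eval_bilinear 1 2] tlift_tens[OF pair_eval_bilinear])
  qed
  then have t: "?t \<in> ?H \<boxtimes> ?H \<and>
     (\<forall>x y. tlift ?H ?H (\<lambda>f1 f2. f1 (uclass L x) * f2 (uclass L y)) ?t = f (uclass L (x * y)))"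
    using finF FR CR coefficient_expansion[OF f]
    by (auto simp: mult.commute intro!: tensor_sum tensor_tens)
  have "\<exists>!t. ?P t"
    unfolding P_iff
  proof (rule ex1I[of _ ?t])
    show "?t \<in> ?H \<boxtimes> ?H \<and>
      (\<forall>x y. tlift ?H ?H (\<lambda>f1 f2. f1 (uclass L x) * f2 (uclass L y)) ?t = f (uclass L (x * y)))"
      by (rule t)
    show "t = ?t" if "t \<in> ?H \<boxtimes> ?H \<and>
      (\<forall>x y. tlift ?H ?H (\<lambda>f1 f2. f1 (uclass L x) * f2 (uclass L y)) t = f (uclass L (x * y)))" for t
      by (rule R_comult_unique[of _ L]) (use that t in simp_all)
  qed
  then have "?P (R_comult L f)"
    unfolding R_comult_def by (rule theI')
  then show "R_comult L f \<in> ?H \<boxtimes> ?H"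
    "tlift ?H ?H (\<lambda>f1 f2. f1 (uclass L x) * f2 (uclass L y)) (R_comult L f) = f (uclass L (x * y))"
    unfolding P_iff by blast+
qed

section \<open>Locally finite modules and comodules\<close>

lemma bilinear_mapI:
  assumes "vector_space sa" "vector_space sb" "vector_space sc"
    "\<And>x y z. f (x + y) z = f x z + f y z" "\<And>x y z. f x (y + z) = f x y + f x z"
    "\<And>c x z. f (sa c x) z = sc c (f x z)" "\<And>c x z. f x (sb c z) = sc c (f x z)"
  shows "bilinear_map sa sb sc f"
  unfolding bilinear_map_def Vector_Spaces.linear_iff using assms by blast

lemma eval_sum:
  assumes A: "is_space s A"
    and "\<And>i. i \<in> I \<Longrightarrow> t i \<in> A \<boxtimes> (function_space F)"
  shows "tensor_eval s A (function_space F) u (\<Sum>i\<in>I. t i) = (\<Sum>i\<in>I. tensor_eval s A (function_space F) u (t i))"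
  using assms(2) by (induction I rule: infinite_finite_induct)
    (simp_all add: eval_simps(1,2)[OF A] tensor_sum)

lemma eval_rep:
  assumes "is_space s A" "tensor_rep A (function_space F) t n a f"
  shows "tensor_eval s A (function_space F) u t = (\<Sum>i<n. s (f i u) (a i))"
  unfolding tensor_eval_def by (rule tlift_rep[OF eval_bilinear[OF assms(1)] assms(2)])

lemma eval_linear:
  assumes A: "is_space s A" and t: "t \<in> A \<boxtimes> (R_space L)"
  shows "tensor_eval s A (R_space L) (uclass L (x + y)) t
      = tensor_eval s A (R_space L) (uclass L x) t + tensor_eval s A (R_space L) (uclass L y) t"
    and "tensor_eval s A (R_space L) (uclass L (tscale c x)) t = s c (tensor_eval s A (R_space L) (uclass L x) t)"
proof -
  interpret vector_space s by (rule is_spaceD(1)[OF A])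
  obtain n a f where r: "tensor_rep A (R_space L) t n a f"
    using t unfolding vcar_tensor by blast
  then have f: "f i \<in> udual L" if "i < n" for i
    using that by (auto simp: tensor_rep_def Pi_iff intro: R_alg_udual)
  show "tensor_eval s A (R_space L) (uclass L (x + y)) t
      = tensor_eval s A (R_space L) (uclass L x) t + tensor_eval s A (R_space L) (uclass L y) t"
    unfolding eval_rep[OF A r] sum.distrib[symmetric]
    by (intro sum.cong) (auto simp: udualD[OF f] scale_left_distrib)
  show "tensor_eval s A (R_space L) (uclass L (tscale c x)) t = s c (tensor_eval s A (R_space L) (uclass L x) t)"
    unfolding eval_rep[OF A r] scale_sum_right
    by (intro sum.cong) (auto simp: udualD[OF f])
qed

lemma tensor_eqI_R:
  assumes A: "is_space s A"
    and t: "t \<in> A \<boxtimes> (R_space L)" "t' \<in> A \<boxtimes> (R_space L)"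
    and eq: "\<And>x. tensor_eval s A (R_space L) (uclass L x) t = tensor_eval s A (R_space L) (uclass L x) t'"
  shows "t = t'"
proof (rule tensor_eqI[where C = "carrier (UEA L)", OF A R_alg_subspace _ t])
  show "f u = 0" if "f \<in> R_alg L" "u \<notin> carrier (UEA L)" for f u
    using that by (rule R_alg_outside)
  show "tensor_eval s A (R_space L) u t = tensor_eval s A (R_space L) u t'" if "u \<in> carrier (UEA L)" for u
    using that eq by (auto simp: UEA_carrier)
qed

lemma tensor_eqI_words:
  assumes A: "is_space s A"
    and t: "t \<in> A \<boxtimes> (R_space L)" "t' \<in> A \<boxtimes> (R_space L)"
    and eq: "\<And>w. tensor_eval s A (R_space L) (uclass L (word w)) t = tensor_eval s A (R_space L) (uclass L (word w)) t'"
  shows "t = t'"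
proof (rule tensor_eqI_R[OF A t])
  show "tensor_eval s A (R_space L) (uclass L x) t = tensor_eval s A (R_space L) (uclass L x) t'" for x
    by (induction x rule: free_alg_induct) (simp_all add: eq eval_linear[OF A] t)
qed

lemma lie_module_word_ext_ideal:
  assumes "lie_module L s act" "z \<in> uea_ideal L"
  shows "word_ext s act z v = 0"
proof -
  interpret linear_ops s act by (rule lie_module_linear_ops[OF assms(1)])
  have "uact s act (uclass L z) v = uact s act (uclass L 0) v"
    using assms(2) uclass_eq_iff[of L z 0] by simp
  then show ?thesis
    by (simp add: uact_uclass[OF assms(1)])
qed

lemma word_ext_cong:
  assumes "lie_module L s act" "uclass L x = uclass L y"
  shows "word_ext s act x v = word_ext s act y v"
  using assms uact_uclass[OF assms(1)] by metis

text \<open>The coaction of \<open>R(\<gg>\<^sub>2)\<close> on \<open>\<gg>\<^sub>1\<close> is described by equations between values of \<open>\<iota>\<close>, which is all that the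
  action on a module depends on.\<close>

lemma act_cong:
  assumes "lie_module L s act" "\<iota> L X = \<iota> L Y"
  shows "act X = act Y"
proof
  interpret linear_ops s act by (rule lie_module_linear_ops[OF assms(1)])
  show "act X v = act Y v" for v
    using word_ext_cong[OF assms(1), of "gen X" "gen Y" v] assms(2) by (simp add: \<iota>_def)
qed

text \<open>In a locally finite module the matrix coefficients are representative functions, so that the
  action is given by a tensor.\<close>

lemma locally_finite_tensor:
  assumes mod: "lie_module L s act" and fin: "locally_finite s act"
  shows "\<exists>t\<in>(whole_space s) \<boxtimes> (R_space L).
    \<forall>x. word_ext s act x v = tensor_eval s (whole_space s) (R_space L) (uclass L x) t"
proof -
  interpret linear_ops s act by (rule lie_module_linear_ops[OF mod])
  obtain W B0 where W: "subspace W" "\<And>X w. w \<in> W \<Longrightarrow> act X w \<in> W" "v \<in> W" and B0: "finite B0" "W = span B0"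
    using fin unfolding locally_finite_def by metis
  obtain B where B: "B \<subseteq> B0" "independent B" "B0 \<subseteq> span B"
    using maximal_independent_subset[of B0] by blast
  have finB: "finite B"
    using B(1) B0(1) by (rule finite_subset)
  have WB: "W = span B"
    using B B0 by (metis span_eq span_superset subset_trans)
  have word: "word_ext s act x w \<in> W" if "w \<in> W" for x w
  proof (induction x rule: free_alg_induct)
    case (word u)
    show ?case using that by (induction u) (simp_all add: W)
  qed (simp_all add: word_ext_plus word_ext_tscale subspace_add[OF W(1)] subspace_scale[OF W(1)])
  define \<theta> where "\<theta> b w = on_uea L (\<lambda>u. representation B (uact s act u w) b)" for b w
  have \<theta>: "\<theta> b w (uclass L x) = representation B (word_ext s act x w) b" for b w x
    by (simp add: \<theta>_def uact_uclass[OF mod])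
  have \<theta>_udual: "\<theta> b w \<in> udual L" if "w \<in> W" for b w
    using word[OF that] unfolding WB
    by (auto simp: udual_iff \<theta> word_ext_plus word_ext_tscale representation_add[OF B(2)]
        representation_scale[OF B(2)]) (simp add: \<theta>_def)
  have R: "\<theta> b w \<in> R_alg L" if "w \<in> W" for b w
    unfolding R_alg_iff
  proof (rule representative_orbit[where \<theta> = "\<theta> b" and A = act and B = B, OF vector_space_axioms finB])
    note sub = fn.subspace_add[OF udual_subspace] fn.subspace_scale[OF udual_subspace]
    show "\<theta> b (v + w) = \<theta> b v + \<theta> b w" if "v \<in> span B" "w \<in> span B" for v w
      using that word unfolding WB[symmetric]
      by (intro udual_eqI[of _ L] sub \<theta>_udual)
        (auto simp: \<theta> word_ext_add_right representation_add[OF B(2)] WB subspace_add[OF W(1), unfolded WB])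
    show "\<theta> b (s c v) = fscale c (\<theta> b v)" if "v \<in> span B" for c v
      using that word unfolding WB[symmetric]
      by (intro udual_eqI[of _ L] sub \<theta>_udual)
        (auto simp: \<theta> word_ext_scale_right representation_scale[OF B(2)] WB subspace_scale[OF W(1), unfolded WB])
    show "translate L (\<iota> L X) (\<theta> b v) = \<theta> b (act X v)" if "v \<in> span B" for X v
      using that W(2) unfolding WB[symmetric]
      by (intro udual_eqI[of _ L] translate_gen_udual \<theta>_udual) (auto simp: \<theta> word_ext_mult)
  qed (use that W(2) \<theta>_udual in \<open>auto simp: WB\<close>)
  have V: "is_space s (whole_space s)"
    by (rule whole_space_is_space[OF vector_space_axioms])
  let ?t = "\<Sum>b\<in>B. tens (whole_space s) (R_space L) b (\<theta> b v)"
  have mem: "tens (whole_space s) (R_space L) b (\<theta> b v) \<in> (whole_space s) \<boxtimes> (R_space L)" for b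
    by (rule tensor_tens) (simp_all add: R W(3))
  have "word_ext s act x v = tensor_eval s (whole_space s) (R_space L) (uclass L x) ?t" for x
  proof -
    have "tensor_eval s (whole_space s) (R_space L) (uclass L x) ?t = (\<Sum>b\<in>B. s (representation B (word_ext s act x v) b) b)"
      unfolding eval_sum[OF V mem] by (intro sum.cong) (simp_all add: eval_simps(4)[OF V] R W(3) \<theta>)
    also have "\<dots> = word_ext s act x v"
      using word[OF W(3)] unfolding WB by (intro sum_representation_eq[OF B(2) _ finB order.refl])
    finally show ?thesis by simp
  qed
  moreover have "?t \<in> (whole_space s) \<boxtimes> (R_space L)"
    by (intro tensor_sum mem)
  ultimately show ?thesis by blast
qed

lemma associated_coaction_iff:
  assumes "lie_module L s act"
  shows "associated_coaction L s act coact \<longleftrightarrow>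
    (\<forall>v. coact v \<in> (whole_space s) \<boxtimes> (R_space L)) \<and>
    (\<forall>x v. word_ext s act x v = tensor_eval s (whole_space s) (R_space L) (uclass L x) (coact v))"
  unfolding associated_coaction_def Let_def tensor_eval_def UEA_carrier
  by (auto simp: uact_uclass[OF assms])

text \<open>Coassociativity is tested by evaluating the two factors in \<open>R(L)\<close>.\<close>

locale precoaction =
  fixes L :: "'b::ab_group_add lie" and s :: "complex \<Rightarrow> 'v::ab_group_add \<Rightarrow> 'v"
    and coact :: "'v \<Rightarrow> ('v, 'b ue \<Rightarrow> complex) tensor"
  assumes vs: "vector_space s"
    and coact_in: "coact v \<in> (whole_space s) \<boxtimes> (R_space L)"
    and coact_add: "coact (v + w) = coact v + coact w"
    and coact_scale: "coact (s c v) = fscale c (coact v)"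
begin

sublocale vector_space s by (rule vs)

abbreviation "V \<equiv> whole_space s"
abbreviation "H \<equiv> R_space L"
abbreviation "VH \<equiv> tensor_product V H"
abbreviation evalV where "evalV x \<equiv> tensor_eval s V H (uclass L x)"
abbreviation evalVH where "evalVH x \<equiv> tensor_eval fscale VH H (uclass L x)"

definition E :: "'b free_alg \<Rightarrow> 'v \<Rightarrow> 'v" where
  "E x v = evalV x (coact v)"

lemma V_space: "is_space s V"
  by (rule whole_space_is_space[OF vs])

lemma VH_space: "is_space fscale VH"
  by (rule tensor_is_space[OF V_space])

lemma E_linear:
  "E (x + y) v = E x v + E y v" "E (tscale c x) v = s c (E x v)"
  "E x (v + w) = E x v + E x w" "E x (s c v) = s c (E x v)"
  unfolding E_def coact_add coact_scale
  by (simp_all add: eval_linear[OF V_space] eval_simps(2,3)[OF V_space] coact_in)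

lemma E_cong: "uclass L x = uclass L y \<Longrightarrow> E x v = E y v"
  by (simp add: E_def)

lemma E_0 [simp]: "E x 0 = 0"
  using E_linear(4)[of x 0 0] by simp

definition coact_left :: "'v \<Rightarrow> (('v, 'b ue \<Rightarrow> complex) tensor, 'b ue \<Rightarrow> complex) tensor" where
  "coact_left v = tlift V H (\<lambda>v0 v1. tens VH H (coact v0) v1) (coact v)"

definition coact_right :: "'v \<Rightarrow> (('v, 'b ue \<Rightarrow> complex) tensor, 'b ue \<Rightarrow> complex) tensor" where
  "coact_right v = tlift V H (\<lambda>v0 v1. tlift H H (\<lambda>f1 f2. tens VH H (tens V H v0 f1) f2) (R_comult L v1)) (coact v)"

lemma tens_bilinear_simps:
  "b \<in> vcar B \<Longrightarrow> a \<in> vcar A \<Longrightarrow> a' \<in> vcar A \<Longrightarrow> tens A B (vadd A a a') b = tens A B a b + tens A B a' b"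
  "a \<in> vcar A \<Longrightarrow> b \<in> vcar B \<Longrightarrow> b' \<in> vcar B \<Longrightarrow> tens A B a (vadd B b b') = tens A B a b + tens A B a b'"
  "a \<in> vcar A \<Longrightarrow> b \<in> vcar B \<Longrightarrow> tens A B (vscale A c a) b = fscale c (tens A B a b)"
  "a \<in> vcar A \<Longrightarrow> b \<in> vcar B \<Longrightarrow> tens A B a (vscale B c b) = fscale c (tens A B a b)"
  using tens_bilinear[of A B] by (auto simp: bilinear_on_def)

lemmas tens_V = tens_bilinear_simps[where A = V and B = H, simplified]
lemmas tens_VH = tens_bilinear_simps[where A = VH and B = H, simplified]

lemma double_eval:
  "t \<in> vcar VH \<Longrightarrow> f \<in> R_alg L \<Longrightarrow> evalV x (evalVH y (tens VH H t f)) = s (f (uclass L y)) (evalV x t)"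
  by (simp add: eval_simps(4)[OF VH_space] eval_simps(3)[OF V_space])

lemma double_eval_add:
  "t \<in> VH \<boxtimes> H \<Longrightarrow> t' \<in> VH \<boxtimes> H \<Longrightarrow>
    evalV x (evalVH y (t + t')) = evalV x (evalVH y t) + evalV x (evalVH y t')"
  by (simp add: eval_simps(2,5)[OF VH_space] eval_simps(2)[OF V_space])

lemma double_eval_0: "evalV x (evalVH y 0) = 0"
  by (simp add: eval_simps(1)[OF VH_space] eval_simps(1)[OF V_space])

lemma double_eval_eqI:
  assumes t: "t \<in> VH \<boxtimes> H" "t' \<in> VH \<boxtimes> H"
    and "\<And>x y. evalV x (evalVH y t) = evalV x (evalVH y t')"
  shows "t = t'"
proof (rule tensor_eqI_R[OF VH_space t])
  show "evalVH y t = evalVH y t'" for y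
    by (rule tensor_eqI_R[where L = L, OF V_space]) (simp_all add: eval_simps(5)[OF VH_space] t assms(3))
qed

lemma coact_left_bilinear: "bilinear_on fscale V H (\<lambda>v0 v1. tens VH H (coact v0) v1)"
  by (intro bilinear_onI[OF fscale_vector_space]) (simp_all add: tens_VH coact_add coact_scale coact_in)

lemma eval_linear_bilinear:
  assumes "\<And>v w. h (v + w) = h v + h w" "\<And>c v. h (s c v) = s c (h v)"
  shows "bilinear_on s V H (\<lambda>v0 v1. s (v1 u) (h v0))"
  by (rule bilinear_onI[OF vs])
    (simp_all add: assms scale_right_distrib scale_left_distrib scale_left_commute
      fn_apply(1)[of _ _ u] fn_apply(4)[of _ _ u])

lemma coact_left_eval:
  shows coact_left_in: "coact_left v \<in> VH \<boxtimes> H"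
    and "evalV x (evalVH y (coact_left v)) = E x (E y v)"
proof -
  show "coact_left v \<in> VH \<boxtimes> H"
    unfolding coact_left_def
    by (rule tlift_in[OF coact_left_bilinear tensor_0 tensor_add _ coact_in]) (simp_all add: tensor_tens coact_in)
  have b: "bilinear_on s V H (\<lambda>v0 v1. s (v1 (uclass L y)) (E x v0))"
    by (rule eval_linear_bilinear) (simp_all add: E_linear)
  have "evalV x (evalVH y (coact_left v)) = tlift V H (\<lambda>v0 v1. s (v1 (uclass L y)) (E x v0)) (coact v)"
    unfolding coact_left_def
    by (rule tlift_comp[OF coact_left_bilinear b _ _ _ _ _ coact_in,
        where h = "\<lambda>t. evalV x (evalVH y t)" and S = "VH \<boxtimes> H"])
      (simp_all add: double_eval double_eval_add double_eval_0 tensor_0 tensor_add tensor_tens coact_in E_def)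
  also have "\<dots> = E x (E y v)"
    unfolding E_def[of y] tensor_eval_def[of s V H "uclass L y"]
    by (rule tlift_comp[OF eval_bilinear[OF V_space] b _ _ _ _ _ coact_in, where S = UNIV, symmetric])
      (simp_all add: E_linear)
  finally show "evalV x (evalVH y (coact_left v)) = E x (E y v)" .
qed

lemma coact_right_eval:
  shows coact_right_in: "coact_right v \<in> VH \<boxtimes> H"
    and "evalV x (evalVH y (coact_right v)) = E (x * y) v"
proof -
  define N where "N v0 v1 = tlift H H (\<lambda>f1 f2. tens VH H (tens V H v0 f1) f2) (R_comult L v1)" for v0 v1
  have b: "bilinear_on fscale H H (\<lambda>f1 f2. tens VH H (tens V H v0 f1) f2)" for v0
    by (intro bilinear_onI[OF fscale_vector_space]) (simp_all add: tens_V tens_VH tensor_tens)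
  have N_in: "N v0 v1 \<in> VH \<boxtimes> H" if "v1 \<in> R_alg L" for v0 v1
    unfolding N_def
    by (rule tlift_in[OF b tensor_0 tensor_add _ R_comult_in[OF that]]) (simp_all add: tensor_tens)
  have N_eval: "evalV x (evalVH y (N v0 v1)) = s (v1 (uclass L (x * y))) v0" if v1: "v1 \<in> R_alg L" for v0 v1 x y
  proof -
    have b': "bilinear_on s H H (\<lambda>f1 f2. s (f1 (uclass L x) * f2 (uclass L y)) v0)"
      by (rule bilinear_onI[OF vs]) (simp_all add: algebra_simps scale_left_distrib)
    have "evalV x (evalVH y (N v0 v1)) = tlift H H (\<lambda>f1 f2. s (f1 (uclass L x) * f2 (uclass L y)) v0) (R_comult L v1)"
      unfolding N_def
      by (rule tlift_comp[OF b b' _ _ _ _ _ R_comult_in[OF v1],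
          where h = "\<lambda>t. evalV x (evalVH y t)" and S = "VH \<boxtimes> H"])
        (simp_all add: double_eval double_eval_add double_eval_0 tensor_0 tensor_add tensor_tens eval_simps(4)[OF V_space] mult.commute)
    also have "\<dots> = s (tlift H H (\<lambda>f1 f2. f1 (uclass L x) * f2 (uclass L y)) (R_comult L v1)) v0"
      by (rule tlift_comp[OF pair_eval_bilinear b' _ _ _ _ _ R_comult_in[OF v1], where S = UNIV and h = "\<lambda>z. s z v0", symmetric])
        (simp_all add: scale_left_distrib)
    finally show ?thesis
      by (simp add: R_comult_eval[OF v1])
  qed
  have N_bilinear: "bilinear_on fscale V H N"
  proof (rule bilinear_onI[OF fscale_vector_space])
    note sub = fn.subspace_add[OF R_alg_subspace] fn.subspace_scale[OF R_alg_subspace]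
    note fs = tensor_fscale[OF is_spaceD(6)[OF VH_space, folded vscale_tensor[of V H]]]
    show "N (vadd V a a') b = N a b + N a' b" if "b \<in> vcar H" for a a' b
      using that by (intro double_eval_eqI tensor_add N_in)
        (simp_all add: N_eval N_in double_eval_add scale_right_distrib)
    show "N a (vadd H b b') = N a b + N a b'" if "b \<in> vcar H" "b' \<in> vcar H" for a b b'
      using that by (intro double_eval_eqI tensor_add N_in)
        (simp_all add: sub N_eval N_in double_eval_add scale_left_distrib)
    have sc: "evalV x (evalVH y (fscale c t)) = s c (evalV x (evalVH y t))" if "t \<in> VH \<boxtimes> H" for c t x y
      using that by (simp add: eval_simps(3,5)[OF VH_space] eval_simps(3)[OF V_space])
    show "N (vscale V c a) b = fscale c (N a b)" if "b \<in> vcar H" for c a b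
      using that by (intro double_eval_eqI fs N_in) (simp_all add: N_eval N_in sc scale_left_commute mult.commute)
    show "N a (vscale H c b) = fscale c (N a b)" if "b \<in> vcar H" for c a b
      using that by (intro double_eval_eqI fs N_in) (simp_all add: sub N_eval N_in sc)
  qed
  have r: "coact_right v = tlift V H N (coact v)"
    by (simp add: coact_right_def N_def[abs_def])
  show "coact_right v \<in> VH \<boxtimes> H"
    unfolding r by (rule tlift_in[OF N_bilinear tensor_0 tensor_add _ coact_in]) (simp_all add: N_in)
  show "evalV x (evalVH y (coact_right v)) = E (x * y) v"
    unfolding r E_def tensor_eval_def[of s V H "uclass L (x * y)"]
    by (rule tlift_comp[OF N_bilinear eval_bilinear[OF V_space] _ _ _ _ _ coact_in,
        where h = "\<lambda>t. evalV x (evalVH y t)" and S = "VH \<boxtimes> H"])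
      (simp_all add: N_eval N_in double_eval_add double_eval_0 tensor_0 tensor_add)
qed

text \<open>\<open>E x (E y v)\<close> and \<open>E (x * y) v\<close> are the double evaluations of the two sides of the coassociativity
  law.\<close>

lemma comodule_iff:
  "R_comodule L s coact \<longleftrightarrow> (\<forall>x y v. E (x * y) v = E x (E y v)) \<and> (\<forall>v. E 1 v = v)"
proof -
  have "coact_left v = coact_right v \<longleftrightarrow> (\<forall>x y. E (x * y) v = E x (E y v))" for v
  proof
    assume "coact_left v = coact_right v"
    then show "\<forall>x y. E (x * y) v = E x (E y v)"
      using coact_left_eval(2) coact_right_eval(2) by metis
  next
    assume "\<forall>x y. E (x * y) v = E x (E y v)"
    then show "coact_left v = coact_right v"
      by (intro double_eval_eqI coact_left_in coact_right_in) (simp add: coact_left_eval(2) coact_right_eval(2))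
  qed
  then show ?thesis
    unfolding R_comodule_def Let_def
    by (auto simp: vs coact_in coact_add coact_scale E_def tensor_eval_def R_counit_def UEA_one
        simp flip: coact_left_def coact_right_def)
qed

end

lemma R_comodule_precoaction: "R_comodule L s coact \<Longrightarrow> precoaction L s coact"
  by (simp add: R_comodule_def Let_def precoaction_def)

section \<open>Induced modules\<close>

context matched
begin

lemma la_module: "lie_module L2 (lscale L1) (la M)"
  by (simp add: lie_module_def la_bilinear la_bracket2)

lemma R_act_uclass: "R_act M X f (uclass L2 x) = f (uclass L2 (right_mutual x X))"
  by (simp add: R_act_def mutual_right_uclass)

lemma R_act_outside: "u \<notin> carrier (UEA L2) \<Longrightarrow> R_act M X f u = 0"
  by (simp add: R_act_def)

lemma R_act_udual:
  assumes "f \<in> udual L2"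
  shows "R_act M X f \<in> udual L2"
  by (simp add: udual_iff R_act_uclass R_act_outside udualD[OF assms])

lemma R_act_linear:
  shows "R_act M X (f + g) = R_act M X f + R_act M X g"
    and "R_act M X (fscale c f) = fscale c (R_act M X f)"
    and "f \<in> udual L2 \<Longrightarrow> R_act M (X + Y) f = R_act M X f + R_act M Y f"
    and "f \<in> udual L2 \<Longrightarrow> R_act M (lscale L1 c X) f = fscale c (R_act M X f)"
proof -
  note sub = fn.subspace_add[OF udual_subspace] fn.subspace_scale[OF udual_subspace]
  show "R_act M X (f + g) = R_act M X f + R_act M X g"
    by (rule ext) (simp add: R_act_def fn_apply)
  show "R_act M X (fscale c f) = fscale c (R_act M X f)"
    by (rule ext) (simp add: R_act_def fn_apply)
  assume f: "f \<in> udual L2"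
  have "uclass L2 (right_mutual x (X + Y)) = uclass L2 (right_mutual x X + right_mutual x Y)" for x
    by (simp add: uclass_eq_iff right_mutual_add)
  then show "R_act M (X + Y) f = R_act M X f + R_act M Y f"
    by (intro udual_eqI[of _ L2] R_act_udual sub f) (simp add: R_act_uclass udualD[OF f])
  have "uclass L2 (right_mutual x (lscale L1 c X)) = uclass L2 (tscale c (right_mutual x X))" for x
    by (simp add: uclass_eq_iff right_mutual_scale)
  then show "R_act M (lscale L1 c X) f = fscale c (R_act M X f)"
    by (intro udual_eqI[of _ L2] R_act_udual sub f) (simp add: R_act_uclass udualD[OF f])
qed

text \<open>Dual to the recursion for \<open>(u \<xi>) \<triangleleft> X\<close>.\<close>

lemma R_act_translate:
  assumes f: "f \<in> udual L2"
  shows "translate L2 (\<iota> L2 \<xi>) (R_act M X f)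
    = R_act M X (translate L2 (\<iota> L2 \<xi>) f) + (R_act M (\<xi> \<triangleright> X) f + translate L2 (\<iota> L2 (\<xi> \<triangleleft> X)) f)"
proof (rule udual_eqI[of _ L2])
  show "translate L2 (\<iota> L2 \<xi>) (R_act M X f) \<in> udual L2"
    "R_act M X (translate L2 (\<iota> L2 \<xi>) f) + (R_act M (\<xi> \<triangleright> X) f + translate L2 (\<iota> L2 (\<xi> \<triangleleft> X)) f) \<in> udual L2"
    by (intro translate_gen_udual R_act_udual fn.subspace_add[OF udual_subspace] f)+
  fix x
  have "uclass L2 (right_mutual (x * gen \<xi>) X)
    = uclass L2 (right_mutual x X * gen \<xi> + right_mutual x (\<xi> \<triangleright> X) + x * gen (\<xi> \<triangleleft> X))"
    unfolding uclass_eq_iff by (rule right_mutual_snoc)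
  then show "translate L2 (\<iota> L2 \<xi>) (R_act M X f) (uclass L2 x)
    = (R_act M X (translate L2 (\<iota> L2 \<xi>) f) + (R_act M (\<xi> \<triangleright> X) f + translate L2 (\<iota> L2 (\<xi> \<triangleleft> X)) f)) (uclass L2 x)"
    by (simp add: R_act_uclass udualD[OF f])
qed

text \<open>By the preceding formula, a stable space together with its images under all \<open>X\<close> is again stable,
  and finitely many \<open>X\<close> suffice because \<open>\<gg>\<^sub>1\<close> is finite-dimensional.\<close>

lemma R_act_R_alg:
  assumes "f \<in> R_alg L2"
  shows "R_act M X f \<in> R_alg L2"
proof -
  interpret V1: vector_space "lscale L1" by (rule scale1)
  obtain F where F: "finite F" "F \<subseteq> udual L2" "f \<in> fn.span F"
    "\<forall>g\<in>F. \<forall>X. translate L2 (\<iota> L2 X) g \<in> fn.span F"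
    using assms unfolding R_alg_iff representative_def by blast
  obtain B where B: "finite B" "V1.span B = UNIV"
    using finite_dim(1) unfolding finite_dim_lie_algebra_def by blast
  let ?P = "F \<union> (\<lambda>(X, g). R_act M X g) ` (B \<times> F)"
  have FP: "fn.span F \<subseteq> fn.span ?P"
    by (rule fn.span_mono) simp
  have base: "R_act M X g \<in> fn.span ?P" if g: "g \<in> F" for X g
  proof -
    have gd: "g \<in> udual L2" using g F(2) by blast
    have "X \<in> V1.span B" by (simp add: B(2))
    then show ?thesis
    proof (induction rule: V1.span_induct_alt)
      case base
      have "R_act M 0 g = 0"
        using R_act_linear(4)[OF gd, of 0 0] by simp
      then show ?case by (simp add: fn.span_zero)
    next
      case (step c x y)
      have "R_act M x g \<in> fn.span ?P"
        using step(1) g by (intro fn.span_base) force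
      then show ?case
        using step(2) by (simp only: R_act_linear(3,4)[OF gd] fn.span_add fn.span_scale)
    qed
  qed
  have span: "R_act M X g \<in> fn.span ?P" if "g \<in> fn.span F" for X g
    using that
  proof (induction rule: fn.span_induct_alt)
    case base
    have "R_act M X 0 = 0"
      using R_act_linear(2)[of X 0 0] by simp
    then show ?case by (simp add: fn.span_zero)
  next
    case (step c x y)
    then show ?case
      by (simp add: R_act_linear(1,2) fn.span_add fn.span_scale base)
  qed
  have "translate L2 (\<iota> L2 \<xi>) (R_act M X g) \<in> fn.span ?P" if "g \<in> F" for X \<xi> g
  proof -
    have t: "translate L2 (\<iota> L2 \<zeta>) g \<in> fn.span F" for \<zeta>
      using that F(4) by blast
    have "g \<in> udual L2" using that F(2) by blast
    then show ?thesis
      unfolding R_act_translate[OF \<open>g \<in> udual L2\<close>]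
      by (intro fn.span_add span[OF t] base[OF that] subsetD[OF FP t])
  qed
  moreover have "translate L2 (\<iota> L2 \<xi>) g \<in> fn.span ?P" if "g \<in> F" for \<xi> g
    using that F(4) FP by blast
  moreover have "?P \<subseteq> udual L2"
    using F(2) R_act_udual by auto
  ultimately show ?thesis
    unfolding R_alg_iff representative_def using F(1) B(1) span[OF F(3)]
    by (intro exI[of _ ?P]) auto
qed

abbreviation G where "G \<equiv> whole_space (lscale L1)"

lemma G_space: "is_space (lscale L1) G"
  by (rule whole_space_is_space[OF scale1])

text \<open>As a finite-dimensional module over \<open>\<gg>\<^sub>2\<close>, the Lie algebra \<open>\<gg>\<^sub>1\<close> is locally finite, so a tensor as
  required exists.\<close>

lemma g1_coact:
  shows g1_coact_in: "g1_coact M X \<in> G \<boxtimes> (R_space L2)"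
    and g1_coact_eval: "\<iota> L1 (tensor_eval (lscale L1) G (R_space L2) (uclass L2 x) (g1_coact M X))
      = \<iota> L1 (word_ext (lscale L1) (la M) x X)"
proof -
  let ?P = "\<lambda>t. t \<in> G \<boxtimes> (R_space L2) \<and>
    (\<forall>u'\<in>carrier (UEA L2). mutual_left M u' (\<iota> L1 X)
      = \<iota> L1 (tlift G (R_space L2) (\<lambda>X0 X1. lscale L1 (X1 u') X0) t))"
  have P: "?P t \<longleftrightarrow> t \<in> G \<boxtimes> (R_space L2) \<and>
    (\<forall>x. \<iota> L1 (word_ext (lscale L1) (la M) x X) = \<iota> L1 (tensor_eval (lscale L1) G (R_space L2) (uclass L2 x) t))" for t
    unfolding tensor_eval_def UEA_carrier by (simp add: mutual_left_uclass)
  interpret V1: vector_space "lscale L1" by (rule scale1)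
  have "locally_finite (lscale L1) (la M)"
    unfolding locally_finite_def
    using finite_dim(1) unfolding finite_dim_lie_algebra_def
    by (intro allI exI[of _ UNIV]) auto
  then obtain t where "?P t"
    using locally_finite_tensor[OF la_module, of X] unfolding P by metis
  then have "?P (g1_coact M X)"
    unfolding g1_coact_def Let_def by (rule someI[of ?P])
  then show "g1_coact M X \<in> G \<boxtimes> (R_space L2)"
    "\<iota> L1 (tensor_eval (lscale L1) G (R_space L2) (uclass L2 x) (g1_coact M X))
      = \<iota> L1 (word_ext (lscale L1) (la M) x X)"
    unfolding P by metis+
qed

end

lemma split_sum_sum: "(\<Sum>i\<in>I. split_sum (g i) w) = split_sum (\<lambda>a b. \<Sum>i\<in>I. g i a b) w"
proof (induction I rule: infinite_finite_induct)
  have "split_sum (\<lambda>a b. 0) w = 0"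
    by (induction w) (simp_all add: split_sum_Cons)
  moreover case empty
  ultimately show ?case by simp
next
  have "split_sum (\<lambda>a b. 0) w = 0"
    by (induction w) (simp_all add: split_sum_Cons)
  moreover case infinite
  ultimately show ?case by simp
qed (simp add: split_sum_add)

definition induced_rhs where
  "induced_rhs M s act X c =
    tlift (whole_space (lscale (g1 M))) (R_space (g2 M))
      (\<lambda>X0 X1. tlift (whole_space s) (R_space (g2 M))
        (\<lambda>v0 v1. tens (whole_space s) (R_space (g2 M)) (act X0 v0) (R_mult (g2 M) X1 v1)) c) (g1_coact M X)
    + tlift (whole_space s) (R_space (g2 M)) (\<lambda>v0 v1. tens (whole_space s) (R_space (g2 M)) v0 (R_act M X v1)) c"

text \<open>The right-hand side of the compatibility condition for induced modules, evaluated at a word: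
  \<open>(u\<^sub>1 \<triangleright> X) (u\<^sub>2 c) + (u \<triangleleft> X) c\<close>.\<close>

lemma (in matched) induced_rhs_eval:
  fixes s :: "complex \<Rightarrow> 'v::ab_group_add \<Rightarrow> 'v"
  assumes mod: "lie_module L1 s act" and c: "c \<in> (whole_space s) \<boxtimes> (R_space L2)"
  defines "ev \<equiv> \<lambda>x. tensor_eval s (whole_space s) (R_space L2) (uclass L2 x)"
  shows induced_rhs_in: "induced_rhs M s act X c \<in> (whole_space s) \<boxtimes> (R_space L2)"
    and "ev (word w) (induced_rhs M s act X c)
      = split_sum (\<lambda>a b. act (word_ext (lscale L1) (la M) (word a) X) (ev (word b) c)) w
        + ev (right_mutual (word w) X) c"
proof -
  note act = bilinear_mapD[OF lie_moduleD(1)[OF mod]]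
  interpret vector_space s by (rule act(3))
  let ?V = "whole_space s" and ?H = "R_space L2"
  have V: "is_space s ?V"
    by (rule whole_space_is_space[OF act(3)])
  have act_sum: "act (\<Sum>k\<in>A. Y k) v = (\<Sum>k\<in>A. act (Y k) v)" "act Z (\<Sum>k\<in>A. v' k) = (\<Sum>k\<in>A. act Z (v' k))"
    for A :: "nat set" and Y v v' Z
    by (induction A rule: infinite_finite_induct) (simp_all add: act)
  note sub = fn.subspace_add[OF R_alg_subspace] fn.subspace_scale[OF R_alg_subspace]
  have tb: "tens ?V ?H (a + a') b = tens ?V ?H a b + tens ?V ?H a' b"
    "tens ?V ?H (s z a) b = fscale z (tens ?V ?H a b)" if "b \<in> R_alg L2" for a a' b z
    using tens_bilinear[of ?V ?H] that by (auto simp: bilinear_on_def)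
  have tb': "tens ?V ?H a (b + b') = tens ?V ?H a b + tens ?V ?H a b'" if "b \<in> R_alg L2" "b' \<in> R_alg L2" for a b b'
    using tens_bilinear[of ?V ?H] that by (auto simp: bilinear_on_def)
  have tb'': "tens ?V ?H a (fscale z b) = fscale z (tens ?V ?H a b)" if "b \<in> R_alg L2" for a b z
    using tens_bilinear[of ?V ?H] that by (auto simp: bilinear_on_def)
  have inner: "bilinear_on fscale ?V ?H (\<lambda>v0 v1. tens ?V ?H (act X0 v0) (R_mult L2 X1 v1))" if "X1 \<in> R_alg L2" for X0 X1
    using that by (intro bilinear_onI[OF fscale_vector_space])
      (simp_all add: tb tb' tb'' act R_mult_bilinear R_alg_udual R_mult_R_alg)
  have right: "bilinear_on fscale ?V ?H (\<lambda>v0 v1. tens ?V ?H v0 (R_act M X v1))"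
    by (intro bilinear_onI[OF fscale_vector_space]) (simp_all add: tb tb' tb'' R_act_linear R_act_R_alg)
  obtain n v f where rc: "tensor_rep ?V ?H c n v f"
    using c unfolding vcar_tensor by blast
  obtain m Y h where rg: "tensor_rep G ?H (g1_coact M X) m Y h"
    using g1_coact_in unfolding vcar_tensor by blast
  have f: "f j \<in> R_alg L2" if "j < n" for j
    using rc that by (auto simp: tensor_rep_def Pi_iff)
  have h: "h k \<in> R_alg L2" if "k < m" for k
    using rg that by (auto simp: tensor_rep_def Pi_iff)
  let ?K = "\<lambda>X0 X1. \<Sum>j<n. tens ?V ?H (act X0 (v j)) (R_mult L2 X1 (f j))"
  have K: "tlift ?V ?H (\<lambda>v0 v1. tens ?V ?H (act X0 v0) (R_mult L2 X1 v1)) c = ?K X0 X1" if "X1 \<in> R_alg L2" for X0 X1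
    by (rule tlift_rep[OF inner[OF that] rc])
  have "bilinear_on fscale G ?H ?K"
    using f by (intro bilinear_onI[OF fscale_vector_space])
      (simp_all add: tb tb' tb'' sub act R_mult_bilinear R_alg_udual R_mult_R_alg fn.scale_sum_right sum.distrib)
  then have K_bilinear: "bilinear_on fscale G ?H (\<lambda>X0 X1. tlift ?V ?H (\<lambda>v0 v1. tens ?V ?H (act X0 v0) (R_mult L2 X1 v1)) c)"
    by (simp add: bilinear_on_def K sub)
  have rhs: "induced_rhs M s act X c
    = (\<Sum>k<m. \<Sum>j<n. tens ?V ?H (act (Y k) (v j)) (R_mult L2 (h k) (f j))) + (\<Sum>j<n. tens ?V ?H (v j) (R_act M X (f j)))"
    unfolding induced_rhs_def tlift_rep[OF K_bilinear rg] tlift_rep[OF right rc]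
    by (simp add: K h)
  have mem: "tens ?V ?H (act (Y k) (v j)) (R_mult L2 (h k) (f j)) \<in> ?V \<boxtimes> ?H" if "k < m" "j < n" for k j
    using that by (intro tensor_tens) (simp_all add: R_mult_R_alg h f)
  have mem': "tens ?V ?H (v j) (R_act M X (f j)) \<in> ?V \<boxtimes> ?H" if "j < n" for j
    using that by (intro tensor_tens) (simp_all add: R_act_R_alg f)
  have in1: "(\<Sum>k<m. \<Sum>j<n. tens ?V ?H (act (Y k) (v j)) (R_mult L2 (h k) (f j))) \<in> ?V \<boxtimes> ?H"
    using mem by (intro tensor_sum) auto
  have in2: "(\<Sum>j<n. tens ?V ?H (v j) (R_act M X (f j))) \<in> ?V \<boxtimes> ?H"
    using mem' by (intro tensor_sum) auto
  show "induced_rhs M s act X c \<in> ?V \<boxtimes> ?H"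
    unfolding rhs by (rule tensor_add[OF in1 in2])
  have ev_c: "ev x c = (\<Sum>j<n. s (f j (uclass L2 x)) (v j))" for x
    unfolding ev_def by (rule eval_rep[OF V rc])
  have "ev (word w) (\<Sum>k<m. \<Sum>j<n. tens ?V ?H (act (Y k) (v j)) (R_mult L2 (h k) (f j)))
    = (\<Sum>k<m. \<Sum>j<n. s (R_mult L2 (h k) (f j) (uclass L2 (word w))) (act (Y k) (v j)))"
    unfolding ev_def
    by (subst eval_sum[OF V], use mem in \<open>auto intro!: tensor_sum\<close>, intro sum.cong refl, subst eval_sum[OF V],
        use mem in auto, intro sum.cong refl) (simp add: eval_simps(4)[OF V] R_mult_R_alg h f)
  also have "\<dots> = (\<Sum>k<m. \<Sum>j<n. split_sum (\<lambda>a b. act (lscale L1 (h k (uclass L2 (word a))) (Y k)) (s (f j (uclass L2 (word b))) (v j))) w)"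
  proof (intro sum.cong refl)
    fix k j assume "k \<in> {..<m}" "j \<in> {..<n}"
    then have "R_mult L2 (h k) (f j) (uclass L2 (word w)) = split_sum (\<lambda>a b. h k (uclass L2 (word a)) * f j (uclass L2 (word b))) w"
      by (intro R_mult_word) (auto intro: R_alg_udual h f)
    then show "s (R_mult L2 (h k) (f j) (uclass L2 (word w))) (act (Y k) (v j))
      = split_sum (\<lambda>a b. act (lscale L1 (h k (uclass L2 (word a))) (Y k)) (s (f j (uclass L2 (word b))) (v j))) w"
      by (simp add: split_sum_hom[where h = "\<lambda>z. s z _"] scale_left_distrib act mult.commute)
  qed
  also have "\<dots> = split_sum (\<lambda>a b. act (\<Sum>k<m. lscale L1 (h k (uclass L2 (word a))) (Y k)) (ev (word b) c)) w"
    unfolding ev_c act_sum(1) unfolding act_sum(2) split_sum_sum ..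
  also have "\<dots> = split_sum (\<lambda>a b. act (word_ext (lscale L1) (la M) (word a) X) (ev (word b) c)) w"
  proof -
    \<comment> \<open>the sum and \<open>a \<triangleright> X\<close> are known to agree under \<open>\<iota>\<close>\<close>
    have "act (\<Sum>k<m. lscale L1 (h k (uclass L2 (word a))) (Y k)) = act (word_ext (lscale L1) (la M) (word a) X)" for a
      by (rule act_cong[OF mod]) (simp add: eval_rep[OF G_space rg, symmetric] g1_coact_eval)
    then show ?thesis by simp
  qed
  finally have 1: "ev (word w) (\<Sum>k<m. \<Sum>j<n. tens ?V ?H (act (Y k) (v j)) (R_mult L2 (h k) (f j)))
    = split_sum (\<lambda>a b. act (word_ext (lscale L1) (la M) (word a) X) (ev (word b) c)) w" .
  have 2: "ev (word w) (\<Sum>j<n. tens ?V ?H (v j) (R_act M X (f j))) = ev (right_mutual (word w) X) c"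
    unfolding ev_c unfolding ev_def
    by (subst eval_sum[OF V], use mem' in auto, intro sum.cong refl)
      (simp add: eval_simps(4)[OF V] R_act_R_alg f R_act_uclass)
  show "ev (word w) (induced_rhs M s act X c)
      = split_sum (\<lambda>a b. act (word_ext (lscale L1) (la M) (word a) X) (ev (word b) c)) w
        + ev (right_mutual (word w) X) c"
    unfolding rhs 1[symmetric] 2[symmetric] unfolding ev_def by (rule eval_simps(2)[OF V in1 in2])
qed

lemma induced_module_iff:
  "induced_module M s act coact \<longleftrightarrow> lie_module (g1 M) s act \<and> R_comodule (g2 M) s coact \<and>
    (\<forall>X v. coact (act X v) = induced_rhs M s act X (coact v))"
  by (simp add: induced_module_def induced_rhs_def Let_def)

section \<open>From modules over the double crossed sum to induced modules\<close>

context matched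
begin

context
  fixes s :: "complex \<Rightarrow> 'v::ab_group_add \<Rightarrow> 'v" and act :: "'a \<times> 'b \<Rightarrow> 'v \<Rightarrow> 'v"
  assumes mod: "lie_module D s act"
begin

abbreviation "res1 \<equiv> \<lambda>X. act (X, 0)"
abbreviation "res2 \<equiv> \<lambda>\<xi>. act (0, \<xi>)"

lemma act_simps:
  "act (X, \<xi>) v = res1 X v + res2 \<xi> v"
  "res2 \<xi> (res1 X v) = res1 X (res2 \<xi> v) + res1 (\<xi> \<triangleright> X) v + res2 (\<xi> \<triangleleft> X) v"
proof -
  note act = bilinear_mapD[OF lie_moduleD(1)[OF mod]]
  show split: "act (X, \<xi>) v = res1 X v + res2 \<xi> v" for X \<xi>
    using act(4)[of "(X, 0)" "(0, \<xi>)" v] by simp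
  have "act (\<xi> \<triangleright> X, \<xi> \<triangleleft> X) v = res2 \<xi> (res1 X v) - res1 X (res2 \<xi> v)"
    using lie_moduleD(2)[OF mod, of "(0, \<xi>)" "(X, 0)" v] by (simp add: br1_simps br2_simps la_simps ra_simps)
  then show "res2 \<xi> (res1 X v) = res1 X (res2 \<xi> v) + res1 (\<xi> \<triangleright> X) v + res2 (\<xi> \<triangleleft> X) v"
    using split[of "\<xi> \<triangleright> X" "\<xi> \<triangleleft> X"] by (simp add: algebra_simps)
qed

lemma
  shows res1_module: "lie_module L1 s res1" and res2_module: "lie_module L2 s res2"
proof -
  note act = bilinear_mapD[OF lie_moduleD(1)[OF mod]]
  have "res1 (X + Y) v = res1 X v + res1 Y v" "res2 (\<xi> + \<zeta>) v = res2 \<xi> v + res2 \<zeta> v" for X Y \<xi> \<zeta> v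
    using act(4)[of "(X, 0)" "(Y, 0)" v] act(4)[of "(0, \<xi>)" "(0, \<zeta>)" v] by simp_all
  moreover have "res1 (lscale L1 c X) v = s c (res1 X v)" "res2 (lscale L2 c \<xi>) v = s c (res2 \<xi> v)" for c X \<xi> v
    using act(6)[of c "(X, 0)" v] act(6)[of c "(0, \<xi>)" v] by (simp_all add: scale_zero)
  moreover have "res1 (br1 X Y) v = res1 X (res1 Y v) - res1 Y (res1 X v)"
    "res2 (br2 \<xi> \<zeta>) v = res2 \<xi> (res2 \<zeta> v) - res2 \<zeta> (res2 \<xi> v)" for X Y \<xi> \<zeta> v
    using lie_moduleD(2)[OF mod, of "(X, 0)" "(Y, 0)" v] lie_moduleD(2)[OF mod, of "(0, \<xi>)" "(0, \<zeta>)" v]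
    by (simp_all add: br1_simps br2_simps la_simps ra_simps)
  ultimately show "lie_module L1 s res1" "lie_module L2 s res2"
    using scale1 scale2 act(3,5,7) by (auto simp: lie_module_def intro!: bilinear_mapI)
qed

text \<open>The compatibility condition evaluated at a word. Appending a letter to the word, the two ways of
  attaching it in the coproduct and the three terms of the recursion for \<open>\<triangleleft>\<close> add up to what
  the mixed bracket relation yields.\<close>

lemma word_ext_res2:
  "word_ext s res2 (word w) (res1 X v)
    = split_sum (\<lambda>a b. res1 (word_ext (lscale L1) (la M) (word a) X) (word_ext s res2 (word b) v)) w
      + word_ext s res2 (right_mutual (word w) X) v"
proof (induction w arbitrary: X v rule: rev_induct)
  interpret A: linear_ops s res2 by (rule lie_module_linear_ops[OF res2_module])
  interpret la: linear_ops "lscale L1" "la M" by (rule la_linear_ops)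
  {
    case Nil
    show ?case
      using lie_module_word_ext_ideal[OF res2_module right_mutual_1] by simp
  next
    case (snoc \<xi> w)
    have "uclass L2 (right_mutual (word w * gen \<xi>) X)
      = uclass L2 (right_mutual (word w) X * gen \<xi> + right_mutual (word w) (\<xi> \<triangleright> X) + word w * gen (\<xi> \<triangleleft> X))"
      unfolding uclass_eq_iff by (rule right_mutual_snoc)
    note r = word_ext_cong[OF res2_module this, of v]
    have "word_ext s res2 (word w * gen \<xi>) (res1 X v)
      = word_ext s res2 (word w) (res1 X (res2 \<xi> v)) + word_ext s res2 (word w) (res1 (\<xi> \<triangleright> X) v)
        + word_ext s res2 (word w) (res2 (\<xi> \<triangleleft> X) v)"
      by (simp only: A.word_ext_mult A.word_ext_gen act_simps(2)[of \<xi> X] A.word_ext_add_right)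
    also have "\<dots> = split_sum (\<lambda>a b. res1 (word_ext (lscale L1) (la M) (word (a @ [\<xi>])) X) (word_ext s res2 (word b) v)) w
        + split_sum (\<lambda>a b. res1 (word_ext (lscale L1) (la M) (word a) X) (word_ext s res2 (word (b @ [\<xi>])) v)) w
        + word_ext s res2 (right_mutual (word w * gen \<xi>) X) v"
      unfolding snoc r by (simp add: A.word_ext_plus A.word_ext_mult)
    finally show ?case
      by (simp only: word_snoc[symmetric] split_sum_snoc)
  }
qed

lemma associated_coaction_induced:
  assumes "associated_coaction L2 s res2 coact"
  shows "induced_module M s res1 coact"
proof -
  note act = bilinear_mapD[OF lie_moduleD(1)[OF mod]]
  interpret A: linear_ops s res2 by (rule lie_module_linear_ops[OF res2_module])
  have V: "is_space s (whole_space s)"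
    by (rule whole_space_is_space[OF act(3)])
  have coact_in: "coact v \<in> (whole_space s) \<boxtimes> (R_space L2)"
    and ev: "tensor_eval s (whole_space s) (R_space L2) (uclass L2 x) (coact v) = word_ext s res2 x v" for v x
    using assms unfolding associated_coaction_iff[OF res2_module] by auto
  have scale_in: "fscale c t \<in> (whole_space s) \<boxtimes> (R_space L2)"
    if "t \<in> (whole_space s) \<boxtimes> (R_space L2)" for c t
    using that by (intro tensor_fscale) auto
  interpret C: precoaction L2 s coact
  proof
    show "coact (v + w) = coact v + coact w" for v w
      by (rule tensor_eqI_R[OF V coact_in tensor_add[OF coact_in coact_in]])
        (simp add: eval_simps(2)[OF V coact_in coact_in] ev A.word_ext_add_right)
    show "coact (s c v) = fscale c (coact v)" for c v
      by (rule tensor_eqI_R[OF V coact_in scale_in[OF coact_in]])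
        (simp add: eval_simps(3)[OF V coact_in] ev A.word_ext_scale_right)
  qed (rule act(3) coact_in)+
  have E: "C.E x v = word_ext s res2 x v" for x v
    by (simp add: C.E_def ev)
  have "R_comodule L2 s coact"
    by (simp add: C.comodule_iff E A.word_ext_mult)
  moreover have "coact (res1 X v) = induced_rhs M s res1 X (coact v)" for X v
    by (rule tensor_eqI_words[OF V coact_in induced_rhs_in[OF res1_module coact_in]])
      (simp only: induced_rhs_eval(2)[OF res1_module coact_in] ev word_ext_res2)
  ultimately show ?thesis
    by (simp add: induced_module_iff res1_module)
qed

lemma ex1_associated_coaction:
  assumes "locally_finite s res2"
  shows "\<exists>!coact. associated_coaction L2 s res2 coact"
proof -
  note act = bilinear_mapD[OF lie_moduleD(1)[OF mod]]
  have V: "is_space s (whole_space s)"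
    by (rule whole_space_is_space[OF act(3)])
  obtain coact where "\<And>v. coact v \<in> (whole_space s) \<boxtimes> (R_space L2)"
    "\<And>v x. word_ext s res2 x v = tensor_eval s (whole_space s) (R_space L2) (uclass L2 x) (coact v)"
    using locally_finite_tensor[OF res2_module assms] by metis
  then have "associated_coaction L2 s res2 coact"
    by (simp add: associated_coaction_iff[OF res2_module])
  moreover have "c = c'" if "associated_coaction L2 s res2 c" "associated_coaction L2 s res2 c'" for c c'
  proof
    show "c v = c' v" for v
      using that unfolding associated_coaction_iff[OF res2_module]
      by (intro tensor_eqI_R[OF V, of _ L2]) metis+
  qed
  ultimately show ?thesis by blast
qed

end

section \<open>From induced modules to modules over the double crossed sum\<close>

lemma double_crossed_sum_vector_space: "vector_space (lscale D)"
proof -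
  interpret V1: vector_space "lscale L1" by (rule scale1)
  interpret V2: vector_space "lscale L2" by (rule scale2)
  show ?thesis
    by standard (auto simp: V1.scale_right_distrib V2.scale_right_distrib V1.scale_left_distrib V2.scale_left_distrib)
qed

lemma lie_module_double_crossed_sumI:
  assumes m1: "lie_module L1 s act1" and m2: "lie_module L2 s act2"
    and comm: "\<And>\<xi> X v. act2 \<xi> (act1 X v) = act1 X (act2 \<xi> v) + act1 (\<xi> \<triangleright> X) v + act2 (\<xi> \<triangleleft> X) v"
  shows "lie_module D s (\<lambda>(X, \<xi>) v. act1 X v + act2 \<xi> v)"
proof -
  note a1 = bilinear_mapD[OF lie_moduleD(1)[OF m1]] and a2 = bilinear_mapD[OF lie_moduleD(1)[OF m2]]
  interpret vector_space s by (rule a1(3))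
  have "bilinear_map (lscale D) s s (\<lambda>(X, \<xi>) v. act1 X v + act2 \<xi> v)"
    by (rule bilinear_mapI[OF double_crossed_sum_vector_space a1(3) a1(3)])
      (auto simp: a1(4-7) a2(4-7) scale_right_distrib)
  then show ?thesis
    by (auto simp: lie_module_def a1(4-) a2(4-) lie_moduleD(2)[OF m1] lie_moduleD(2)[OF m2] comm)
qed

text \<open>The second Lie algebra acts by evaluation of the coaction. The finite-dimensional submodule generated
  by \<open>v\<close> is contained in the span of the first tensor factors of the coaction of \<open>v\<close>.\<close>

lemma induced_module_arises:
  fixes s :: "complex \<Rightarrow> 'v::ab_group_add \<Rightarrow> 'v"
  assumes ind: "induced_module M s act1 coact"
  shows "\<exists>act :: 'a \<times> 'b \<Rightarrow> 'v \<Rightarrow> 'v.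
    lie_module D s act \<and> locally_finite s (\<lambda>\<xi>. act (0, \<xi>)) \<and> (\<lambda>X. act (X, 0)) = act1 \<and>
    associated_coaction L2 s (\<lambda>\<xi>. act (0, \<xi>)) coact"
proof -
  have m1: "lie_module L1 s act1" and com: "R_comodule L2 s coact"
    and comp: "\<And>X v. coact (act1 X v) = induced_rhs M s act1 X (coact v)"
    using ind by (auto simp: induced_module_iff)
  note a1 = bilinear_mapD[OF lie_moduleD(1)[OF m1]]
  interpret C: precoaction L2 s coact
    by (rule R_comodule_precoaction[OF com])
  have E_mult: "C.E (x * y) v = C.E x (C.E y v)" and E_1: "C.E 1 v = v" for x y v
    using com by (auto simp: C.comodule_iff)
  define act2 where "act2 \<xi> v = C.E (gen \<xi>) v" for \<xi> v
  have E_minus: "C.E (x - y) v = C.E x v - C.E y v" for x y v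
    using C.E_linear(1)[of "x - y" y v] by simp
  have "uclass L2 (gen (br2 \<xi> \<zeta>)) = uclass L2 (gen \<xi> * gen \<zeta> - gen \<zeta> * gen \<xi>)" for \<xi> \<zeta>
    using uea_ideal_minus[OF uea_rel_bracket[of \<xi> \<zeta> L2]] by (simp add: uclass_eq_iff)
  from C.E_cong[OF this] have bracket: "act2 (br2 \<xi> \<zeta>) v = act2 \<xi> (act2 \<zeta> v) - act2 \<zeta> (act2 \<xi> v)" for \<xi> \<zeta> v
    by (simp add: act2_def E_mult E_minus)
  have add: "act2 (\<xi> + \<zeta>) v = act2 \<xi> v + act2 \<zeta> v" for \<xi> \<zeta> v
    unfolding act2_def C.E_linear(1)[symmetric]
    by (rule C.E_cong) (use uea_rel_add[of \<xi> \<zeta> L2] in \<open>simp add: uclass_eq_iff algebra_simps\<close>)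
  have scale: "act2 (lscale L2 c \<xi>) v = s c (act2 \<xi> v)" for c \<xi> v
    unfolding act2_def C.E_linear(2)[symmetric]
    by (rule C.E_cong) (use uea_rel_scale[of L2 c \<xi>] in \<open>simp add: uclass_eq_iff\<close>)
  have m2: "lie_module L2 s act2"
    unfolding lie_module_def
  proof (intro conjI allI bracket)
    show "bilinear_map (lscale L2) s s act2"
    proof (rule bilinear_mapI[OF scale2 C.vs C.vs])
      show "act2 \<xi> (v + w) = act2 \<xi> v + act2 \<xi> w" "act2 \<xi> (s c v) = s c (act2 \<xi> v)" for \<xi> v w c
        by (simp_all only: act2_def C.E_linear(3,4))
    qed (rule add scale)+
  qed
  interpret A: linear_ops s act2 by (rule lie_module_linear_ops[OF m2])
  have word_ext: "word_ext s act2 x v = C.E x v" for x v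
  proof (induction x rule: free_alg_induct)
    case (word w)
    show ?case
    proof (induction w)
      case (Cons \<xi> w)
      have "word_ext s act2 (word (\<xi> # w)) v = act2 \<xi> (C.E (word w) v)"
        using Cons by simp
      also have "\<dots> = C.E (word (\<xi> # w)) v"
        by (simp only: act2_def word_Cons[of \<xi> w] E_mult)
      finally show ?case .
    qed (simp add: E_1)
  qed (simp_all add: A.word_ext_plus A.word_ext_tscale C.E_linear)
  have comm: "act2 \<xi> (act1 X v) = act1 X (act2 \<xi> v) + act1 (\<xi> \<triangleright> X) v + act2 (\<xi> \<triangleleft> X) v" for \<xi> X v
  proof -
    interpret la: linear_ops "lscale L1" "la M" by (rule la_linear_ops)
    have r: "right_mutual (gen \<xi>) X - gen (\<xi> \<triangleleft> X) \<in> uea_ideal L2"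
    proof -
      have "right_mutual 1 X * gen \<xi> + right_mutual 1 (\<xi> \<triangleright> X) \<in> uea_ideal L2"
        by (intro uea_ideal_add uea_ideal_mult_right right_mutual_1)
      from uea_ideal_add[OF right_mutual_snoc[of 1 \<xi> X] this] show ?thesis
        by (simp add: algebra_simps)
    qed
    \<comment> \<open>the compatibility condition, evaluated at \<open>\<xi>\<close>, whose coproduct is \<open>\<xi> \<otimes> 1 + 1 \<otimes> \<xi>\<close>\<close>
    have "act2 \<xi> (act1 X v) = C.evalV (word [\<xi>]) (induced_rhs M s act1 X (coact v))"
      by (simp add: act2_def C.E_def comp)
    also have "\<dots> = act1 (\<xi> \<triangleright> X) (C.E 1 v) + act1 X (C.E (gen \<xi>) v) + C.E (right_mutual (gen \<xi>) X) v"
      unfolding induced_rhs_eval(2)[OF m1 C.coact_in] C.E_def by (simp add: split_sum_Cons)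
    also have "C.E (right_mutual (gen \<xi>) X) v = act2 (\<xi> \<triangleleft> X) v"
      unfolding act2_def using r by (intro C.E_cong) (simp add: uclass_eq_iff)
    finally show ?thesis
      by (simp add: E_1 act2_def algebra_simps)
  qed
  have "locally_finite s act2"
    unfolding locally_finite_def
  proof
    fix v
    let ?W = "range (\<lambda>x. C.E x v)"
    obtain n a f where r: "tensor_rep C.V C.H (coact v) n a f"
      using C.coact_in unfolding vcar_tensor by blast
    have W: "C.subspace ?W"
    proof (rule C.subspaceI)
      show "0 \<in> ?W"
        using C.E_linear(2)[of 0 1 v] by (metis C.scale_zero_left rangeI)
      show "x + y \<in> ?W" if "x \<in> ?W" "y \<in> ?W" for x y
        using that by (auto simp flip: C.E_linear(1))
      show "s c x \<in> ?W" if "x \<in> ?W" for c x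
        using that by (auto simp flip: C.E_linear(2))
    qed
    have sub: "?W \<subseteq> C.span (a ` {..<n})"
    proof
      fix w assume "w \<in> ?W"
      then obtain x where "w = C.E x v" by blast
      then have w: "w = (\<Sum>i<n. s (f i (uclass L2 x)) (a i))"
        by (simp add: C.E_def eval_rep[OF C.V_space r])
      show "w \<in> C.span (a ` {..<n})"
        unfolding w by (intro C.span_sum C.span_scale C.span_base) auto
    qed
    obtain B where B: "B \<subseteq> ?W" "C.independent B" "?W \<subseteq> C.span B"
      using C.maximal_independent_subset[of ?W] by blast
    have "finite B"
      using C.independent_span_bound[of "a ` {..<n}" B] B(1,2) sub by auto
    moreover have "?W = C.span B"
      using B(1,3) C.span_minimal[OF B(1) W] by blast
    moreover have "v \<in> ?W"
      using E_1[of v] by (metis rangeI)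
    moreover have "act2 \<xi> w \<in> ?W" if "w \<in> ?W" for \<xi> w
      using that by (auto simp: act2_def simp flip: E_mult)
    ultimately show "\<exists>W. C.subspace W \<and> (\<forall>x. \<forall>w\<in>W. act2 x w \<in> W) \<and> v \<in> W \<and> (\<exists>B. finite B \<and> W = C.span B)"
      using W by blast
  qed
  moreover have "associated_coaction L2 s act2 coact"
    unfolding associated_coaction_iff[OF m2] by (simp add: C.coact_in word_ext C.E_def)
  moreover have "(\<lambda>\<xi>. (case (0, \<xi>) of (X, \<xi>) \<Rightarrow> \<lambda>v. act1 X v + act2 \<xi> v)) = act2"
    by (simp add: a1 fun_eq_iff)
  moreover have "(\<lambda>X. (case (X, 0) of (X, \<xi>) \<Rightarrow> \<lambda>v. act1 X v + act2 \<xi> v)) = act1"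
    using bilinear_mapD(8)[OF lie_moduleD(1)[OF m2]] by (simp add: fun_eq_iff)
  ultimately show ?thesis
    using lie_module_double_crossed_sumI[OF m1 m2 comm]
    by (intro exI[of _ "\<lambda>(X, \<xi>) v. act1 X v + act2 \<xi> v"]) simp
qed

end

theorem proposition4p1p8:
  fixes M :: "('a::ab_group_add, 'b::ab_group_add) lie_pair"
    and s :: "complex \<Rightarrow> 'v::ab_group_add \<Rightarrow> 'v"
  assumes "matched_pair M"
  shows "(\<forall>act :: 'a \<times> 'b \<Rightarrow> 'v \<Rightarrow> 'v.
            lie_module (double_crossed_sum M) s act \<and> locally_finite s (\<lambda>\<xi>. act (0, \<xi>)) \<longrightarrow>
            (\<exists>!coact. associated_coaction (g2 M) s (\<lambda>\<xi>. act (0, \<xi>)) coact) \<and>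
            (\<forall>coact. associated_coaction (g2 M) s (\<lambda>\<xi>. act (0, \<xi>)) coact \<longrightarrow>
               induced_module M s (\<lambda>X. act (X, 0)) coact)) \<and>
         (\<forall>(act1 :: 'a \<Rightarrow> 'v \<Rightarrow> 'v) coact.
            induced_module M s act1 coact \<longrightarrow>
            (\<exists>act :: 'a \<times> 'b \<Rightarrow> 'v \<Rightarrow> 'v.
               lie_module (double_crossed_sum M) s act \<and> locally_finite s (\<lambda>\<xi>. act (0, \<xi>)) \<and>
               (\<lambda>X. act (X, 0)) = act1 \<and>
               associated_coaction (g2 M) s (\<lambda>\<xi>. act (0, \<xi>)) coact))"
proof -
  interpret matched M
    by (rule matched.intro[OF assms])
  show ?thesis
  proof (intro conjI allI impI; (elim conjE)?)
    fix act :: "'a \<times> 'b \<Rightarrow> 'v \<Rightarrow> 'v"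
    assume act: "lie_module D s act" "locally_finite s (\<lambda>\<xi>. act (0, \<xi>))"
    show "\<exists>!coact. associated_coaction L2 s (\<lambda>\<xi>. act (0, \<xi>)) coact"
      by (rule ex1_associated_coaction[OF act])
    show "induced_module M s (\<lambda>X. act (X, 0)) coact"
      if "associated_coaction L2 s (\<lambda>\<xi>. act (0, \<xi>)) coact" for coact
      by (rule associated_coaction_induced[OF act(1) that])
  next
    fix act1 coact
    assume "induced_module M s act1 coact"
    then show "\<exists>act. lie_module D s act \<and> locally_finite s (\<lambda>\<xi>. act (0, \<xi>)) \<and>
      (\<lambda>X. act (X, 0)) = act1 \<and> associated_coaction L2 s (\<lambda>\<xi>. act (0, \<xi>)) coact"
      by (rule induced_module_arises)
  qed
qed

end
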